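(* Let $x:\mathcal{L}\to\hat{\mathbb{C}}$ satisfy the dSKP recurrence, let $h$ be a height function, and let $a_{i,j}=x(i,j,h(i,j))$ for $(i,j)\in\mathbb{Z}^2$. Then for every point $p\in\mathcal{U}_h$, $$x(p)=Y(G_p,a),$$ where $G_p$ is the crosses-and-wrenches graph corresponding to $p$ (with face weights $a$).
   Context: $\hat{\mathbb{C}}=\mathbb{C}\cup\{\infty\}$. $\mathcal{L}=\{(i,j,k)\in\mathbb{Z}^3:i+j+k\in2\mathbb{Z}\}$; $(e_1,e_2,e_3)$ the canonical basis. $x:\mathcal{L}\to\hat{\mathbb{C}}$ satisfies the dSKP recurrence if for every $p\in\mathbb{Z}^3\setminus\mathcal{L}$, with $x_q=x(p+q)$: $\frac{(x_{-e_3}-x_{e_2})(x_{-e_1}-x_{e_3})(x_{-e_2}-x_{e_1})}{(x_{e_2}-x_{-e_1})(x_{e_3}-x_{-e_2})(x_{e_1}-x_{-e_3})}=-1$. Height function: $h:\mathbb{Z}^2\to\mathbb{Z}$ with $(i,j,h(i,j))\in\mathcal{L}$ for all $(i,j)$, $|h(i,j)-h(i',j')|=1$ for neighbours in $\mathbb{Z}^2$, and $h(i,j)+|i|+|j|\to\infty$ as $|i|+|j|\to\infty$. Let $\mathcal{I}_h=\{(i,j,h(i,j))\}$, $\mathcal{U}_h=\{(i,j,k)\in\mathcal{L}:k>h(i,j)\}$, and for $p=(i,j,k)$, $\mathring{\mathcal C}_p=\{(i',j',k')\in\mathcal{L}:k'<k-|i-i'|-|j-j'|\}$. Crosses-and-wrenches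 graph: the infinite planar graph $\mathcal G$ has one face for each $(i,j)\in\mathbb{Z}^2$, "centred" at $(i,j)$. For each unit square of $\mathbb{Z}^2$, its four corners give four faces meeting there: if both pairs of diagonally opposite corners have equal heights, the four faces meet at a single vertex of degree 4 (a cross); otherwise one diagonal pair has common height $h_0$ and the other has heights $h_0-1$, $h_0+1$, and one puts a wrench: an edge with two endpoints of degree 3, this edge separating the two faces of height $h_0$. $\mathcal G$ is bipartite. For $p\in\mathcal{U}_h$, $G_p$ is the finite subgraph whose internal faces are the faces $(i,j)$ with $(i,j,h(i,j))\in\mathring{\mathcal C}_p$, whose edges and vertices are those of $\mathcal G$ lying on at least one of these faces, and whose open faces are the faces of $\mathcal G$ sharing some but not all of their edges with $G_p$. The degree $d(f)$ of a face $f$ is the number of edges of $G_p$ adjacent to $f$. Face $(i,j)$ gets weight $a_{i,j}$. For a finite bipartite planar graph $G$ with vertex set $V=W\sqcup B$ ($|W|=|B|$), internal faces $F^i$, open faces $F^o$, face weights $a$: $f(\vec e)$ is the face to the right of the directed edge $\vec e$. A Kasteleyn orientation is a skew-symmetric $\varphi$ from directed edges to $\{\pm1\}$ with $\prod_{wb\in\partial f}\varphi_{(w,b)}=(-1)^{\ell+1}$ for every internal face $f$ of degree $2\ell$. $Z(G,a,\varphi)=\sum_{\vec{\mathsf M}}\prod_{\vec e\in\vec{\mathsf M}}\varphi_{\vec e}a_{f(\vec e)}$, summed over sets $\vec{\mathsf M}$ of directed edges whose undirected versions form perfect matchings. The ratio function of oriented dimers is $$Y(G,a)=i^{|V|}\prod_{f\in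 F^i}a_f^{\frac{d(f)}2-1}\prod_{f\in F^o}a_f^{\lceil\frac{d(f)}2\rceil}\cdot\frac{Z(G,a^{-1},\varphi)}{Z(G,a,\varphi)},$$ where $a^{-1}=(a_f^{-1})_f$; it does not depend on the choice of $\varphi$.
   Formalization: The formal statement assumes that the right-hand side Y(G_p,a) is defined, i.e. not of the form 0/0; it can be 0/0 for some solutions, e.g. x(i,j,k)=g(i+j,k) with g injective. Y at weights 0 and ∞ is the continuous extension of the formula. *)

theory Defs
  imports "HOL-Analysis.Analysis"
begin

text \<open>\<open>None\<close> is the point at infinity.\<close>

type_synonym sphere = "complex option"

text \<open>Representatives in homogeneous coordinates, \<open>[z : 1]\<close> and \<open>[1 : 0]\<close>.\<close>

fun homog :: "sphere \<Rightarrow> complex \<times> complex" where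
  "homog (Some z) = (z, 1)"
| "homog None = (1, 0)"

definition of_homog :: "complex \<times> complex \<Rightarrow> sphere" where
  "of_homog w = (if snd w = 0 then None else Some (fst w / snd w))"

text \<open>
  The difference of two points of the sphere, as the determinant of their representatives.
  For finite points it is the ordinary difference. In a ratio of products of differences in which
  every point occurs equally often above and below, as in the dSKP equation, the choice of the
  representatives cancels: the ratio is the usual continuous extension to infinite arguments.
\<close>

definition sdiff :: "sphere \<Rightarrow> sphere \<Rightarrow> complex" where
  "sdiff z w = fst (homog z) * snd (homog w) - fst (homog w) * snd (homog z)"

lemma sdiff_finite [simp]: "sdiff (Some z) (Some w) = z - w"
  by (simp add: sdiff_def)

type_synonym point = "int \<times> int \<times> int"
type_synonym face = "int \<times> int"

definition even_lattice :: "point set" where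
  "even_lattice = {(i, j, k). even (i + j + k)}"

definition e1 :: point where "e1 = (1, 0, 0)"
definition e2 :: point where "e2 = (0, 1, 0)"
definition e3 :: point where "e3 = (0, 0, 1)"

text \<open>
  Only the values of \<open>x\<close> on \<^const>\<open>even_lattice\<close> matter. As division by zero yields zero, the
  equation includes that the denominator (and hence the numerator) does not vanish.
\<close>

definition dSKP :: "(point \<Rightarrow> sphere) \<Rightarrow> bool" where
  "dSKP x \<longleftrightarrow> (\<forall>p. p \<notin> even_lattice \<longrightarrow>
     (sdiff (x (p - e3)) (x (p + e2)) * sdiff (x (p - e1)) (x (p + e3)) * sdiff (x (p - e2)) (x (p + e1))) /
     (sdiff (x (p + e2)) (x (p - e1)) * sdiff (x (p + e3)) (x (p - e2)) * sdiff (x (p + e1)) (x (p - e3)))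
     = -1)"

definition height_function :: "(face \<Rightarrow> int) \<Rightarrow> bool" where
  "height_function h \<longleftrightarrow>
     (\<forall>i j. (i, j, h (i, j)) \<in> even_lattice) \<and>
     (\<forall>i j i' j'. \<bar>i - i'\<bar> + \<bar>j - j'\<bar> = 1 \<longrightarrow> \<bar>h (i, j) - h (i', j')\<bar> = 1) \<and>
     filterlim (\<lambda>(i, j). h (i, j) + \<bar>i\<bar> + \<bar>j\<bar>) at_top (filtercomap (\<lambda>(i, j). \<bar>i\<bar> + \<bar>j\<bar>) at_top)"

definition upper_region :: "(face \<Rightarrow> int) \<Rightarrow> point set" where
  "upper_region h = {(i, j, k) \<in> even_lattice. k > h (i, j)}"

fun open_cone :: "point \<Rightarrow> point set" where
  "open_cone (i, j, k) = {(i', j', k') \<in> even_lattice. k' < k - \<bar>i - i'\<bar> - \<bar>j - j'\<bar>}"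

text \<open>
  The combinatorial data of a finite planar graph with internal and open faces. Each edge is
  represented by its two directed versions; \<open>right_face\<close> is the face to the right of a directed edge.
\<close>

record ('v, 'f) face_graph =
  vertices :: "'v set"
  dir_edges :: "('v \<times> 'v) set"
  right_face :: "'v \<times> 'v \<Rightarrow> 'f"
  internal_faces :: "'f set"
  open_faces :: "'f set"

definition face_degree :: "('v, 'f) face_graph \<Rightarrow> 'f \<Rightarrow> nat" where
  "face_degree G f = card {{u, v} | u v. (u, v) \<in> dir_edges G \<and> right_face G (u, v) = f}"

definition face_boundary :: "('v, 'f) face_graph \<Rightarrow> 'f \<Rightarrow> ('v \<times> 'v) set" where
  "face_boundary G f = {e \<in> dir_edges G. right_face G e = f \<or> right_face G (prod.swap e) = f}"

definition bipartition :: "('v, 'f) face_graph \<Rightarrow> 'v set \<Rightarrow> bool" where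
  "bipartition G W \<longleftrightarrow> W \<subseteq> vertices G \<and> (\<forall>(u, v) \<in> dir_edges G. u \<in> W \<longleftrightarrow> v \<notin> W)"

text \<open>
  The white vertices \<open>W\<close> need not be recorded in the graph: reversing all edges of a cycle of even
  length does not change the product, so that any proper 2-colouring gives the same condition.
\<close>

definition Kasteleyn_orientation :: "('v, 'f) face_graph \<Rightarrow> ('v \<times> 'v \<Rightarrow> complex) \<Rightarrow> bool" where
  "Kasteleyn_orientation G \<phi> \<longleftrightarrow>
     (\<forall>e \<in> dir_edges G. \<phi> e \<in> {1, -1} \<and> \<phi> (prod.swap e) = - \<phi> e) \<and>
     (\<exists>W. bipartition G W \<and>
        (\<forall>f \<in> internal_faces G.
           (\<Prod>e \<in> {(w, b) \<in> face_boundary G f. w \<in> W}. \<phi> e) = (-1) ^ (face_degree G f div 2 + 1)))"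

text \<open>The condition also excludes that an edge is taken in both directions.\<close>

definition oriented_dimers :: "('v, 'f) face_graph \<Rightarrow> ('v \<times> 'v) set set" where
  "oriented_dimers G =
     {M. M \<subseteq> dir_edges G \<and> (\<forall>v \<in> vertices G. \<exists>!e. e \<in> M \<and> (fst e = v \<or> snd e = v))}"

definition dimer_Z ::
  "('v, 'f) face_graph \<Rightarrow> ('f \<Rightarrow> complex) \<Rightarrow> ('v \<times> 'v \<Rightarrow> complex) \<Rightarrow> complex" where
  "dimer_Z G a \<phi> = (\<Sum>M \<in> oriented_dimers G. \<Prod>e \<in> M. \<phi> e * a (right_face G e))"

definition ratio_prefactor :: "('v, 'f) face_graph \<Rightarrow> ('f \<Rightarrow> complex) \<Rightarrow> complex" where
  "ratio_prefactor G a =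
     (\<Prod>f \<in> internal_faces G. a f powi (int (face_degree G f) div 2 - 1)) *
     (\<Prod>f \<in> open_faces G. a f powi \<lceil>real (face_degree G f) / 2\<rceil>)"

definition ratio_formula ::
  "('v, 'f) face_graph \<Rightarrow> ('f \<Rightarrow> complex) \<Rightarrow> ('v \<times> 'v \<Rightarrow> complex) \<Rightarrow> complex" where
  "ratio_formula G a \<phi> =
     \<i> ^ card (vertices G) * ratio_prefactor G a * (dimer_Z G (\<lambda>f. inverse (a f)) \<phi> / dimer_Z G a \<phi>)"

text \<open>
  For arbitrary weights on the sphere, the ratio function is understood as a rational function in the
  weights. For weights \<open>a\<^sub>f = [u\<^sub>f : v\<^sub>f]\<close> with nonzero \<open>u\<^sub>f\<close> and \<open>v\<^sub>f\<close>, the numerator and the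
  denominator of \<^const>\<open>ratio_formula\<close>, both multiplied by the prefactor evaluated at \<open>v\<close>, are the
  two components below. For the graphs \<open>cw_graph h p\<close> they are homogeneous polynomials in each
  \<open>(u\<^sub>f, v\<^sub>f)\<close> (the apparent negative powers cancel because \<open>\<phi>\<close> is a Kasteleyn orientation), and so
  they extend to weights \<open>0\<close> and \<open>\<infinity>\<close> by continuity.
\<close>

definition ratio_fraction ::
  "('v, 'f) face_graph \<Rightarrow> ('v \<times> 'v \<Rightarrow> complex) \<Rightarrow> ('f \<Rightarrow> complex \<times> complex) \<Rightarrow> complex \<times> complex" where
  "ratio_fraction G \<phi> w =
     (\<i> ^ card (vertices G) * ratio_prefactor G (\<lambda>f. fst (w f)) * dimer_Z G (\<lambda>f. snd (w f) / fst (w f)) \<phi>,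
      ratio_prefactor G (\<lambda>f. snd (w f)) * dimer_Z G (\<lambda>f. fst (w f) / snd (w f)) \<phi>)"

definition ratio_coords ::
  "('v, 'f) face_graph \<Rightarrow> ('f \<Rightarrow> sphere) \<Rightarrow> ('v \<times> 'v \<Rightarrow> complex) \<Rightarrow> complex \<times> complex" where
  "ratio_coords G a \<phi> =
     Lim (at (\<lambda>f. homog (a f)) within {w. \<forall>f. fst (w f) \<noteq> 0 \<and> snd (w f) \<noteq> 0}) (ratio_fraction G \<phi>)"

text \<open>
  Another choice of \<open>\<phi>\<close> multiplies both coordinates by the same sign. The value is defined
  unless it is of the form \<open>0/0\<close>.
\<close>

definition ratio_defined :: "('v, 'f) face_graph \<Rightarrow> ('f \<Rightarrow> sphere) \<Rightarrow> bool" where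
  "ratio_defined G a \<longleftrightarrow> ratio_coords G a (SOME \<phi>. Kasteleyn_orientation G \<phi>) \<noteq> (0, 0)"

definition ratio_function :: "('v, 'f) face_graph \<Rightarrow> ('f \<Rightarrow> sphere) \<Rightarrow> sphere" where
  "ratio_function G a = of_homog (ratio_coords G a (SOME \<phi>. Kasteleyn_orientation G \<phi>))"

lemma ratio_coords_finite:
  fixes a :: "'f \<Rightarrow> complex"
  assumes nz: "\<And>f. a f \<noteq> 0"
  shows "ratio_coords G (\<lambda>f. Some (a f)) \<phi> =
    (\<i> ^ card (vertices G) * ratio_prefactor G a * dimer_Z G (\<lambda>f. inverse (a f)) \<phi>, dimer_Z G a \<phi>)"
proof -
  define S where "S = {w :: 'f \<Rightarrow> complex \<times> complex. \<forall>f. fst (w f) \<noteq> 0 \<and> snd (w f) \<noteq> 0}"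
  define w0 where "w0 = (\<lambda>f. (a f, 1 :: complex))"
  define g where "g = (\<lambda>t f. (a f * t, 1 :: complex))"
  have cont: "continuous_on UNIV g"
    unfolding g_def
    by (intro continuous_on_coordinatewise_then_product continuous_intros)
  have "w0 islimpt S"
  proof (rule islimptI)
    fix T assume T: "w0 \<in> T" "open T"
    have "open (g -` T)"
      using cont T(2) by (simp add: continuous_on_open_vimage)
    moreover have "1 \<in> g -` T"
      using T(1) by (simp add: g_def w0_def)
    ultimately obtain \<epsilon> where e: "\<epsilon> > 0" "ball 1 \<epsilon> \<subseteq> g -` T"
      by (meson open_contains_ball)
    define t where "t = (1 + of_real (\<epsilon> / 2) :: complex)"
    have "t \<in> ball 1 \<epsilon>"
      using e(1) by (simp add: t_def dist_norm)
    then have "g t \<in> T"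
      using e(2) by blast
    have t: "t = of_real (1 + \<epsilon> / 2)"
      by (simp add: t_def)
    have t0: "t \<noteq> 0" "t \<noteq> 1"
      unfolding t of_real_eq_0_iff of_real_eq_1_iff using e(1) by linarith+
    have "g t \<noteq> w0"
    proof
      assume "g t = w0"
      then have "a f * t = a f" for f
        by (metis g_def w0_def fst_conv)
      then show False
        using nz t0 by simp
    qed
    moreover have "g t \<in> S"
      using nz t0 by (simp add: S_def g_def)
    ultimately show "\<exists>y\<in>S. y \<in> T \<and> y \<noteq> w0"
      using \<open>g t \<in> T\<close> by blast
  qed
  then have nontriv: "at w0 within S \<noteq> bot"
    by (simp add: trivial_limit_within)
  have coord: "((\<lambda>w. w f) \<longlongrightarrow> w0 f) (at w0 within S)" for f
    using continuous_on_product_coordinates[of f]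
    by (metis UNIV_I continuous_on_def tendsto_within_subset top_greatest)
  have c1: "((\<lambda>w. fst (w f)) \<longlongrightarrow> a f) (at w0 within S)" for f
    using tendsto_fst[OF coord[of f]] by (simp add: w0_def)
  have c2: "((\<lambda>w. snd (w f)) \<longlongrightarrow> 1) (at w0 within S)" for f
    using tendsto_snd[OF coord[of f]] by (simp add: w0_def)
  have "(ratio_fraction G \<phi> \<longlongrightarrow>
     (\<i> ^ card (vertices G) * ratio_prefactor G a * dimer_Z G (\<lambda>f. 1 / a f) \<phi>,
      ratio_prefactor G (\<lambda>f. 1) * dimer_Z G (\<lambda>f. a f / 1) \<phi>)) (at w0 within S)"
    unfolding ratio_fraction_def ratio_prefactor_def dimer_Z_def
    by (intro tendsto_intros c1 c2) (simp_all add: nz)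
  then have "Lim (at w0 within S) (ratio_fraction G \<phi>) =
     (\<i> ^ card (vertices G) * ratio_prefactor G a * dimer_Z G (\<lambda>f. inverse (a f)) \<phi>, dimer_Z G a \<phi>)"
    by (simp add: tendsto_Lim nontriv ratio_prefactor_def inverse_eq_divide)
  then show ?thesis
    by (simp add: ratio_coords_def S_def w0_def)
qed

text \<open>For finite nonzero weights, the value is given by the formula itself.\<close>

lemma ratio_function_finite:
  fixes a :: "'f \<Rightarrow> complex"
  assumes "\<And>f. a f \<noteq> 0" and "dimer_Z G a (SOME \<phi>. Kasteleyn_orientation G \<phi>) \<noteq> 0"
  shows "ratio_defined G (\<lambda>f. Some (a f))"
    and "ratio_function G (\<lambda>f. Some (a f)) =
           Some (ratio_formula G a (SOME \<phi>. Kasteleyn_orientation G \<phi>))"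
  using assms
  by (simp_all add: ratio_defined_def ratio_function_def of_homog_def ratio_coords_finite ratio_formula_def)

text \<open>
  A vertex is represented by the set of the faces that meet at it: the four corners of a unit square
  for a cross. If the corners have heights \<open>h\<^sub>0, h\<^sub>0, h\<^sub>0 - 1, h\<^sub>0 + 1\<close>, the endpoints of the wrench are
  all corners but the one of height \<open>h\<^sub>0 + 1\<close>, and all corners but the one of height \<open>h\<^sub>0 - 1\<close>.
\<close>

type_synonym cw_vertex = "face set"

fun unit_square :: "face \<Rightarrow> face set" where
  "unit_square (i, j) = {i, i + 1} \<times> {j, j + 1}"

fun opposite_corner :: "face \<Rightarrow> face \<Rightarrow> face" where
  "opposite_corner (i, j) (k, l) = (2 * i + 1 - k, 2 * j + 1 - l)"

definition square_vertices :: "(face \<Rightarrow> int) \<Rightarrow> face \<Rightarrow> cw_vertex set" where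
  "square_vertices h q =
     (if \<forall>f \<in> unit_square q. h (opposite_corner q f) = h f
      then {unit_square q}
      else {unit_square q - {f} | f. f \<in> unit_square q \<and> h (opposite_corner q f) \<noteq> h f})"

definition cw_vertices :: "(face \<Rightarrow> int) \<Rightarrow> cw_vertex set" where
  "cw_vertices h = (\<Union>q. square_vertices h q)"

text \<open>
  Two vertices are joined by an edge iff they have exactly two faces in common; these are the two
  faces separated by the edge. The edges are the wrenches, and one edge for each pair of neighbouring
  faces, between the two unit squares that contain this pair.
\<close>

definition cw_edges :: "(face \<Rightarrow> int) \<Rightarrow> (cw_vertex \<times> cw_vertex) set" where
  "cw_edges h = {(u, v). u \<in> cw_vertices h \<and> v \<in> cw_vertices h \<and> card (u \<inter> v) = 2}"

text \<open>
  The graph is drawn with straight edges, each vertex being placed at the barycentre of (the centres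
  of) its faces. The right-hand side of a directed edge is where the cross product with its direction
  is negative.
\<close>

definition cw_pos :: "cw_vertex \<Rightarrow> real \<times> real" where
  "cw_pos u = ((\<Sum>f\<in>u. real_of_int (fst f)) / card u, (\<Sum>f\<in>u. real_of_int (snd f)) / card u)"

definition right_of :: "real \<times> real \<Rightarrow> real \<times> real \<Rightarrow> real \<times> real \<Rightarrow> bool" where
  "right_of P Q R \<longleftrightarrow>
     (fst Q - fst P) * (snd R - snd P) - (snd Q - snd P) * (fst R - fst P) < 0"

definition cw_right :: "cw_vertex \<times> cw_vertex \<Rightarrow> face" where
  "cw_right e = (THE f. f \<in> fst e \<inter> snd e \<and>
     right_of (cw_pos (fst e)) (cw_pos (snd e)) (real_of_int (fst f), real_of_int (snd f)))"

definition cw_internal :: "(face \<Rightarrow> int) \<Rightarrow> point \<Rightarrow> face set" where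
  "cw_internal h p = {(i, j). (i, j, h (i, j)) \<in> open_cone p}"

definition cw_sub_edges :: "(face \<Rightarrow> int) \<Rightarrow> point \<Rightarrow> (cw_vertex \<times> cw_vertex) set" where
  "cw_sub_edges h p =
     {e \<in> cw_edges h. cw_right e \<in> cw_internal h p \<or> cw_right (prod.swap e) \<in> cw_internal h p}"

definition cw_open :: "(face \<Rightarrow> int) \<Rightarrow> point \<Rightarrow> face set" where
  "cw_open h p = {f. (\<exists>e \<in> cw_edges h. cw_right e = f \<and> e \<in> cw_sub_edges h p) \<and>
                     (\<exists>e \<in> cw_edges h. cw_right e = f \<and> e \<notin> cw_sub_edges h p)}"

definition cw_graph :: "(face \<Rightarrow> int) \<Rightarrow> point \<Rightarrow> (cw_vertex, face) face_graph" where
  "cw_graph h p =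
     \<lparr>vertices = {v \<in> cw_vertices h. v \<inter> cw_internal h p \<noteq> {}},
      dir_edges = cw_sub_edges h p,
      right_face = cw_right,
      internal_faces = cw_internal h p,
      open_faces = cw_open h p\<rparr>"

end

theory Submission
  imports Defs
begin

text \<open>
  For a suitable Kasteleyn orientation, the partition function is a hafnian in which an edge separating
  the faces \<open>f\<close> and \<open>g\<close> has weight \<open>a\<^sub>f - a\<^sub>g\<close> or \<open>a\<^sub>g - a\<^sub>f\<close>. Raising the height of a lowest internal
  face \<open>f\<close> by 2, and replacing its weight by the next value of the solution, is a spider move. It
  multiplies the partition functions of \<open>a\<close> and of \<open>a\<^sup>-\<^sup>1\<close> by factors whose quotient is the change of
  the prefactor, by the dSKP equation at the octahedron centred above \<open>f\<close>. When no internal face is left,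
  this gives \<open>numerator = x(p) * denominator\<close> for solutions without zeros and poles. Any other
  solution is a limit of such solutions, and numerator and denominator are polynomials in the
  homogeneous coordinates of the weights.
\<close>

section \<open>Hafnians\<close>

text \<open>A vertex is the set of its faces, so adjacency and weight of a pair of vertices depend
  only on their intersection. The hafnian may therefore run over all pairs, and the graph survives
  only as a function of intersections. This shapes the spider move: once the edges around
  \<open>f\<close> are summed out, deleting \<open>f\<close> from the remaining vertices turns a
  cross into the outer end of a wrench, and the graphs before and after the move leave the same
  hafnians, indexed by complementary sets of corners of \<open>f\<close>. What remains is an
  identity between coefficients for each set of corners. The obstacle is vanishing. A solution may
  have equal weights on some neighbouring faces, so the factor of a move and the partition functions
  can be zero. Hence no quotient is formed before the end, the claim is kept as an equation between
  products, and it is transported from the moved graph back to the original one, where a zero factor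
  does no harm. The moves change the quotient of numerator and denominator only once: the last move
  takes place at the apex, and the weight it introduces is the value at \<open>p\<close>.\<close>

definition perfect_matchings :: "'v set \<Rightarrow> 'v set set set" where
  "perfect_matchings V = {M. partition_on V M \<and> (\<forall>e\<in>M. card e = 2)}"

definition hafnian :: "'v set \<Rightarrow> ('v set \<Rightarrow> 'a) \<Rightarrow> 'a::comm_semiring_1" where
  "hafnian V c = (\<Sum>M\<in>perfect_matchings V. \<Prod>e\<in>M. c e)"

lemma finite_perfect_matchings: "finite V \<Longrightarrow> finite (perfect_matchings V)"
  by (rule finite_subset[OF _ finitely_many_partition_on]) (auto simp: perfect_matchings_def)

lemma finite_perfect_matching: "finite V \<Longrightarrow> M \<in> perfect_matchings V \<Longrightarrow> finite M"
  using finite_elements[of V M] by (auto simp: perfect_matchings_def)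

lemma perfect_matching_edge:
  assumes "M \<in> perfect_matchings V" "e \<in> M"
  obtains u v where "e = {u, v}" "u \<noteq> v" "u \<in> V" "v \<in> V"
proof -
  have "card e = 2" "e \<subseteq> V"
    using assms by (auto simp: perfect_matchings_def partition_on_def)
  then show thesis
    using that unfolding card_2_iff by blast
qed

lemma perfect_matching_unique:
  assumes "M \<in> perfect_matchings V" "e \<in> M" "e' \<in> M" "x \<in> e" "x \<in> e'"
  shows "e = e'"
  using assms disjointD[of M e e'] by (auto simp: perfect_matchings_def partition_on_def)

lemma perfect_matchings_empty: "perfect_matchings {} = {{}}"
  by (auto simp: perfect_matchings_def partition_on_empty)

lemma hafnian_empty [simp]: "hafnian {} c = 1"
  by (simp add: hafnian_def perfect_matchings_empty)

lemma hafnian_cong: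
  assumes "\<And>u v. u \<in> V \<Longrightarrow> v \<in> V \<Longrightarrow> u \<noteq> v \<Longrightarrow> c {u, v} = d {u, v}"
  shows "hafnian V c = hafnian V d"
  unfolding hafnian_def using assms by (intro sum.cong prod.cong) (auto elim!: perfect_matching_edge)

lemma perfect_matchings_union:
  assumes "N \<in> perfect_matchings A" "N' \<in> perfect_matchings B" "A \<inter> B = {}"
  shows "N \<union> N' \<in> perfect_matchings (A \<union> B)" "N \<inter> N' = {}"
proof -
  have N: "\<Union>N = A" "disjoint N" "{} \<notin> N" "\<forall>e\<in>N. card e = 2"
    and N': "\<Union>N' = B" "disjoint N'" "{} \<notin> N'" "\<forall>e\<in>N'. card e = 2"
    using assms by (auto simp: perfect_matchings_def partition_on_def)
  have "disjoint (N \<union> N')"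
    using N N' assms(3) by (intro disjoint_union) auto
  then show "N \<union> N' \<in> perfect_matchings (A \<union> B)"
    using N N' by (auto simp: perfect_matchings_def partition_on_def)
  show "N \<inter> N' = {}"
  proof (rule ccontr)
    assume "N \<inter> N' \<noteq> {}"
    then obtain e where e: "e \<in> N" "e \<in> N'" by blast
    then have "e \<subseteq> A" "e \<subseteq> B" using N(1) N'(1) by blast+
    then have "e = {}" using assms(3) by blast
    then show False using e N(3) by blast
  qed
qed

lemma perfect_matchings_sub:
  assumes "M \<in> perfect_matchings V" "N \<subseteq> M"
  shows "N \<in> perfect_matchings (\<Union>N)" "M - N \<in> perfect_matchings (V - \<Union>N)" "\<Union>N \<subseteq> V"
proof -
  have p: "\<Union>M = V" "disjoint M" "{} \<notin> M" "\<forall>e\<in>M. card e = 2"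
    using assms(1) by (auto simp: perfect_matchings_def partition_on_def)
  show "\<Union>N \<subseteq> V" using p assms(2) by blast
  show "N \<in> perfect_matchings (\<Union>N)"
    unfolding perfect_matchings_def partition_on_def mem_Collect_eq
    using pairwise_subset[OF p(2) assms(2)] p(3,4) assms(2) by (intro conjI refl) blast+
  have "\<Union>(M - N) = V - \<Union>N"
  proof -
    have "x \<notin> \<Union>N" if "x \<in> e" "e \<in> M" "e \<notin> N" for x e
    proof
      assume "x \<in> \<Union>N"
      then obtain e' where "x \<in> e'" "e' \<in> N" by blast
      then show False
        using disjointD[OF p(2) that(2), of e'] that assms(2) by auto
    qed
    then show ?thesis unfolding p(1)[symmetric] by auto
  qed
  then show "M - N \<in> perfect_matchings (V - \<Union>N)"
    unfolding perfect_matchings_def partition_on_def mem_Collect_eq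
    using pairwise_subset[OF p(2), of "M - N"] p(3,4) by (intro conjI) blast+
qed

text \<open>The multiplicativity of the exponential generating function of matchings.\<close>

lemma hafnian_add:
  assumes fin: "finite V"
  shows "hafnian V (\<lambda>e. c e + d e) = (\<Sum>A\<in>Pow V. hafnian A c * hafnian (V - A) d)"
proof -
  have "hafnian V (\<lambda>e. c e + d e) =
      (\<Sum>M\<in>perfect_matchings V. \<Sum>N\<in>Pow M. (\<Prod>e\<in>N. c e) * (\<Prod>e\<in>M - N. d e))"
    unfolding hafnian_def using finite_perfect_matching[OF fin] by (intro sum.cong prod_add) auto
  also have "\<dots> = (\<Sum>(M, N)\<in>(SIGMA M:perfect_matchings V. Pow M). (\<Prod>e\<in>N. c e) * (\<Prod>e\<in>M - N. d e))"
    using finite_perfect_matchings[OF fin] finite_perfect_matching[OF fin] by (subst sum.Sigma) auto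
  also have "\<dots> = (\<Sum>(A, N, N')\<in>(SIGMA A:Pow V. perfect_matchings A \<times> perfect_matchings (V - A)).
      (\<Prod>e\<in>N. c e) * (\<Prod>e\<in>N'. d e))"
  proof (rule sum.reindex_bij_witness[where
        i = "\<lambda>(A, N, N'). (N \<union> N', N)" and j = "\<lambda>(M, N). (\<Union>N, N, M - N)"])
    fix a assume "a \<in> (SIGMA M:perfect_matchings V. Pow M)"
    then obtain M N where a: "a = (M, N)" "M \<in> perfect_matchings V" "N \<subseteq> M" by auto
    show "(case case a of (M, N) \<Rightarrow> (\<Union>N, N, M - N) of (A, N, N') \<Rightarrow> (N \<union> N', N)) = a"
      using a by auto
    show "(case a of (M, N) \<Rightarrow> (\<Union>N, N, M - N)) \<in> (SIGMA A:Pow V. perfect_matchings A \<times> perfect_matchings (V - A))"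
      using perfect_matchings_sub[OF a(2,3)] a by auto
    show "(case case a of (M, N) \<Rightarrow> (\<Union>N, N, M - N) of (A, N, N') \<Rightarrow> prod c N * prod d N') =
         (case a of (M, N) \<Rightarrow> prod c N * prod d (M - N))"
      using a by simp
  next
    fix b assume "b \<in> (SIGMA A:Pow V. perfect_matchings A \<times> perfect_matchings (V - A))"
    then obtain A N N' where b: "b = (A, N, N')" "A \<subseteq> V" "N \<in> perfect_matchings A"
      "N' \<in> perfect_matchings (V - A)" by auto
    have u: "N \<union> N' \<in> perfect_matchings V" "N \<inter> N' = {}"
      using perfect_matchings_union[OF b(3,4)] b(2) by (auto simp: Un_absorb1)
    have "\<Union>N = A" using b(3) by (auto simp: perfect_matchings_def partition_on_def)
    then show "(case case b of (A, N, N') \<Rightarrow> (N \<union> N', N) of (M, N) \<Rightarrow> (\<Union>N, N, M - N)) = b"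
      using u b by auto
    show "(case b of (A, N, N') \<Rightarrow> (N \<union> N', N)) \<in> (SIGMA M:perfect_matchings V. Pow M)"
      using u b by auto
  qed
  also have "\<dots> = (\<Sum>A\<in>Pow V. \<Sum>(N, N')\<in>perfect_matchings A \<times> perfect_matchings (V - A).
      (\<Prod>e\<in>N. c e) * (\<Prod>e\<in>N'. d e))"
    using fin by (subst sum.Sigma) (auto simp: finite_subset finite_perfect_matchings)
  also have "\<dots> = (\<Sum>A\<in>Pow V. hafnian A c * hafnian (V - A) d)"
    by (simp add: hafnian_def sum_product sum.cartesian_product)
  finally show ?thesis .
qed

lemma perfect_matchings_pair: "x \<noteq> y \<Longrightarrow> perfect_matchings {x, y} = {{{x, y}}}"
proof -
  assume xy: "x \<noteq> y"
  have "M = {{x, y}}" if "M \<in> perfect_matchings {x, y}" for M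
  proof -
    have "e = {x, y}" if "e \<in> M" for e
      by (rule perfect_matching_edge[OF \<open>M \<in> _\<close> that]) auto
    moreover have "M \<noteq> {}"
      using that by (auto simp: perfect_matchings_def partition_on_def)
    ultimately show ?thesis by blast
  qed
  moreover have "{{x, y}} \<in> perfect_matchings {x, y}"
    using xy by (simp add: perfect_matchings_def partition_on_space)
  ultimately show ?thesis by blast
qed

lemma hafnian_pair [simp]: "x \<noteq> y \<Longrightarrow> hafnian {x, y} c = c {x, y}"
  by (simp add: hafnian_def perfect_matchings_pair)

text \<open>Classifies the perfect matchings by the partner \<open>y\<close> of \<open>x\<close>;
  the rest of such a matching is a perfect matching of \<open>V - {x, y}\<close>.\<close>

lemma hafnian_expand:
  assumes fin: "finite V" and x: "x \<in> V"
  shows "hafnian V c = (\<Sum>y\<in>V - {x}. c {x, y} * hafnian (V - {x, y}) c)"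
proof -
  have "hafnian V c = (\<Sum>(y, N)\<in>(SIGMA y:V - {x}. perfect_matchings (V - {x, y})). c {x, y} * (\<Prod>e\<in>N. c e))"
    unfolding hafnian_def
  proof (rule sum.reindex_bij_witness[where
        j = "\<lambda>M. let y = THE y. {x, y} \<in> M in (y, M - {{x, y}})" and i = "\<lambda>(y, N). insert {x, y} N"], goal_cases)
    have key: "\<exists>y\<in>V - {x}. {x, y} \<in> M \<and> (THE y. {x, y} \<in> M) = y" if M: "M \<in> perfect_matchings V" for M
    proof -
      obtain e where e: "e \<in> M" "x \<in> e"
        using M x by (auto simp: perfect_matchings_def partition_on_def)
      obtain y where y: "e = {x, y}" "y \<noteq> x" "y \<in> V"
        using perfect_matching_edge[OF M e(1)] e(2) by blast
      have "z = y" if "{x, z} \<in> M" for z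
      proof -
        have "{x, z} = {x, y}"
          using perfect_matching_unique[OF M that e(1), of x] y by auto
        then show ?thesis by (metis doubleton_eq_iff)
      qed
      then have "(THE y. {x, y} \<in> M) = y" using e y by blast
      then show ?thesis using y e by auto
    qed
    {
      case (1 M)
      then show ?case using key[OF 1] by (auto simp: Let_def)
    next
      case (2 M)
      then obtain y where y: "y \<in> V - {x}" "{x, y} \<in> M" "(THE y. {x, y} \<in> M) = y" using key by blast
      have "M - {{x, y}} \<in> perfect_matchings (V - {x, y})"
        using perfect_matchings_sub(2)[OF 2, of "{{x, y}}"] y by simp
      then show ?case using y by (simp add: Let_def)
    next
      case (3 b)
      then obtain y N where b: "b = (y, N)" "y \<in> V" "y \<noteq> x" "N \<in> perfect_matchings (V - {x, y})" by auto
      have xy: "{{x, y}} \<in> perfect_matchings {x, y}" using perfect_matchings_pair[of x y] b by simp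
      have V: "{x, y} \<union> (V - {x, y}) = V" using x b by auto
      have N: "insert {x, y} N \<in> perfect_matchings V" "{x, y} \<notin> N"
        using perfect_matchings_union[OF xy b(4)] V by auto
      from key[OF N(1)] obtain z where z: "z \<noteq> x" "{x, z} \<in> insert {x, y} N" "(THE z. {x, z} \<in> insert {x, y} N) = z" by auto
      have "{x, z} \<notin> N" using b(4) by (auto simp: perfect_matchings_def partition_on_def)
      then have "z = y" using z by (auto simp: doubleton_eq_iff)
      then show ?case using N z b by (auto simp: Let_def)
    next
      case (4 b)
      then obtain y N where b: "b = (y, N)" "y \<in> V" "y \<noteq> x" "N \<in> perfect_matchings (V - {x, y})" by auto
      have xy: "{{x, y}} \<in> perfect_matchings {x, y}" using perfect_matchings_pair[of x y] b by simp
      have V: "{x, y} \<union> (V - {x, y}) = V" using x b by auto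
      show ?case
        using perfect_matchings_union[OF xy b(4)] V b by auto
    next
      case (5 M)
      then obtain y where y: "y \<in> V - {x}" "{x, y} \<in> M" "(THE y. {x, y} \<in> M) = y" using key by blast
      then show ?case
        using finite_perfect_matching[OF fin 5] by (simp add: Let_def prod.remove[of M "{x, y}"])
    }
  qed
  also have "\<dots> = (\<Sum>y\<in>V - {x}. \<Sum>N\<in>perfect_matchings (V - {x, y}). c {x, y} * (\<Prod>e\<in>N. c e))"
    using fin by (subst sum.Sigma) (auto simp: finite_perfect_matchings)
  finally show ?thesis by (simp add: hafnian_def sum_distrib_left)
qed

lemma hafnian_isolated:
  assumes "finite V" "x \<in> V" "\<And>y. y \<in> V \<Longrightarrow> y \<noteq> x \<Longrightarrow> c {x, y} = 0"
  shows "hafnian V c = 0"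
  using assms by (simp add: hafnian_expand[of V x])

lemma hafnian_pendant:
  assumes "finite V" "x \<in> V" "y \<in> V" "x \<noteq> y" "\<And>z. z \<in> V \<Longrightarrow> z \<noteq> x \<Longrightarrow> z \<noteq> y \<Longrightarrow> c {x, z} = 0"
  shows "hafnian V c = c {x, y} * hafnian (V - {x, y}) c"
proof -
  have "hafnian V c = (\<Sum>z\<in>V - {x}. if z = y then c {x, y} * hafnian (V - {x, y}) c else 0)"
    unfolding hafnian_expand[OF assms(1,2)] using assms by (intro sum.cong) auto
  then show ?thesis using assms by simp
qed

lemma hafnian_four_cycle:
  assumes "distinct [p, q, r, s]" "c {p, r} = 0" "c {q, s} = 0"
  shows "hafnian {p, q, r, s} c = c {p, q} * c {r, s} + c {q, r} * c {s, p}"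
proof -
  have "{p, q, r, s} - {p} = {q, r, s}" "{p, q, r, s} - {p, q} = {r, s}"
    "{p, q, r, s} - {p, s} = {q, r}"
    using assms by auto
  then show ?thesis
    using assms by (subst hafnian_expand[of _ p]) (auto simp: insert_commute mult.commute)
qed

text \<open>Serves for vertices that are sets of faces: the map will be the deletion of one face
  from each of these sets.\<close>

lemma hafnian_image:
  assumes inj: "inj_on f V"
  shows "hafnian (f ` V) c = hafnian V (\<lambda>e. c (f ` e))"
proof -
  have inj2: "inj_on ((`) f) (Pow V)" using inj by (rule inj_on_image_Pow)
  have sub: "M \<subseteq> Pow V" if "M \<in> perfect_matchings V" for M and V :: "'z set"
    using that by (auto simp: perfect_matchings_def partition_on_def)
  have im: "(`) ((`) f) ` perfect_matchings V = perfect_matchings (f ` V)"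
  proof -
    have 1: "(`) g ` M \<in> perfect_matchings (g ` V)" if "M \<in> perfect_matchings V" "inj_on g V"
      for M V and g :: "'z \<Rightarrow> 'y"
    proof -
      have "partition_on (g ` V) ((`) g ` M)"
        using that partition_on_inj_image[of V M g] unfolding perfect_matchings_def
        by (auto simp: image_iff dest: partition_onD3)
      moreover have "card (g ` e) = 2" if "e \<in> M" for e
        using that \<open>M \<in> _\<close> \<open>inj_on g V\<close> sub[OF \<open>M \<in> _\<close>]
        by (subst card_image) (auto simp: perfect_matchings_def intro: inj_on_subset)
      ultimately show ?thesis by (auto simp: perfect_matchings_def)
    qed
    have "M \<in> (`) ((`) f) ` perfect_matchings V" if M: "M \<in> perfect_matchings (f ` V)" for M
    proof -
      let ?g = "inv_into V f"
      have g: "inj_on ?g (f ` V)" by (simp add: inj_on_inv_into)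
      have "?g ` f ` V = V" using inj by (simp)
      then have "(`) ?g ` M \<in> perfect_matchings V" using 1[OF M g] by simp
      moreover have "f ` ?g ` e = e" if "e \<in> M" for e
        using sub[OF M] that by (auto simp: image_image f_inv_into_f subset_iff intro!: image_eqI)
      then have "(`) f ` (`) ?g ` M = M" by (force simp: image_image)
      ultimately show ?thesis by (metis image_eqI)
    qed
    then have "perfect_matchings (f ` V) \<subseteq> (`) ((`) f) ` perfect_matchings V"
      by (rule subsetI)
    moreover have "(`) ((`) f) ` perfect_matchings V \<subseteq> perfect_matchings (f ` V)"
      using 1[OF _ inj] by (rule image_subsetI)
    ultimately show ?thesis by (rule subset_antisym[rotated])
  qed
  have "inj_on ((`) ((`) f)) (perfect_matchings V)"
    by (rule inj_on_subset[OF inj_on_image_Pow[OF inj2]]) (use sub in auto)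
  then have "hafnian (f ` V) c = (\<Sum>M\<in>perfect_matchings V. \<Prod>e\<in>(`) f ` M. c e)"
    by (simp add: hafnian_def im[symmetric] sum.reindex)
  also have "\<dots> = hafnian V (\<lambda>e. c (f ` e))"
    unfolding hafnian_def
  proof (intro sum.cong refl)
    fix M assume M: "M \<in> perfect_matchings V"
    show "prod c ((`) f ` M) = (\<Prod>e\<in>M. c (f ` e))"
      using inj_on_subset[OF inj2 sub[OF M]] by (simp add: prod.reindex)
  qed
  finally show ?thesis .
qed

text \<open>Every vertex lies in exactly one edge of a perfect matching, so each \<open>g u\<close>
  is collected exactly once.\<close>

lemma hafnian_gauge:
  assumes fin: "finite V"
  shows "hafnian V (\<lambda>e. (\<Prod>u\<in>e. g u) * c e) = (\<Prod>u\<in>V. g u) * hafnian V c"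
proof -
  have "(\<Prod>e\<in>M. (\<Prod>u\<in>e. g u) * c e) = (\<Prod>u\<in>V. g u) * (\<Prod>e\<in>M. c e)" if M: "M \<in> perfect_matchings V" for M
  proof -
    have "(\<Prod>e\<in>M. \<Prod>u\<in>e. g u) = (\<Prod>u\<in>\<Union>M. g u)"
      using M fin by (intro prod.Union_disjoint[symmetric, unfolded comp_def])
        (auto simp: perfect_matchings_def partition_on_def disjoint_def intro: finite_subset)
    moreover have "\<Union>M = V" using M by (auto simp: perfect_matchings_def partition_on_def)
    ultimately show ?thesis by (simp add: prod.distrib)
  qed
  then show ?thesis unfolding hafnian_def by (simp add: sum_distrib_left)
qed

section \<open>The local structure of crosses-and-wrenches graphs\<close>

definition dirs :: "face set" where
  "dirs = {(1, 0), (0, 1), (-1, 0), (0, -1)}"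

fun rot :: "face \<Rightarrow> face" where
  "rot (a, b) = (- b, a)"

text \<open>The endpoint, in the unit square spanned by \<open>\<delta>\<close> and \<open>rot \<delta>\<close> at \<open>f\<close>, of the edge separating
  \<open>f\<close> and \<open>f + \<delta>\<close>.\<close>

definition corner_vertex :: "(face \<Rightarrow> int) \<Rightarrow> face \<Rightarrow> face \<Rightarrow> cw_vertex" where
  "corner_vertex h f \<delta> = {f, f + \<delta>} \<union>
     (if h (f + rot \<delta>) = h (f + \<delta>) then {f + rot \<delta>} else {}) \<union>
     (if h (f + \<delta> + rot \<delta>) = h f then {f + \<delta> + rot \<delta>} else {})"

text \<open>The directed edges with \<open>f\<close> to their right: those separating \<open>f\<close> from a neighbour, and the wrenches
  separating it from a diagonal neighbour.\<close>

definition face_cycle :: "(face \<Rightarrow> int) \<Rightarrow> face \<Rightarrow> (cw_vertex \<times> cw_vertex) set" where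
  "face_cycle h f =
     {(corner_vertex h f \<delta>, corner_vertex h (f + \<delta>) (- \<delta>)) | \<delta>. \<delta> \<in> dirs} \<union>
     {(corner_vertex h (f + rot \<delta>) (- rot \<delta>), corner_vertex h f \<delta>) | \<delta>.
        \<delta> \<in> dirs \<and> h (f + rot \<delta>) \<noteq> h (f + \<delta>)}"

lemma dirs_cases:
  assumes "\<delta> \<in> dirs"
  obtains "\<delta> = (1, 0)" | "\<delta> = (0, 1)" | "\<delta> = (-1, 0)" | "\<delta> = (0, -1)"
  using assms by (auto simp: dirs_def)

lemma dirs_four:
  assumes "\<delta> \<in> dirs" "\<epsilon> \<in> dirs"
  shows "\<epsilon> = \<delta> \<or> \<epsilon> = rot \<delta> \<or> \<epsilon> = - \<delta> \<or> \<epsilon> = - rot \<delta>"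
  using assms by (elim dirs_cases; simp)

lemma rot_rot [simp]: "rot (rot \<delta>) = - \<delta>"
  by (cases \<delta>) simp

lemma rot_minus [simp]: "rot (- \<delta>) = - rot \<delta>"
  by (cases \<delta>) simp

lemma rot_in_dirs [simp]: "rot \<delta> \<in> dirs \<longleftrightarrow> \<delta> \<in> dirs"
  by (cases \<delta>) (auto simp: dirs_def)

lemma minus_in_dirs [simp]: "- \<delta> \<in> dirs \<longleftrightarrow> \<delta> \<in> dirs"
  by (cases \<delta>) (auto simp: dirs_def)

lemma finite_dirs [simp]: "finite dirs"
  by (simp add: dirs_def)

lemma square_distinct:
  assumes "\<delta> \<in> dirs"
  shows "\<delta> \<noteq> 0" "rot \<delta> \<noteq> 0" "\<delta> \<noteq> rot \<delta>" "\<delta> + rot \<delta> \<noteq> 0" "rot \<delta> \<noteq> \<delta>" "rot \<delta> + \<delta> \<noteq> 0"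
  using assms by (auto simp: dirs_def zero_prod_def)

text \<open>Names a unit square at a face by a direction. The case distinctions that follow can then
  be made in terms of \<delta> and \<open>rot \<delta>\<close>, uniformly for the four squares
  around the face, instead of in coordinates.\<close>

fun square_base :: "face \<Rightarrow> face \<Rightarrow> face" where
  "square_base (x, y) (a, b) = (if a = 1 then (x, y) else if b = 1 then (x - 1, y)
     else if a = -1 then (x - 1, y - 1) else (x, y - 1))"

lemma square_base:
  assumes "\<delta> \<in> dirs"
  shows "unit_square (square_base f \<delta>) = {f, f + \<delta>, f + rot \<delta>, f + \<delta> + rot \<delta>}"
    and "opposite_corner (square_base f \<delta>) f = f + \<delta> + rot \<delta>"
    and "opposite_corner (square_base f \<delta>) (f + \<delta> + rot \<delta>) = f"
    and "opposite_corner (square_base f \<delta>) (f + \<delta>) = f + rot \<delta>"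
    and "opposite_corner (square_base f \<delta>) (f + rot \<delta>) = f + \<delta>"
  using assms by (cases f; elim dirs_cases; auto)+

lemma square_base_ex:
  assumes "f \<in> unit_square q"
  obtains \<delta> where "\<delta> \<in> dirs" "q = square_base f \<delta>"
proof -
  obtain i j where q: "q = (i, j)" by fastforce
  then have "f = (i, j) \<or> f = (i + 1, j) \<or> f = (i, j + 1) \<or> f = (i + 1, j + 1)"
    using assms by auto
  then show thesis
    using that[of "(1, 0)"] that[of "(0, 1)"] that[of "(-1, 0)"] that[of "(0, -1)"] q
    by (auto simp: dirs_def)
qed

lemma remove_one_of_four:
  fixes p q r s :: 'a
  shows "{A - {z} | z. z \<in> {p, q, r, s} \<and> P z} =
    (if P p then {A - {p}} else {}) \<union> (if P q then {A - {q}} else {}) \<union>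
    (if P r then {A - {r}} else {}) \<union> (if P s then {A - {s}} else {})"
  by auto

text \<open>The step condition fixes the local structure of the graph. It is a locale of its own
  because everything derived from it is used twice, for the height function before and after a
  flip.\<close>

locale heights =
  fixes h :: "face \<Rightarrow> int"
  assumes step: "\<delta> \<in> dirs \<Longrightarrow> \<bar>h (f + \<delta>) - h f\<bar> = 1"
begin

lemma step_cases:
  assumes "\<delta> \<in> dirs"
  shows "h (f + \<delta>) = h f + 1 \<or> h (f + \<delta>) = h f - 1"
  using step[OF assms, of f] by linarith

text \<open>Opposite corners that differ must differ by 2, and then both other corners have the
  height in between.\<close>

lemma square_heights:
  assumes "\<delta> \<in> dirs"
  shows "h (f + \<delta> + rot \<delta>) = h f \<or> h (f + rot \<delta>) = h (f + \<delta>)"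
  using step[of \<delta> f] step[of "rot \<delta>" f] step[of "rot \<delta>" "f + \<delta>"] step[of \<delta> "f + rot \<delta>"] assms
  by (auto simp: algebra_simps)

lemma square_vertices_base:
  assumes d: "\<delta> \<in> dirs"
  shows "square_vertices h (square_base f \<delta>) =
    (if h (f + \<delta> + rot \<delta>) \<noteq> h f
       then {{f, f + \<delta>, f + rot \<delta>}, {f + \<delta>, f + rot \<delta>, f + \<delta> + rot \<delta>}}
     else if h (f + rot \<delta>) \<noteq> h (f + \<delta>)
       then {{f, f + \<delta>, f + \<delta> + rot \<delta>}, {f, f + rot \<delta>, f + \<delta> + rot \<delta>}}
     else {{f, f + \<delta>, f + rot \<delta>, f + \<delta> + rot \<delta>}})"
proof -
  have diff: "{f, f + \<delta>, f + rot \<delta>, f + \<delta> + rot \<delta>} - {f} = {f + \<delta>, f + rot \<delta>, f + \<delta> + rot \<delta>}"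
    "{f, f + \<delta>, f + rot \<delta>, f + \<delta> + rot \<delta>} - {f + \<delta>} = {f, f + rot \<delta>, f + \<delta> + rot \<delta>}"
    "{f, f + \<delta>, f + rot \<delta>, f + \<delta> + rot \<delta>} - {f + rot \<delta>} = {f, f + \<delta>, f + \<delta> + rot \<delta>}"
    "{f, f + \<delta>, f + rot \<delta>, f + \<delta> + rot \<delta>} - {f + \<delta> + rot \<delta>} = {f, f + \<delta>, f + rot \<delta>}"
    using square_distinct[OF d] by (auto simp: add.assoc)
  have 1: "(\<forall>z\<in>unit_square (square_base f \<delta>). h (opposite_corner (square_base f \<delta>) z) = h z) \<longleftrightarrow>
      h (f + \<delta> + rot \<delta>) = h f \<and> h (f + rot \<delta>) = h (f + \<delta>)"
    by (auto simp: square_base[OF d])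
  have 2: "{unit_square (square_base f \<delta>) - {z} | z. z \<in> unit_square (square_base f \<delta>) \<and>
       h (opposite_corner (square_base f \<delta>) z) \<noteq> h z} =
      (if h (f + \<delta> + rot \<delta>) \<noteq> h f
       then {{f, f + \<delta>, f + rot \<delta>}, {f + \<delta>, f + rot \<delta>, f + \<delta> + rot \<delta>}} else {}) \<union>
      (if h (f + rot \<delta>) \<noteq> h (f + \<delta>)
       then {{f, f + \<delta>, f + \<delta> + rot \<delta>}, {f, f + rot \<delta>, f + \<delta> + rot \<delta>}} else {})"
  proof -
    show ?thesis
      unfolding square_base(1)[OF d] remove_one_of_four diff square_base(2-5)[OF d] by (auto simp: eq_commute)
  qed
  show ?thesis
    unfolding square_vertices_def 1 2 unfolding square_base(1)[OF d] using square_heights[OF d, of f]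
    by (cases "h (f + \<delta> + rot \<delta>) = h f"; cases "h (f + rot \<delta>) = h (f + \<delta>)") simp_all
qed

text \<open>Both formulas concern the same unit square: the edges separating \<open>f\<close> from
  \<open>f + \<delta>\<close> and from \<open>f + rot \<delta>\<close> each have an endpoint there.
  The two endpoints differ only in the middle case, where they are the ends of a wrench between
  \<open>f\<close> and the diagonal face.\<close>

lemma corner_vertex_simps:
  assumes d: "\<delta> \<in> dirs"
  shows "corner_vertex h f \<delta> = (if h (f + \<delta> + rot \<delta>) \<noteq> h f then {f, f + \<delta>, f + rot \<delta>}
     else if h (f + rot \<delta>) \<noteq> h (f + \<delta>) then {f, f + \<delta>, f + \<delta> + rot \<delta>}
     else {f, f + \<delta>, f + rot \<delta>, f + \<delta> + rot \<delta>})"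
    and "corner_vertex h (f + rot \<delta>) (- rot \<delta>) = (if h (f + \<delta> + rot \<delta>) \<noteq> h f then {f, f + \<delta>, f + rot \<delta>}
     else if h (f + rot \<delta>) \<noteq> h (f + \<delta>) then {f, f + rot \<delta>, f + \<delta> + rot \<delta>}
     else {f, f + \<delta>, f + rot \<delta>, f + \<delta> + rot \<delta>})"
  using square_heights[OF d, of f] by (auto simp: corner_vertex_def algebra_simps)

lemma corner_vertex_in: "\<delta> \<in> dirs \<Longrightarrow> corner_vertex h f \<delta> \<in> cw_vertices h"
  using square_vertices_base[of \<delta> f] corner_vertex_simps(1)[of \<delta> f]
  unfolding cw_vertices_def by (intro UN_I[of "square_base f \<delta>"]) auto

lemma cw_vertex_cases:
  assumes "u \<in> cw_vertices h" "f \<in> u"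
  obtains \<delta> where "\<delta> \<in> dirs" "u \<in> {corner_vertex h f \<delta>, corner_vertex h (f + rot \<delta>) (- rot \<delta>)}"
proof -
  obtain q where q: "u \<in> square_vertices h q" using assms(1) by (auto simp: cw_vertices_def)
  then have "f \<in> unit_square q"
    using assms(2) by (auto simp: square_vertices_def split: if_splits)
  then obtain \<delta> where d: "\<delta> \<in> dirs" "q = square_base f \<delta>" by (rule square_base_ex)
  have "u \<noteq> {f + \<delta>, f + rot \<delta>, f + \<delta> + rot \<delta>}"
    using assms(2) square_distinct[OF d(1)] by (auto simp: add.assoc)
  then have "u \<in> {corner_vertex h f \<delta>, corner_vertex h (f + rot \<delta>) (- rot \<delta>)}"
    using q unfolding d(2) square_vertices_base[OF d(1)] corner_vertex_simps[OF d(1), of f]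
    by (auto split: if_splits)
  then show thesis using that d(1) by blast
qed

lemma cw_vertex_obtain:
  assumes "u \<in> cw_vertices h"
  obtains f \<delta> where "\<delta> \<in> dirs" "u = corner_vertex h f \<delta>"
proof -
  obtain q where q: "u \<in> square_vertices h q" using assms(1) by (auto simp: cw_vertices_def)
  have "u \<noteq> {}"
  proof
    assume "u = {}"
    then have "{} \<in> square_vertices h (square_base q (1, 0))" using q by (cases q) auto
    then show False by (subst (asm) square_vertices_base) (auto simp: dirs_def split: if_splits)
  qed
  then obtain f where "f \<in> u" by blast
  then show thesis
    using cw_vertex_cases[OF assms] that by (metis insert_iff minus_in_dirs rot_in_dirs singletonD)
qed

lemma card_cw_vertex:
  assumes "u \<in> cw_vertices h" shows "card u \<ge> 3"
proof -
  obtain f \<delta> where d: "\<delta> \<in> dirs" "u = corner_vertex h f \<delta>" using assms by (rule cw_vertex_obtain)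
  show ?thesis
    unfolding d(2) corner_vertex_simps[OF d(1)] using square_distinct[OF d(1)] by (auto simp: add.assoc)
qed

lemma corner_mem:
  assumes "\<delta> \<in> dirs"
  shows "f \<in> corner_vertex h f \<delta>" "f + \<delta> \<in> corner_vertex h f \<delta>"
  by (auto simp: corner_vertex_def)

text \<open>Two squares contain both faces, one on each side of their common edge. Within a square
  only one vertex contains both, because the ends of a wrench share only a diagonal pair.\<close>

lemma vertex_of_neighbours:
  assumes "u \<in> cw_vertices h" "f \<in> u" "f + \<delta> \<in> u" "\<delta> \<in> dirs"
  shows "u = corner_vertex h f \<delta> \<or> u = corner_vertex h (f + \<delta>) (- \<delta>)"
proof -
  obtain \<epsilon> where e: "\<epsilon> \<in> dirs" "u \<in> {corner_vertex h f \<epsilon>, corner_vertex h (f + rot \<epsilon>) (- rot \<epsilon>)}"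
    using cw_vertex_cases[OF assms(1,2)] .
  have "f + \<delta> \<in> {f, f + \<epsilon>, f + rot \<epsilon>, f + \<epsilon> + rot \<epsilon>}"
    using e assms(3) corner_vertex_simps[OF e(1), of f] by (auto split: if_splits)
  then have "\<delta> = 0 \<or> \<delta> = \<epsilon> \<or> \<delta> = rot \<epsilon> \<or> \<delta> = \<epsilon> + rot \<epsilon>"
    by (simp add: add.assoc)
  then have "\<delta> = \<epsilon> \<or> \<delta> = rot \<epsilon>"
    using assms(4) e(1) by (elim dirs_cases; simp add: zero_prod_def)
  moreover have "corner_vertex h f \<epsilon> = corner_vertex h (f + rot \<epsilon>) (- rot \<epsilon>)" if "f + \<epsilon> \<in> u \<and> f + rot \<epsilon> \<in> u"
  proof (cases "h (f + \<epsilon> + rot \<epsilon>) = h f \<and> h (f + rot \<epsilon>) \<noteq> h (f + \<epsilon>)")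
    case True
    then have "u \<in> {{f, f + \<epsilon>, f + \<epsilon> + rot \<epsilon>}, {f, f + rot \<epsilon>, f + \<epsilon> + rot \<epsilon>}}"
      using e(2) by (simp add: corner_vertex_simps[OF e(1), of f])
    moreover have "f + rot \<epsilon> \<notin> {f, f + \<epsilon>, f + \<epsilon> + rot \<epsilon>}" "f + \<epsilon> \<notin> {f, f + rot \<epsilon>, f + \<epsilon> + rot \<epsilon>}"
      using square_distinct[OF e(1)] by (auto simp: add.assoc)
    ultimately show ?thesis using that by blast
  qed (auto simp: corner_vertex_simps[OF e(1), of f])
  moreover have "u = corner_vertex h f \<epsilon>" if "f + \<epsilon> \<in> u" "f + rot \<epsilon> \<notin> u"
    using that e corner_mem(1)[of "- rot \<epsilon>" "f + rot \<epsilon>"] by auto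
  moreover have "u = corner_vertex h (f + rot \<epsilon>) (- rot \<epsilon>)" if "f + rot \<epsilon> \<in> u" "f + \<epsilon> \<notin> u"
    using that e corner_mem(2)[of "\<epsilon>" "f"] by auto
  ultimately show ?thesis
    using assms(3) e(2) by (metis insert_iff singletonD)
qed

lemma vertex_of_diagonal:
  assumes "u \<in> cw_vertices h" "f \<in> u" "f + \<delta> + rot \<delta> \<in> u" "\<delta> \<in> dirs"
  shows "u = corner_vertex h f \<delta> \<or> u = corner_vertex h (f + rot \<delta>) (- rot \<delta>)"
proof -
  obtain \<epsilon> where e: "\<epsilon> \<in> dirs" "u \<in> {corner_vertex h f \<epsilon>, corner_vertex h (f + rot \<epsilon>) (- rot \<epsilon>)}"
    using cw_vertex_cases[OF assms(1,2)] .
  have "f + (\<delta> + rot \<delta>) \<in> {f, f + \<epsilon>, f + rot \<epsilon>, f + (\<epsilon> + rot \<epsilon>)}"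
    using e assms(3) corner_vertex_simps[OF e(1), of f] by (auto split: if_splits simp: add.assoc)
  then have "\<delta> = \<epsilon>"
    using e(1) assms(4) by (auto simp: dirs_def zero_prod_def)
  then show ?thesis using e by auto
qed

lemma inter_neighbours:
  assumes d: "\<delta> \<in> dirs"
  shows "corner_vertex h f \<delta> \<inter> corner_vertex h (f + \<delta>) (- \<delta>) = {f, f + \<delta>}"
  using d by (cases f; elim dirs_cases; auto simp: corner_vertex_def)

lemma inter_wrench:
  assumes d: "\<delta> \<in> dirs" and "h (f + rot \<delta>) \<noteq> h (f + \<delta>)"
  shows "corner_vertex h (f + rot \<delta>) (- rot \<delta>) = {f, f + rot \<delta>, f + \<delta> + rot \<delta>}"
    and "corner_vertex h f \<delta> = {f, f + \<delta>, f + \<delta> + rot \<delta>}"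
    and "corner_vertex h (f + rot \<delta>) (- rot \<delta>) \<inter> corner_vertex h f \<delta> = {f, f + \<delta> + rot \<delta>}"
    and "h (f + \<delta> + rot \<delta>) = h f"
proof -
  show e: "h (f + \<delta> + rot \<delta>) = h f" using square_heights[OF d, of f] assms(2) by auto
  show 1: "corner_vertex h (f + rot \<delta>) (- rot \<delta>) = {f, f + rot \<delta>, f + \<delta> + rot \<delta>}"
    and 2: "corner_vertex h f \<delta> = {f, f + \<delta>, f + \<delta> + rot \<delta>}"
    using assms(2) e by (simp_all add: corner_vertex_simps[OF d, of f])
  show "corner_vertex h (f + rot \<delta>) (- rot \<delta>) \<inter> corner_vertex h f \<delta> = {f, f + \<delta> + rot \<delta>}"
    unfolding 1 2 using square_distinct[OF d] by (auto simp: add.assoc)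
qed

section \<open>Positions of the vertices and the right-hand sides of edges\<close>

definition rpt :: "face \<Rightarrow> real \<times> real" where
  "rpt f = (real_of_int (fst f), real_of_int (snd f))"

text \<open>The vectors \<delta> and \<open>rot \<delta>\<close> form a positively oriented
  orthonormal basis, so the cross product is the determinant of the coordinates in it.\<close>

lemma right_of_basis:
  assumes "\<delta> \<in> dirs"
  shows "right_of (rpt f + s *\<^sub>R rpt \<delta> + t *\<^sub>R rpt (rot \<delta>)) (rpt f + s' *\<^sub>R rpt \<delta> + t' *\<^sub>R rpt (rot \<delta>))
      (rpt f + s'' *\<^sub>R rpt \<delta> + t'' *\<^sub>R rpt (rot \<delta>)) \<longleftrightarrow> (s' - s) * (t'' - t) - (t' - t) * (s'' - s) < 0"
  using assms by (cases f; elim dirs_cases; simp add: right_of_def rpt_def algebra_simps)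

lemma cw_pos_square:
  assumes "\<delta> \<in> dirs"
  shows "cw_pos {f, f + \<delta>, f + rot \<delta>} = rpt f + (1 / 3) *\<^sub>R rpt \<delta> + (1 / 3) *\<^sub>R rpt (rot \<delta>)"
    and "cw_pos {f, f + \<delta>, f + \<delta> + rot \<delta>} = rpt f + (2 / 3) *\<^sub>R rpt \<delta> + (1 / 3) *\<^sub>R rpt (rot \<delta>)"
    and "cw_pos {f, f + rot \<delta>, f + \<delta> + rot \<delta>} = rpt f + (1 / 3) *\<^sub>R rpt \<delta> + (2 / 3) *\<^sub>R rpt (rot \<delta>)"
    and "cw_pos {f, f + \<delta>, f + rot \<delta>, f + \<delta> + rot \<delta>} =
      rpt f + (1 / 2) *\<^sub>R rpt \<delta> + (1 / 2) *\<^sub>R rpt (rot \<delta>)"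
  using assms by (cases f; elim dirs_cases; simp add: cw_pos_def rpt_def field_simps)+

text \<open>What matters about the position: the vertex projects into the open segment from
  \<open>f\<close> to \<open>f + \<delta>\<close> and lies strictly on the side of
  \<open>rot \<delta>\<close>.\<close>

lemma cw_pos_corner:
  assumes "\<delta> \<in> dirs"
  obtains s t where "0 < s" "s < 1" "0 < t"
    "cw_pos (corner_vertex h f \<delta>) = rpt f + s *\<^sub>R rpt \<delta> + t *\<^sub>R rpt (rot \<delta>)"
proof -
  let ?P = "\<lambda>s t. cw_pos (corner_vertex h f \<delta>) = rpt f + s *\<^sub>R rpt \<delta> + t *\<^sub>R rpt (rot \<delta>)"
  have "?P (1/3) (1/3) \<or> ?P (2/3) (1/3) \<or> ?P (1/2) (1/2)"
    unfolding corner_vertex_simps(1)[OF assms] by (simp add: cw_pos_square[OF assms])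
  then show thesis
    by (elim disjE) (rule that[rotated 3], assumption, simp_all)+
qed

lemma rpt_add: "rpt (f + g) = rpt f + rpt g" and rpt_minus: "rpt (- f) = - rpt f"
  by (simp_all add: rpt_def)

lemma cw_right_eqI:
  assumes "fst e \<inter> snd e = {f, g}" "right_of (cw_pos (fst e)) (cw_pos (snd e)) (rpt f)"
    "\<not> right_of (cw_pos (fst e)) (cw_pos (snd e)) (rpt g)"
  shows "cw_right e = f"
  unfolding cw_right_def using assms by (intro the_equality) (auto simp: rpt_def)

lemma cw_right_neighbours:
  assumes d: "\<delta> \<in> dirs"
  shows "cw_right (corner_vertex h f \<delta>, corner_vertex h (f + \<delta>) (- \<delta>)) = f"
proof -
  obtain s t where s: "0 < s" "s < 1" "0 < t"
    "cw_pos (corner_vertex h f \<delta>) = rpt f + s *\<^sub>R rpt \<delta> + t *\<^sub>R rpt (rot \<delta>)"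
    using cw_pos_corner[OF d] .
  obtain s' t' where s': "0 < s'" "s' < 1" "0 < t'"
    "cw_pos (corner_vertex h (f + \<delta>) (- \<delta>)) = rpt (f + \<delta>) + s' *\<^sub>R rpt (- \<delta>) + t' *\<^sub>R rpt (rot (- \<delta>))"
    using cw_pos_corner[of "- \<delta>" "f + \<delta>"] d by auto
  have p: "cw_pos (corner_vertex h (f + \<delta>) (- \<delta>)) = rpt f + (1 - s') *\<^sub>R rpt \<delta> + (- t') *\<^sub>R rpt (rot \<delta>)"
    unfolding s'(4) by (simp add: rpt_add rpt_minus algebra_simps)
  have f: "rpt f = rpt f + 0 *\<^sub>R rpt \<delta> + 0 *\<^sub>R rpt (rot \<delta>)"
    and g: "rpt (f + \<delta>) = rpt f + 1 *\<^sub>R rpt \<delta> + 0 *\<^sub>R rpt (rot \<delta>)"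
    by (simp_all add: rpt_add)
  \<comment> \<open>In coordinates, the cross product for \<open>f\<close> is
    \<open>- ((1 - s') * t + s * t')\<close> and the one for \<open>f + \<delta>\<close> is
    \<open>s' * t + (1 - s) * t'\<close>, so these four inequalities decide both signs.\<close>
  have m: "s * t' > 0" "(1 - s') * t > 0" "s' * t > 0" "(1 - s) * t' > 0" using s s' by simp_all
  show ?thesis
  proof (rule cw_right_eqI[where g = "f + \<delta>"])
    show "right_of (cw_pos (fst (corner_vertex h f \<delta>, corner_vertex h (f + \<delta>) (- \<delta>))))
      (cw_pos (snd (corner_vertex h f \<delta>, corner_vertex h (f + \<delta>) (- \<delta>)))) (rpt f)"
      unfolding fst_conv snd_conv s(4) p by (subst (3) f, subst right_of_basis[OF d]) (use m in \<open>simp add: algebra_simps\<close>)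
    show "\<not> right_of (cw_pos (fst (corner_vertex h f \<delta>, corner_vertex h (f + \<delta>) (- \<delta>))))
      (cw_pos (snd (corner_vertex h f \<delta>, corner_vertex h (f + \<delta>) (- \<delta>)))) (rpt (f + \<delta>))"
      unfolding fst_conv snd_conv s(4) p by (subst g, subst right_of_basis[OF d]) (use m in \<open>simp add: algebra_simps\<close>)
  qed (use inter_neighbours[OF d] in simp)
qed

lemma cw_right_wrench:
  assumes d: "\<delta> \<in> dirs" and ne: "h (f + rot \<delta>) \<noteq> h (f + \<delta>)"
  shows "cw_right (corner_vertex h (f + rot \<delta>) (- rot \<delta>), corner_vertex h f \<delta>) = f"
    "cw_right (corner_vertex h f \<delta>, corner_vertex h (f + rot \<delta>) (- rot \<delta>)) = f + \<delta> + rot \<delta>"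
proof -
  have f: "rpt f = rpt f + 0 *\<^sub>R rpt \<delta> + 0 *\<^sub>R rpt (rot \<delta>)"
    and g: "rpt (f + \<delta> + rot \<delta>) = rpt f + 1 *\<^sub>R rpt \<delta> + 1 *\<^sub>R rpt (rot \<delta>)"
    by (simp_all add: rpt_add)
  note w = inter_wrench(1-3)[OF d ne]
  show "cw_right (corner_vertex h (f + rot \<delta>) (- rot \<delta>), corner_vertex h f \<delta>) = f"
  proof (rule cw_right_eqI[where g = "f + \<delta> + rot \<delta>"])
    show "right_of (cw_pos (fst (corner_vertex h (f + rot \<delta>) (- rot \<delta>), corner_vertex h f \<delta>)))
      (cw_pos (snd (corner_vertex h (f + rot \<delta>) (- rot \<delta>), corner_vertex h f \<delta>))) (rpt f)"
      unfolding fst_conv snd_conv w cw_pos_square[OF d] by (subst (3) f, subst right_of_basis[OF d]) simp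
    show "\<not> right_of (cw_pos (fst (corner_vertex h (f + rot \<delta>) (- rot \<delta>), corner_vertex h f \<delta>)))
      (cw_pos (snd (corner_vertex h (f + rot \<delta>) (- rot \<delta>), corner_vertex h f \<delta>))) (rpt (f + \<delta> + rot \<delta>))"
      unfolding fst_conv snd_conv w cw_pos_square[OF d] by (subst g, subst right_of_basis[OF d]) simp
  qed (use w in simp)
  show "cw_right (corner_vertex h f \<delta>, corner_vertex h (f + rot \<delta>) (- rot \<delta>)) = f + \<delta> + rot \<delta>"
  proof (rule cw_right_eqI[where g = f])
    show "\<not> right_of (cw_pos (fst (corner_vertex h f \<delta>, corner_vertex h (f + rot \<delta>) (- rot \<delta>))))
      (cw_pos (snd (corner_vertex h f \<delta>, corner_vertex h (f + rot \<delta>) (- rot \<delta>)))) (rpt f)"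
      unfolding fst_conv snd_conv w cw_pos_square[OF d] by (subst (3) f, subst right_of_basis[OF d]) simp
    show "right_of (cw_pos (fst (corner_vertex h f \<delta>, corner_vertex h (f + rot \<delta>) (- rot \<delta>))))
      (cw_pos (snd (corner_vertex h f \<delta>, corner_vertex h (f + rot \<delta>) (- rot \<delta>)))) (rpt (f + \<delta> + rot \<delta>))"
      unfolding fst_conv snd_conv w cw_pos_square[OF d] by (subst g, subst right_of_basis[OF d]) simp
  qed (use w in \<open>simp add: Int_commute insert_commute\<close>)
qed

text \<open>Seen from the face \<open>g\<close> on its other side, a wrench has the direction
  \<open>- \<delta>\<close>, and its two ends exchange their roles. Thus the reverse of a wrench in
  the cycle of \<open>f\<close> belongs to the cycle of \<open>g\<close>.\<close>

lemma corner_wrench_swap: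
  assumes d: "\<delta> \<in> dirs" and ne: "h (f + rot \<delta>) \<noteq> h (f + \<delta>)"
  defines "g \<equiv> f + \<delta> + rot \<delta>"
  shows "corner_vertex h (g + rot (- \<delta>)) (- rot (- \<delta>)) = corner_vertex h f \<delta>"
    and "corner_vertex h g (- \<delta>) = corner_vertex h (f + rot \<delta>) (- rot \<delta>)"
    and "h (g + rot (- \<delta>)) \<noteq> h (g + - \<delta>)"
proof -
  have ne': "h (g + rot (- \<delta>)) \<noteq> h (g + - \<delta>)"
    using ne by (simp add: g_def algebra_simps)
  have d': "- \<delta> \<in> dirs" using d by simp
  note w = inter_wrench(1,2)[OF d ne] and w' = inter_wrench(1,2)[OF d' ne']
  have g: "g + rot (- \<delta>) = f + \<delta>" "g + - \<delta> = f + rot \<delta>" "g + - \<delta> + rot (- \<delta>) = f"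
    by (simp_all add: g_def)
  show "corner_vertex h (g + rot (- \<delta>)) (- rot (- \<delta>)) = corner_vertex h f \<delta>"
    unfolding w w' unfolding g by (auto simp: g_def)
  show "corner_vertex h g (- \<delta>) = corner_vertex h (f + rot \<delta>) (- rot \<delta>)"
    unfolding w w' unfolding g by (auto simp: g_def)
  show "h (g + rot (- \<delta>)) \<noteq> h (g + - \<delta>)" by (rule ne')
qed

lemma face_cycle_neighbour:
  "\<delta> \<in> dirs \<Longrightarrow> (corner_vertex h f \<delta>, corner_vertex h (f + \<delta>) (- \<delta>)) \<in> face_cycle h f"
  unfolding face_cycle_def by blast

lemma face_cycle_wrench:
  "\<delta> \<in> dirs \<Longrightarrow> h (f + rot \<delta>) \<noteq> h (f + \<delta>) \<Longrightarrow>
    (corner_vertex h (f + rot \<delta>) (- rot \<delta>), corner_vertex h f \<delta>) \<in> face_cycle h f"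
  unfolding face_cycle_def by blast

lemma face_cycle_edge:
  assumes "e \<in> face_cycle h f"
  shows "e \<in> cw_edges h" "cw_right e = f" "fst e \<inter> snd e = {f, cw_right (prod.swap e)}"
    "cw_right (prod.swap e) \<noteq> f"
proof -
  have "e \<in> cw_edges h \<and> cw_right e = f \<and> fst e \<inter> snd e = {f, cw_right (prod.swap e)} \<and> cw_right (prod.swap e) \<noteq> f"
    using assms unfolding face_cycle_def
  proof (elim UnE CollectE exE conjE)
    fix \<delta> assume e: "e = (corner_vertex h f \<delta>, corner_vertex h (f + \<delta>) (- \<delta>))" and d: "\<delta> \<in> dirs"
    have "cw_right (prod.swap e) = f + \<delta>"
      using cw_right_neighbours[of "- \<delta>" "f + \<delta>"] d by (simp add: e)
    then show ?thesis
      using inter_neighbours[OF d, of f] cw_right_neighbours[OF d, of f] corner_vertex_in[OF d, of f]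
        corner_vertex_in[of "- \<delta>" "f + \<delta>"] d square_distinct[OF d]
      by (simp add: e cw_edges_def)
  next
    fix \<delta> assume e: "e = (corner_vertex h (f + rot \<delta>) (- rot \<delta>), corner_vertex h f \<delta>)" and d: "\<delta> \<in> dirs"
      and ne: "h (f + rot \<delta>) \<noteq> h (f + \<delta>)"
    show ?thesis
      using inter_wrench(3)[OF d ne] cw_right_wrench[OF d ne] corner_vertex_in[OF d, of f]
        corner_vertex_in[of "- rot \<delta>" "f + rot \<delta>"] d square_distinct[OF d]
      by (simp add: e cw_edges_def add.assoc)
  qed
  then show "e \<in> cw_edges h" "cw_right e = f" "fst e \<inter> snd e = {f, cw_right (prod.swap e)}"
    "cw_right (prod.swap e) \<noteq> f" by auto
qed

text \<open>Links the definition of edges by two common faces with the explicit list. Two faces of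
  one vertex lie in a unit square, so they are neighbours or diagonal neighbours; in either case the
  two vertices containing both are known, and only the direction is left open.\<close>

lemma cw_edge_face_cycle:
  assumes "e \<in> cw_edges h"
  shows "e \<in> face_cycle h (cw_right e)"
proof -
  obtain u v where e: "e = (u, v)" by fastforce
  then have uv: "u \<in> cw_vertices h" "v \<in> cw_vertices h" "card (u \<inter> v) = 2"
    using assms by (auto simp: cw_edges_def)
  obtain f g where fg: "u \<inter> v = {f, g}" "f \<noteq> g" using uv(3) by (auto simp: card_2_iff)
  have in_uv: "f \<in> u" "g \<in> u" "f \<in> v" "g \<in> v" using fg by auto
  have "u \<noteq> v" using card_cw_vertex[OF uv(1)] uv(3) by auto
  obtain \<epsilon> where eps: "\<epsilon> \<in> dirs" "u \<in> {corner_vertex h f \<epsilon>, corner_vertex h (f + rot \<epsilon>) (- rot \<epsilon>)}"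
    using cw_vertex_cases[OF uv(1) in_uv(1)] .
  have "g \<in> {f, f + \<epsilon>, f + rot \<epsilon>, f + \<epsilon> + rot \<epsilon>}"
    using eps in_uv(2) corner_vertex_simps[OF eps(1), of f] by (auto split: if_splits)
  then have "\<exists>\<delta>\<in>dirs. g = f + \<delta> \<or> g = f + \<delta> + rot \<delta>"
    using eps(1) fg(2) by (metis empty_iff insert_iff rot_in_dirs)
  then obtain \<delta> where d: "\<delta> \<in> dirs" "g = f + \<delta> \<or> g = f + \<delta> + rot \<delta>" by blast
  have "\<exists>f'. e \<in> face_cycle h f'"
    using d(2)
  proof
    assume g: "g = f + \<delta>"
    have "e = (corner_vertex h f \<delta>, corner_vertex h (f + \<delta>) (- \<delta>)) \<or>
        e = (corner_vertex h (f + \<delta>) (- \<delta>), corner_vertex h f \<delta>)"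
      using vertex_of_neighbours[of u f \<delta>] vertex_of_neighbours[of v f \<delta>] uv in_uv d(1) g \<open>u \<noteq> v\<close> e by auto
    then show ?thesis
    proof
      assume "e = (corner_vertex h f \<delta>, corner_vertex h (f + \<delta>) (- \<delta>))"
      then have "e \<in> face_cycle h f" using face_cycle_neighbour[OF d(1)] by simp
      then show ?thesis ..
    next
      assume "e = (corner_vertex h (f + \<delta>) (- \<delta>), corner_vertex h f \<delta>)"
      then have "e = (corner_vertex h (f + \<delta>) (- \<delta>), corner_vertex h (f + \<delta> + - \<delta>) (- (- \<delta>)))"
        by simp
      then have "e \<in> face_cycle h (f + \<delta>)" unfolding face_cycle_def using minus_in_dirs[of \<delta>] d(1) by blast
      then show ?thesis ..
    qed
  next
    assume g: "g = f + \<delta> + rot \<delta>"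
    have ee: "e = (corner_vertex h f \<delta>, corner_vertex h (f + rot \<delta>) (- rot \<delta>)) \<or>
        e = (corner_vertex h (f + rot \<delta>) (- rot \<delta>), corner_vertex h f \<delta>)"
      using vertex_of_diagonal[of u f \<delta>] vertex_of_diagonal[of v f \<delta>] uv in_uv d(1) g \<open>u \<noteq> v\<close> e by auto
    then have ne: "h (f + rot \<delta>) \<noteq> h (f + \<delta>)"
      using \<open>u \<noteq> v\<close> e corner_vertex_simps[OF d(1), of f] by (auto split: if_splits)
    from ee show ?thesis
    proof
      assume "e = (corner_vertex h (f + rot \<delta>) (- rot \<delta>), corner_vertex h f \<delta>)"
      then have "e \<in> face_cycle h f" using face_cycle_wrench[OF d(1) ne] by simp
      then show ?thesis ..
    next
      assume e': "e = (corner_vertex h f \<delta>, corner_vertex h (f + rot \<delta>) (- rot \<delta>))"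
      have "e \<in> face_cycle h (f + \<delta> + rot \<delta>)"
        unfolding face_cycle_def e' corner_wrench_swap(1,2)[OF d(1) ne, symmetric]
        using corner_wrench_swap(3)[OF d(1) ne] minus_in_dirs[of \<delta>] d(1) by blast
      then show ?thesis ..
    qed
  qed
  then obtain f' where "e \<in> face_cycle h f'" ..
  with face_cycle_edge(2)[OF this] show ?thesis by simp
qed

lemma face_cycle_eq: "face_cycle h f = {e \<in> cw_edges h. cw_right e = f}"
  using face_cycle_edge cw_edge_face_cycle by blast

lemma cw_edges_swap: "prod.swap e \<in> cw_edges h \<longleftrightarrow> e \<in> cw_edges h"
  by (cases e) (auto simp: cw_edges_def Int_commute)

lemma cw_edge_inter:
  assumes "e \<in> cw_edges h"
  shows "fst e \<inter> snd e = {cw_right e, cw_right (prod.swap e)}" "cw_right (prod.swap e) \<noteq> cw_right e"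
  using face_cycle_edge(3,4)[OF cw_edge_face_cycle[OF assms]] by auto

end

lemma card_square_inter:
  assumes "q \<noteq> q'"
  shows "card (unit_square q \<inter> unit_square q') \<le> 2"
proof -
  obtain i j k l where q: "q = (i, j)" "q' = (k, l)" by fastforce
  have eq: "unit_square q \<inter> unit_square q' = ({i, i + 1} \<inter> {k, k + 1}) \<times> ({j, j + 1} \<inter> {l, l + 1})"
    by (auto simp: q)
  have 2: "card ({i, i + 1} \<inter> A) \<le> 2" for i :: int and A
    by (rule order_trans[OF card_mono[of "{i, i + 1}"]]) auto
  have 1: "card ({i, i + 1} \<inter> {k, k + 1}) \<le> 1" if "i \<noteq> k" for i k :: int
  proof -
    have "{i, i + 1} \<inter> {k, k + 1} \<subseteq> {max i k}" using that by auto
    then show ?thesis using card_mono[of "{max i k}"] by simp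
  qed
  show ?thesis
    unfolding eq card_cartesian_product
    using assms 1[of i k] 1[of j l] 2[of i "{k, k + 1}"] 2[of j "{l, l + 1}"] mult_le_mono[of _ 1 _ 2] mult_le_mono[of _ 2 _ 1]
    by (cases "i = k") (auto simp: q)
qed

lemma finite_unit_square [simp]: "finite (unit_square q)"
  by (cases q) simp

lemma square_base_inj:
  assumes "\<delta> \<in> dirs" "\<epsilon> \<in> dirs" "square_base f \<delta> = square_base f \<epsilon>"
  shows "\<delta> = \<epsilon>"
  using assms by (cases f; elim dirs_cases; simp)

section \<open>Kasteleyn orientations\<close>

text \<open>With these signs, the two orientations of an edge contribute \<open>a\<^sub>s - a\<^sub>n\<close> if the faces next to it
  are one (\<open>s\<close>) to the south of the other (\<open>n\<close>), and the weight of the lower face minus that of the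
  higher one if they lie side by side.\<close>

definition source_sign :: "(face \<Rightarrow> int) \<Rightarrow> face \<Rightarrow> face \<Rightarrow> complex" where
  "source_sign h f g = (if snd f < snd g \<or> snd f = snd g \<and> h f < h g then 1 else -1)"

context heights
begin

abbreviation "star f \<equiv> {u \<in> cw_vertices h. f \<in> u}"

lemma corner_vertex_square:
  assumes "\<delta> \<in> dirs"
  shows "corner_vertex h f \<delta> \<subseteq> unit_square (square_base f \<delta>)"
    "corner_vertex h (f + rot \<delta>) (- rot \<delta>) \<subseteq> unit_square (square_base f \<delta>)"
  unfolding corner_vertex_simps[OF assms, of f] square_base(1)[OF assms] by auto

text \<open>A vertex has at least three faces, while two different unit squares share at most two,
  so a vertex determines its square.\<close>

lemma corner_unique:
  assumes "\<delta> \<in> dirs" "\<epsilon> \<in> dirs"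
    and "u \<in> {corner_vertex h f \<delta>, corner_vertex h (f + rot \<delta>) (- rot \<delta>)}"
    and "u \<in> {corner_vertex h f \<epsilon>, corner_vertex h (f + rot \<epsilon>) (- rot \<epsilon>)}"
  shows "\<delta> = \<epsilon>"
proof (rule ccontr)
  assume "\<delta> \<noteq> \<epsilon>"
  then have ne: "square_base f \<delta> \<noteq> square_base f \<epsilon>" using square_base_inj assms(1,2) by blast
  have "u \<subseteq> unit_square (square_base f \<delta>) \<inter> unit_square (square_base f \<epsilon>)"
    using assms corner_vertex_square[of \<delta> f] corner_vertex_square[of \<epsilon> f] by auto
  then have "card u \<le> 2"
    using card_square_inter[OF ne]
    by (meson card_mono finite_Int finite_unit_square le_trans)
  moreover have "u \<in> cw_vertices h"
    using assms corner_vertex_in[of \<delta> f] corner_vertex_in[of "- rot \<delta>" "f + rot \<delta>"] by auto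
  ultimately show False using card_cw_vertex[of u] by simp
qed

lemma wrench_iff:
  assumes "\<delta> \<in> dirs"
  shows "corner_vertex h (f + rot \<delta>) (- rot \<delta>) \<noteq> corner_vertex h f \<delta> \<longleftrightarrow> h (f + rot \<delta>) \<noteq> h (f + \<delta>)"
proof
  assume "h (f + rot \<delta>) \<noteq> h (f + \<delta>)"
  then have "(corner_vertex h (f + rot \<delta>) (- rot \<delta>), corner_vertex h f \<delta>) \<in> cw_edges h"
    using face_cycle_edge(1)[OF face_cycle_wrench[OF assms]] by blast
  then show "corner_vertex h (f + rot \<delta>) (- rot \<delta>) \<noteq> corner_vertex h f \<delta>"
    using card_cw_vertex[of "corner_vertex h f \<delta>"] by (auto simp: cw_edges_def)
qed (auto simp: corner_vertex_simps[OF assms, of f] split: if_splits)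

lemma face_cycle_out:
  assumes "u \<in> cw_vertices h" "f \<in> u"
  shows "\<exists>!e. e \<in> face_cycle h f \<and> fst e = u"
proof -
  obtain \<delta> where d: "\<delta> \<in> dirs" "u \<in> {corner_vertex h f \<delta>, corner_vertex h (f + rot \<delta>) (- rot \<delta>)}"
    using cw_vertex_cases[OF assms] .
  have P: "\<epsilon> = \<delta>" if "\<epsilon> \<in> dirs" "u = corner_vertex h f \<epsilon>" for \<epsilon>
    using corner_unique[OF that(1) d(1), of u f] that d(2) by auto
  have N: "\<epsilon> = \<delta>" if "\<epsilon> \<in> dirs" "u = corner_vertex h (f + rot \<epsilon>) (- rot \<epsilon>)" for \<epsilon>
    using corner_unique[OF that(1) d(1), of u f] that d(2) by auto
  show ?thesis
  proof (cases "u = corner_vertex h f \<delta>")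
    case True
    show ?thesis
    proof (rule ex1I[of _ "(corner_vertex h f \<delta>, corner_vertex h (f + \<delta>) (- \<delta>))"])
      show "(corner_vertex h f \<delta>, corner_vertex h (f + \<delta>) (- \<delta>)) \<in> face_cycle h f \<and>
          fst (corner_vertex h f \<delta>, corner_vertex h (f + \<delta>) (- \<delta>)) = u"
        using face_cycle_neighbour[OF d(1)] True by simp
    next
      fix e assume e: "e \<in> face_cycle h f \<and> fst e = u"
      then consider \<epsilon> where "\<epsilon> \<in> dirs" "e = (corner_vertex h f \<epsilon>, corner_vertex h (f + \<epsilon>) (- \<epsilon>))"
        | \<epsilon> where "\<epsilon> \<in> dirs" "h (f + rot \<epsilon>) \<noteq> h (f + \<epsilon>)"
          "e = (corner_vertex h (f + rot \<epsilon>) (- rot \<epsilon>), corner_vertex h f \<epsilon>)"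
        unfolding face_cycle_def by blast
      then show "e = (corner_vertex h f \<delta>, corner_vertex h (f + \<delta>) (- \<delta>))"
      proof cases
        case (1 \<epsilon>) then show ?thesis using P[of \<epsilon>] e by simp
      next
        case (2 \<epsilon>) then show ?thesis using N[of \<epsilon>] e True wrench_iff[OF d(1), of f] by auto
      qed
    qed
  next
    case False
    then have u: "u = corner_vertex h (f + rot \<delta>) (- rot \<delta>)" using d by blast
    then have ne: "h (f + rot \<delta>) \<noteq> h (f + \<delta>)" using False wrench_iff[OF d(1), of f] by auto
    show ?thesis
    proof (rule ex1I[of _ "(corner_vertex h (f + rot \<delta>) (- rot \<delta>), corner_vertex h f \<delta>)"])
      show "(corner_vertex h (f + rot \<delta>) (- rot \<delta>), corner_vertex h f \<delta>) \<in> face_cycle h f \<and>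
          fst (corner_vertex h (f + rot \<delta>) (- rot \<delta>), corner_vertex h f \<delta>) = u"
        using face_cycle_wrench[OF d(1) ne] u by simp
    next
      fix e assume e: "e \<in> face_cycle h f \<and> fst e = u"
      then consider \<epsilon> where "\<epsilon> \<in> dirs" "e = (corner_vertex h f \<epsilon>, corner_vertex h (f + \<epsilon>) (- \<epsilon>))"
        | \<epsilon> where "\<epsilon> \<in> dirs" "h (f + rot \<epsilon>) \<noteq> h (f + \<epsilon>)"
          "e = (corner_vertex h (f + rot \<epsilon>) (- rot \<epsilon>), corner_vertex h f \<epsilon>)"
        unfolding face_cycle_def by blast
      then show "e = (corner_vertex h (f + rot \<delta>) (- rot \<delta>), corner_vertex h f \<delta>)"
      proof cases
        case (1 \<epsilon>) then show ?thesis using P[of \<epsilon>] e False by auto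
      next
        case (2 \<epsilon>) then show ?thesis using N[of \<epsilon>] e by auto
      qed
    qed
  qed
qed

lemma face_cycle_in:
  assumes "u \<in> cw_vertices h" "f \<in> u"
  shows "\<exists>!e. e \<in> face_cycle h f \<and> snd e = u"
proof -
  obtain \<delta> where d: "\<delta> \<in> dirs" "u \<in> {corner_vertex h f \<delta>, corner_vertex h (f + rot \<delta>) (- rot \<delta>)}"
    using cw_vertex_cases[OF assms] .
  have P: "\<epsilon> = \<delta>" if "\<epsilon> \<in> dirs" "u = corner_vertex h f \<epsilon>" for \<epsilon>
    using corner_unique[OF that(1) d(1), of u f] that d(2) by auto
  \<comment> \<open>The end of the edge to \<open>f + \<epsilon>\<close> lies in the square of
    \<open>- rot \<epsilon>\<close>, not of \<epsilon>, hence the quarter turn.\<close>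
  have N: "\<epsilon> = rot \<delta>" if "\<epsilon> \<in> dirs" "u = corner_vertex h (f + \<epsilon>) (- \<epsilon>)" for \<epsilon>
  proof -
    have "u \<in> {corner_vertex h f (- rot \<epsilon>), corner_vertex h (f + rot (- rot \<epsilon>)) (- rot (- rot \<epsilon>))}"
      using that by simp
    then have "- rot \<epsilon> = \<delta>" using corner_unique[of "- rot \<epsilon>" \<delta> u f] that(1) d by simp
    then show ?thesis by (metis minus_minus rot_minus rot_rot)
  qed
  show ?thesis
  proof (cases "u = corner_vertex h (f + rot \<delta>) (- rot \<delta>)")
    case True
    show ?thesis
    proof (rule ex1I[of _ "(corner_vertex h f (rot \<delta>), corner_vertex h (f + rot \<delta>) (- rot \<delta>))"])
      show "(corner_vertex h f (rot \<delta>), corner_vertex h (f + rot \<delta>) (- rot \<delta>)) \<in> face_cycle h f \<and>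
          snd (corner_vertex h f (rot \<delta>), corner_vertex h (f + rot \<delta>) (- rot \<delta>)) = u"
        using face_cycle_neighbour[of "rot \<delta>"] d(1) True by simp
    next
      fix e assume e: "e \<in> face_cycle h f \<and> snd e = u"
      then consider \<epsilon> where "\<epsilon> \<in> dirs" "e = (corner_vertex h f \<epsilon>, corner_vertex h (f + \<epsilon>) (- \<epsilon>))"
        | \<epsilon> where "\<epsilon> \<in> dirs" "h (f + rot \<epsilon>) \<noteq> h (f + \<epsilon>)"
          "e = (corner_vertex h (f + rot \<epsilon>) (- rot \<epsilon>), corner_vertex h f \<epsilon>)"
        unfolding face_cycle_def by blast
      then show "e = (corner_vertex h f (rot \<delta>), corner_vertex h (f + rot \<delta>) (- rot \<delta>))"
      proof cases
        case (1 \<epsilon>) then show ?thesis using N[of \<epsilon>] e by simp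
      next
        case (2 \<epsilon>) then show ?thesis using P[of \<epsilon>] e True wrench_iff[OF d(1), of f] by auto
      qed
    qed
  next
    case False
    then have u: "u = corner_vertex h f \<delta>" using d by blast
    then have ne: "h (f + rot \<delta>) \<noteq> h (f + \<delta>)" using False wrench_iff[OF d(1), of f] by auto
    show ?thesis
    proof (rule ex1I[of _ "(corner_vertex h (f + rot \<delta>) (- rot \<delta>), corner_vertex h f \<delta>)"])
      show "(corner_vertex h (f + rot \<delta>) (- rot \<delta>), corner_vertex h f \<delta>) \<in> face_cycle h f \<and>
          snd (corner_vertex h (f + rot \<delta>) (- rot \<delta>), corner_vertex h f \<delta>) = u"
        using face_cycle_wrench[OF d(1) ne] u by simp
    next
      fix e assume e: "e \<in> face_cycle h f \<and> snd e = u"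
      then consider \<epsilon> where "\<epsilon> \<in> dirs" "e = (corner_vertex h f \<epsilon>, corner_vertex h (f + \<epsilon>) (- \<epsilon>))"
        | \<epsilon> where "\<epsilon> \<in> dirs" "h (f + rot \<epsilon>) \<noteq> h (f + \<epsilon>)"
          "e = (corner_vertex h (f + rot \<epsilon>) (- rot \<epsilon>), corner_vertex h f \<epsilon>)"
        unfolding face_cycle_def by blast
      then show "e = (corner_vertex h (f + rot \<delta>) (- rot \<delta>), corner_vertex h f \<delta>)"
      proof cases
        case (1 \<epsilon>) then show ?thesis using N[of \<epsilon>] e False by auto
      next
        case (2 \<epsilon>) then show ?thesis using P[of \<epsilon>] e u by auto
      qed
    qed
  qed
qed

lemma face_cycle_ends:
  assumes "e \<in> face_cycle h f"
  shows "fst e \<in> star f" "snd e \<in> star f"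
  using face_cycle_edge[OF assms] by (auto simp: cw_edges_def)

text \<open>The face cycle is the graph of the permutation that moves each vertex of
  \<open>f\<close> one step clockwise around it; these are its two projections.\<close>

lemma bij_face_cycle:
  "bij_betw fst (face_cycle h f) (star f)" "bij_betw snd (face_cycle h f) (star f)"
proof -
  have "inj_on fst (face_cycle h f)"
  proof (rule inj_onI)
    fix e e' assume a: "e \<in> face_cycle h f" "e' \<in> face_cycle h f" "fst e = fst e'"
    then have "\<exists>!d. d \<in> face_cycle h f \<and> fst d = fst e"
      using face_cycle_out[of "fst e" f] face_cycle_ends(1)[OF a(1)] by simp
    then show "e = e'" using a by auto
  qed
  moreover have "inj_on snd (face_cycle h f)"
  proof (rule inj_onI)
    fix e e' assume a: "e \<in> face_cycle h f" "e' \<in> face_cycle h f" "snd e = snd e'"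
    then have "\<exists>!d. d \<in> face_cycle h f \<and> snd d = snd e"
      using face_cycle_in[of "snd e" f] face_cycle_ends(2)[OF a(1)] by simp
    then show "e = e'" using a by auto
  qed
  moreover have "fst ` face_cycle h f = star f"
  proof (intro subset_antisym subsetI)
    fix u assume "u \<in> star f"
    then show "u \<in> fst ` face_cycle h f" using face_cycle_out[of u f] by blast
  qed (use face_cycle_ends in blast)
  moreover have "snd ` face_cycle h f = star f"
  proof (intro subset_antisym subsetI)
    fix u assume "u \<in> star f"
    then show "u \<in> snd ` face_cycle h f" using face_cycle_in[of u f] by blast
  qed (use face_cycle_ends in blast)
  ultimately show "bij_betw fst (face_cycle h f) (star f)" "bij_betw snd (face_cycle h f) (star f)"
    by (simp_all add: bij_betw_def)
qed

lemma face_cycle_images: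
  "face_cycle h f = (\<lambda>\<delta>. (corner_vertex h f \<delta>, corner_vertex h (f + \<delta>) (- \<delta>))) ` dirs \<union>
     (\<lambda>\<delta>. (corner_vertex h (f + rot \<delta>) (- rot \<delta>), corner_vertex h f \<delta>)) ` {\<delta>\<in>dirs. h (f + rot \<delta>) \<noteq> h (f + \<delta>)}"
  unfolding face_cycle_def by blast

lemma inj_corner: "inj_on (corner_vertex h f) dirs"
  using corner_unique by (intro inj_onI) blast

lemma inj_corner2:
  "inj_on (\<lambda>\<delta>. (corner_vertex h f \<delta>, corner_vertex h (f + \<delta>) (- \<delta>))) dirs"
  "inj_on (\<lambda>\<delta>. (corner_vertex h (f + rot \<delta>) (- rot \<delta>), corner_vertex h f \<delta>)) {\<delta>\<in>dirs. P \<delta>}"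
  using inj_corner[of f] by (auto simp: inj_on_def)

lemma face_cycle_disjoint:
  "(\<lambda>\<delta>. (corner_vertex h f \<delta>, corner_vertex h (f + \<delta>) (- \<delta>))) ` dirs \<inter>
     (\<lambda>\<delta>. (corner_vertex h (f + rot \<delta>) (- rot \<delta>), corner_vertex h f \<delta>)) ` {\<delta>\<in>dirs. h (f + rot \<delta>) \<noteq> h (f + \<delta>)} = {}"
proof -
  have False if "\<delta> \<in> dirs" "\<epsilon> \<in> dirs" "h (f + rot \<epsilon>) \<noteq> h (f + \<epsilon>)"
    "corner_vertex h f \<delta> = corner_vertex h (f + rot \<epsilon>) (- rot \<epsilon>)" for \<delta> \<epsilon>
    using corner_unique[OF that(1,2), of "corner_vertex h f \<delta>" f] that(3,4) wrench_iff[OF that(2), of f] by auto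
  then show ?thesis by blast
qed

lemma finite_face_cycle [simp]: "finite (face_cycle h f)"
  unfolding face_cycle_images by simp

lemma card_face_cycle: "card (face_cycle h f) = 4 + card {\<delta>\<in>dirs. h (f + rot \<delta>) \<noteq> h (f + \<delta>)}"
proof -
  have "card dirs = 4" by (simp add: dirs_def)
  then show ?thesis
    unfolding face_cycle_images
    by (subst card_Un_disjoint[OF _ _ face_cycle_disjoint]) (simp_all add: card_image inj_corner2)
qed

lemma prod_face_cycle:
  "(\<Prod>e\<in>face_cycle h f. \<phi> (cw_right (prod.swap e))) =
     (\<Prod>\<delta>\<in>dirs. \<phi> (f + \<delta>)) * (\<Prod>\<delta>\<in>{\<delta>\<in>dirs. h (f + rot \<delta>) \<noteq> h (f + \<delta>)}. \<phi> (f + \<delta> + rot \<delta>))"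
proof -
  have 1: "cw_right (corner_vertex h (f + \<delta>) (- \<delta>), corner_vertex h f \<delta>) = f + \<delta>" if "\<delta> \<in> dirs" for \<delta>
    using cw_right_neighbours[of "- \<delta>" "f + \<delta>"] that by simp
  show ?thesis
    unfolding face_cycle_images
    by (subst prod.union_disjoint[OF _ _ face_cycle_disjoint])
      (simp_all add: prod.reindex[OF inj_corner2(1)] prod.reindex[OF inj_corner2(2)] 1 cw_right_wrench(2))
qed

text \<open>The northern edges contribute 1 and the edge to the south contributes -1. The rest
  cancels: take the directions of the height steps from \<open>f\<close> to the west, south and east
  as signs. The western and eastern edges contribute the first and the last, and the southern
  wrenches contribute the products of two consecutive ones, as a wrench is present iff the two steps
  differ. Each sign occurs twice.\<close>

lemma prod_source_sign: "(\<Prod>e\<in>face_cycle h f. source_sign h f (cw_right (prod.swap e))) = -1"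
proof -
  define E N W S :: face where "E = (1, 0)" and "N = (0, 1)" and "W = (-1, 0)" and "S = (0, -1)"
  have dirs: "dirs = {E, N, W, S}" by (simp add: dirs_def E_def N_def W_def S_def)
  have dist: "E \<noteq> N" "E \<noteq> W" "E \<noteq> S" "N \<noteq> W" "N \<noteq> S" "W \<noteq> S"
    by (simp_all add: E_def N_def W_def S_def)
  have r: "rot E = N" "rot N = W" "rot W = S" "rot S = E"
    by (simp_all add: E_def N_def W_def S_def)
  have snds: "snd E = 0" "snd W = 0" "snd N = 1" "snd S = - 1"
    by (simp_all add: E_def N_def W_def S_def)
  have s1: "source_sign h f (f + N) = 1" "source_sign h f (f + S) = -1"
    "source_sign h f (f + E + N) = 1" "source_sign h f (f + N + W) = 1"
    "source_sign h f (f + W + S) = -1" "source_sign h f (f + S + E) = -1"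
    "source_sign h f (f + E) = (if h f < h (f + E) then 1 else -1)"
    "source_sign h f (f + W) = (if h f < h (f + W) then 1 else -1)"
    by (simp_all add: source_sign_def snds)
  have "(\<Prod>\<delta>\<in>{\<delta>\<in>dirs. h (f + rot \<delta>) \<noteq> h (f + \<delta>)}. source_sign h f (f + \<delta> + rot \<delta>)) =
      (\<Prod>\<delta>\<in>dirs. if h (f + rot \<delta>) \<noteq> h (f + \<delta>) then source_sign h f (f + \<delta> + rot \<delta>) else 1)"
    by (simp add: prod.inter_filter)
  also have "\<dots> = (if h (f + S) \<noteq> h (f + W) then -1 else 1) * (if h (f + E) \<noteq> h (f + S) then -1 else 1)"
    unfolding dirs using dist by (simp add: r s1)
  finally show ?thesis
    unfolding prod_face_cycle unfolding dirs using dist step_cases[of E f] step_cases[of W f] step_cases[of S f]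
    by (auto simp: dirs s1)
qed

section \<open>A proper 2-colouring of the vertices\<close>

definition white :: "cw_vertex set" where
  "white = {u \<in> cw_vertices h. \<exists>i j. (i, j) \<in> u \<and> (i + 1, j) \<in> u \<and>
     (h (i, j) < h (i + 1, j) \<and> (\<exists>k. (k, j + 1) \<in> u) \<or> h (i + 1, j) < h (i, j) \<and> (\<exists>k. (k, j - 1) \<in> u))}"

lemma white_square:
  assumes "u \<subseteq> {(i, j), (i + 1, j), (i, j + 1), (i + 1, j + 1)}" "u \<in> cw_vertices h"
  shows "u \<in> white \<longleftrightarrow>
    (i, j) \<in> u \<and> (i + 1, j) \<in> u \<and> h (i, j) < h (i + 1, j) \<and> ((i, j + 1) \<in> u \<or> (i + 1, j + 1) \<in> u) \<or>
    (i, j + 1) \<in> u \<and> (i + 1, j + 1) \<in> u \<and> h (i + 1, j + 1) < h (i, j + 1) \<and> ((i, j) \<in> u \<or> (i + 1, j) \<in> u)"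
    (is "_ \<longleftrightarrow> ?R")
proof
  assume "u \<in> white"
  let ?P = "\<lambda>i' j'. (i', j') \<in> u \<and> (i' + 1, j') \<in> u \<and>
     (h (i', j') < h (i' + 1, j') \<and> (\<exists>k. (k, j' + 1) \<in> u) \<or> h (i' + 1, j') < h (i', j') \<and> (\<exists>k. (k, j' - 1) \<in> u))"
  have "\<exists>i' j'. ?P i' j'"
    using \<open>u \<in> white\<close> unfolding white_def mem_Collect_eq by (rule conjunct2)
  then obtain i' where "\<exists>j'. ?P i' j'" ..
  then obtain j' where P: "?P i' j'" ..
  note w = P[THEN conjunct1] P[THEN conjunct2, THEN conjunct1] P[THEN conjunct2, THEN conjunct2]
  have ij: "i' = i" "j' = j \<or> j' = j + 1" using subsetD[OF assms(1) w(1)] subsetD[OF assms(1) w(2)] by auto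
  have no: "(k, j + 1 + 1) \<notin> u" "(k, j - 1) \<notin> u" for k
    using assms(1) by auto
  have bot: "(k, j) \<in> u \<longleftrightarrow> k = i \<and> (i, j) \<in> u \<or> k = i + 1 \<and> (i + 1, j) \<in> u" for k
    using subsetD[OF assms(1), of "(k, j)"] by auto
  have top: "(k, j + 1) \<in> u \<longleftrightarrow> k = i \<and> (i, j + 1) \<in> u \<or> k = i + 1 \<and> (i + 1, j + 1) \<in> u" for k
    using subsetD[OF assms(1), of "(k, j + 1)"] by auto
  from ij(2) show ?R
  proof
    assume "j' = j"
    then have "(i, j) \<in> u" "(i + 1, j) \<in> u" "h (i, j) < h (i + 1, j)" "\<exists>k. (k, j + 1) \<in> u"
      using w no ij(1) by simp_all
    then show ?R using top by blast
  next
    assume "j' = j + 1"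
    then have "(i, j + 1) \<in> u" "(i + 1, j + 1) \<in> u" "h (i + 1, j + 1) < h (i, j + 1)" "\<exists>k. (k, j) \<in> u"
      using w no ij(1) by simp_all
    then show ?R using bot by blast
  qed
next
  assume ?R
  then show "u \<in> white"
  proof
    assume "(i, j) \<in> u \<and> (i + 1, j) \<in> u \<and> h (i, j) < h (i + 1, j) \<and> ((i, j + 1) \<in> u \<or> (i + 1, j + 1) \<in> u)"
    then show ?thesis unfolding white_def using assms(2) by blast
  next
    assume a: "(i, j + 1) \<in> u \<and> (i + 1, j + 1) \<in> u \<and> h (i + 1, j + 1) < h (i, j + 1) \<and> ((i, j) \<in> u \<or> (i + 1, j) \<in> u)"
    then have "\<exists>k. (k, j + 1 - 1) \<in> u" by auto
    then show ?thesis unfolding white_def using assms(2) a by blast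
  qed
qed

text \<open>The geometric meaning of the colour: an edge leaving a white vertex has the lower of its
  two faces on its right if the faces lie side by side, and on its left if one lies above the other.
  At a cross, low and high faces alternate, so all its edges agree on its colour.\<close>

lemma white_corner:
  assumes d: "\<delta> \<in> dirs"
  shows "corner_vertex h f \<delta> \<in> white \<longleftrightarrow> (h f < h (f + \<delta>)) \<noteq> (fst \<delta> = 0)"
proof -
  obtain x y where f: "f = (x, y)" by fastforce
  note cv = corner_vertex_in[OF d, of f]
  have st: "\<bar>h (f + \<delta>) - h f\<bar> = 1" "\<bar>h (f + rot \<delta>) - h f\<bar> = 1" "\<bar>h (f + \<delta> + rot \<delta>) - h (f + \<delta>)\<bar> = 1"
    "\<bar>h (f + \<delta> + rot \<delta>) - h (f + rot \<delta>)\<bar> = 1"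
    using step[OF d, of f] step[of "rot \<delta>" f] step[of "rot \<delta>" "f + \<delta>"] step[OF d, of "f + rot \<delta>"] d
    by (simp_all add: algebra_simps)
  from d show ?thesis
  proof (cases rule: dirs_cases)
    case 1
    then show ?thesis
      using st cv unfolding f by (subst white_square[where i = x and j = y]) (auto simp: corner_vertex_def f)
  next
    case 2
    then show ?thesis
      using st cv unfolding f by (subst white_square[where i = "x - 1" and j = y]) (auto simp: corner_vertex_def f)
  next
    case 3
    then show ?thesis
      using st cv unfolding f by (subst white_square[where i = "x - 1" and j = "y - 1"]) (auto simp: corner_vertex_def f)
  next
    case 4
    then show ?thesis
      using st cv unfolding f by (subst white_square[where i = x and j = "y - 1"]) (auto simp: corner_vertex_def f)
  qed
qed

lemma white_edge:
  assumes "e \<in> cw_edges h"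
  shows "fst e \<in> white \<longleftrightarrow> snd e \<notin> white"
  using cw_edge_face_cycle[OF assms] unfolding face_cycle_def
proof (elim UnE CollectE exE conjE)
  fix \<delta> assume e: "e = (corner_vertex h (cw_right e) \<delta>, corner_vertex h (cw_right e + \<delta>) (- \<delta>))" and d: "\<delta> \<in> dirs"
  have "fst e \<in> white \<longleftrightarrow> (h (cw_right e) < h (cw_right e + \<delta>)) \<noteq> (fst \<delta> = 0)"
    using white_corner[OF d] e by (metis fst_conv)
  moreover have "snd e \<in> white \<longleftrightarrow> (h (cw_right e + \<delta>) < h (cw_right e)) \<noteq> (fst \<delta> = 0)"
    using white_corner[of "- \<delta>" "cw_right e + \<delta>"] d e by (metis snd_conv add_uminus_conv_diff add_diff_cancel fst_uminus minus_in_dirs neg_equal_0_iff_equal)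
  ultimately show ?thesis using step_cases[OF d, of "cw_right e"] by auto
next
  fix \<delta> assume e: "e = (corner_vertex h (cw_right e + rot \<delta>) (- rot \<delta>), corner_vertex h (cw_right e) \<delta>)"
    and d: "\<delta> \<in> dirs" and ne: "h (cw_right e + rot \<delta>) \<noteq> h (cw_right e + \<delta>)"
  have "snd e \<in> white \<longleftrightarrow> (h (cw_right e) < h (cw_right e + \<delta>)) \<noteq> (fst \<delta> = 0)"
    using white_corner[OF d] e by (metis snd_conv)
  moreover have "fst e \<in> white \<longleftrightarrow> (h (cw_right e + rot \<delta>) < h (cw_right e)) \<noteq> (fst (- rot \<delta>) = 0)"
    using white_corner[of "- rot \<delta>" "cw_right e + rot \<delta>"] d e by (metis fst_conv add_uminus_conv_diff add_diff_cancel minus_in_dirs rot_in_dirs)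
  moreover have "fst (- rot \<delta>) = 0 \<longleftrightarrow> fst \<delta> \<noteq> 0" using d by (auto simp: dirs_def)
  ultimately show ?thesis
    using step_cases[OF d, of "cw_right e"] step_cases[of "rot \<delta>" "cw_right e"] d ne by auto
qed

lemma cw_sub_edges_iff:
  "e \<in> cw_sub_edges h p \<longleftrightarrow> e \<in> cw_edges h \<and> fst e \<inter> snd e \<inter> cw_internal h p \<noteq> {}"
proof (cases "e \<in> cw_edges h")
  case True
  show ?thesis
    unfolding cw_edge_inter(1)[OF True] using True by (auto simp: cw_sub_edges_def)
qed (simp add: cw_sub_edges_def)

lemma bipartition_cw:
  assumes "bipartition (cw_graph h p) W" "e \<in> cw_sub_edges h p"
  shows "fst e \<in> W \<longleftrightarrow> snd e \<notin> W"
proof -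
  have "\<forall>(u, v)\<in>cw_sub_edges h p. u \<in> W \<longleftrightarrow> v \<notin> W"
    using assms(1) by (simp add: bipartition_def cw_graph_def)
  then show ?thesis using assms(2) by (cases e) auto
qed

lemma face_cycle_sub_edges: "f \<in> cw_internal h p \<Longrightarrow> face_cycle h f \<subseteq> cw_sub_edges h p"
  by (auto simp: face_cycle_eq cw_sub_edges_def)

lemma cw_sub_edges_swap: "prod.swap e \<in> cw_sub_edges h p \<longleftrightarrow> e \<in> cw_sub_edges h p"
  by (auto simp: cw_sub_edges_def cw_edges_swap)

text \<open>The two directions of an edge have different faces on their right, so counting directed
  edges gives the degree of a face.\<close>

lemma undirected_inj:
  "inj_on (\<lambda>e. {fst e, snd e}) (face_cycle h f)"
proof (rule inj_onI)
  fix e e' assume e: "e \<in> face_cycle h f" "e' \<in> face_cycle h f" "{fst e, snd e} = {fst e', snd e'}"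
  have "e' = e \<or> e' = prod.swap e"
    using e(3) by (auto simp: doubleton_eq_iff prod_eq_iff)
  moreover have "e' \<noteq> prod.swap e"
    using face_cycle_edge(2)[OF e(2)] face_cycle_edge(4)[OF e(1)] by auto
  ultimately show "e = e'" by blast
qed

lemma face_degree_cw: "face_degree (cw_graph h p) f = card (face_cycle h f \<inter> cw_sub_edges h p)"
proof -
  have *: "{{u, v} | u v. P (u, v)} = (\<lambda>e. {fst e, snd e}) ` {e. P e}" for P :: "cw_vertex \<times> cw_vertex \<Rightarrow> bool"
    by (auto intro: rev_image_eqI) blast
  have "{{u, v} | u v. (u, v) \<in> dir_edges (cw_graph h p) \<and> right_face (cw_graph h p) (u, v) = f} =
      (\<lambda>e. {fst e, snd e}) ` {e. e \<in> dir_edges (cw_graph h p) \<and> right_face (cw_graph h p) e = f}"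
    by (rule *[of "\<lambda>e. e \<in> dir_edges (cw_graph h p) \<and> right_face (cw_graph h p) e = f"])
  moreover have "{e. e \<in> dir_edges (cw_graph h p) \<and> right_face (cw_graph h p) e = f} =
      face_cycle h f \<inter> cw_sub_edges h p"
    by (auto simp: cw_graph_def face_cycle_eq cw_sub_edges_iff)
  moreover have "card ((\<lambda>e. {fst e, snd e}) ` (face_cycle h f \<inter> cw_sub_edges h p)) =
      card (face_cycle h f \<inter> cw_sub_edges h p)"
    by (rule card_image[OF inj_on_subset[OF undirected_inj[of f]]]) auto
  ultimately show ?thesis by (simp add: face_degree_def)
qed

lemma face_degree_internal:
  "f \<in> cw_internal h p \<Longrightarrow> face_degree (cw_graph h p) f = card (face_cycle h f)"
  using face_cycle_sub_edges[of f p] by (simp add: face_degree_cw Int_absorb2)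

text \<open>Starting points and end points of the cycle both run through the vertices of
  \<open>f\<close> once, so equally many are white. As each edge changes the colour, an edge has a
  white end iff it starts at a black vertex.\<close>

lemma card_face_cycle_white:
  assumes f: "f \<in> cw_internal h p" and W: "bipartition (cw_graph h p) W"
  shows "card (face_cycle h f) = 2 * card {e \<in> face_cycle h f. fst e \<notin> W}"
proof -
  let ?R = "face_cycle h f"
  have alt: "fst e \<in> W \<longleftrightarrow> snd e \<notin> W" if "e \<in> ?R" for e
    using bipartition_cw[OF W, of e] face_cycle_sub_edges[OF f] that by blast
  have "card {e \<in> ?R. fst e \<in> W} = card (fst ` {e \<in> ?R. fst e \<in> W})"
    by (rule card_image[symmetric, OF inj_on_subset[OF bij_betw_imp_inj_on[OF bij_face_cycle(1)[of f]]]]) auto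
  also have "fst ` {e \<in> ?R. fst e \<in> W} = star f \<inter> W"
    unfolding bij_betw_imp_surj_on[OF bij_face_cycle(1)[of f], symmetric] by (auto intro: rev_image_eqI)
  also have "\<dots> = snd ` {e \<in> ?R. snd e \<in> W}"
    unfolding bij_betw_imp_surj_on[OF bij_face_cycle(2)[of f], symmetric] by (auto intro: rev_image_eqI)
  also have "card \<dots> = card {e \<in> ?R. snd e \<in> W}"
    by (rule card_image[OF inj_on_subset[OF bij_betw_imp_inj_on[OF bij_face_cycle(2)[of f]]]]) auto
  also have "{e \<in> ?R. snd e \<in> W} = {e \<in> ?R. fst e \<notin> W}" using alt by blast
  finally have "card {e \<in> ?R. fst e \<in> W} = card {e \<in> ?R. fst e \<notin> W}" .
  moreover have "card ?R = card {e \<in> ?R. fst e \<in> W} + card {e \<in> ?R. fst e \<notin> W}"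
    by (subst card_Un_disjoint[symmetric]) (auto intro: arg_cong[where f = card])
  ultimately show ?thesis by simp
qed

text \<open>Clockwise around a face, half of the directed edges go from black to white vertices, which changes
  the sign in the definition of a Kasteleyn orientation into \<open>-1\<close>.\<close>

lemma Kasteleyn_condition:
  assumes f: "f \<in> cw_internal h p" and W: "bipartition (cw_graph h p) W"
    and skew: "\<And>e. e \<in> cw_sub_edges h p \<Longrightarrow> \<phi> (prod.swap e) = - \<phi> e"
  shows "(\<Prod>e \<in> {(w, b) \<in> face_boundary (cw_graph h p) f. w \<in> W}. \<phi> e) =
      (-1) ^ (face_degree (cw_graph h p) f div 2 + 1) \<longleftrightarrow> (\<Prod>e\<in>face_cycle h f. \<phi> e) = (-1 :: complex)"
proof -
  let ?R = "face_cycle h f" and ?A = "{e \<in> face_cycle h f. fst e \<in> W}" and ?B = "{e \<in> face_cycle h f. fst e \<notin> W}"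
  have alt: "fst e \<in> W \<longleftrightarrow> snd e \<notin> W" if "e \<in> ?R" for e
    using bipartition_cw[OF W, of e] face_cycle_sub_edges[OF f] that by blast
  have "face_boundary (cw_graph h p) f = ?R \<union> prod.swap ` ?R"
  proof -
    have A: "e \<in> prod.swap ` ?R \<longleftrightarrow> prod.swap e \<in> ?R" for e by (cases e) (simp add: pair_in_swap_image)
    have B: "e \<in> cw_sub_edges h p \<and> cw_right e = f \<longleftrightarrow> e \<in> ?R" for e
      using face_cycle_sub_edges[OF f] by (auto simp: face_cycle_eq cw_sub_edges_iff)
    show ?thesis
    proof (rule set_eqI)
      fix e
      have "e \<in> face_boundary (cw_graph h p) f \<longleftrightarrow>
          e \<in> cw_sub_edges h p \<and> (cw_right e = f \<or> cw_right (prod.swap e) = f)"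
        by (simp add: face_boundary_def cw_graph_def)
      then show "e \<in> face_boundary (cw_graph h p) f \<longleftrightarrow> e \<in> ?R \<union> prod.swap ` ?R"
        unfolding Un_iff A using B[of e] B[of "prod.swap e"] cw_sub_edges_swap[of e p] by blast
    qed
  qed
  then have eq: "{(w, b) \<in> face_boundary (cw_graph h p) f. w \<in> W} = ?A \<union> prod.swap ` ?B"
    using alt by fastforce
  have disj: "?A \<inter> prod.swap ` ?B = {}"
    using face_cycle_edge(2,4) by fastforce
  have "(\<Prod>e \<in> {(w, b) \<in> face_boundary (cw_graph h p) f. w \<in> W}. \<phi> e) = (\<Prod>e\<in>?A. \<phi> e) * (\<Prod>e\<in>?B. \<phi> (prod.swap e))"
    unfolding eq by (subst prod.union_disjoint[OF _ _ disj]) (simp_all add: prod.reindex)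
  also have "(\<Prod>e\<in>?B. \<phi> (prod.swap e)) = (\<Prod>e\<in>?B. - 1 * \<phi> e)"
    using skew face_cycle_sub_edges[OF f] by (intro prod.cong) auto
  also have "\<dots> = (- 1) ^ card ?B * (\<Prod>e\<in>?B. \<phi> e)"
    by (subst prod.distrib) simp
  also have "(\<Prod>e\<in>?A. \<phi> e) * ((- 1) ^ card ?B * (\<Prod>e\<in>?B. \<phi> e)) = (- 1) ^ card ?B * (\<Prod>e\<in>?R. \<phi> e)"
  proof -
    have "?A \<union> ?B = ?R" "?A \<inter> ?B = {}" by auto
    moreover have "finite ?A" "finite ?B" by simp_all
    ultimately have "(\<Prod>e\<in>?R. \<phi> e) = (\<Prod>e\<in>?A. \<phi> e) * (\<Prod>e\<in>?B. \<phi> e)"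
      using prod.union_disjoint[of ?A ?B \<phi>] by simp
    then show ?thesis by simp
  qed
  finally have *: "(\<Prod>e \<in> {(w, b) \<in> face_boundary (cw_graph h p) f. w \<in> W}. \<phi> e) =
    (- 1) ^ card ?B * (\<Prod>e\<in>?R. \<phi> e)" .
  have "face_degree (cw_graph h p) f div 2 = card ?B"
    using card_face_cycle_white[OF f W] by (simp add: face_degree_internal[OF f])
  then show ?thesis
    unfolding * by (simp only: power_add power_one_right mult_cancel_left) simp
qed

lemma white_bipartition: "bipartition (cw_graph h p) {u \<in> white. u \<inter> cw_internal h p \<noteq> {}}"
  unfolding bipartition_def
proof (intro conjI ballI)
  show "{u \<in> white. u \<inter> cw_internal h p \<noteq> {}} \<subseteq> vertices (cw_graph h p)"
    by (auto simp: cw_graph_def white_def)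
  fix e assume "e \<in> dir_edges (cw_graph h p)"
  then have e: "e \<in> cw_edges h" "fst e \<inter> snd e \<inter> cw_internal h p \<noteq> {}"
    by (auto simp: cw_graph_def cw_sub_edges_iff)
  have "fst e \<inter> cw_internal h p \<noteq> {}" "snd e \<inter> cw_internal h p \<noteq> {}" using e(2) by blast+
  then show "case e of (u, v) \<Rightarrow> (u \<in> {u \<in> white. u \<inter> cw_internal h p \<noteq> {}}) =
      (v \<notin> {u \<in> white. u \<inter> cw_internal h p \<noteq> {}})"
    using white_edge[OF e(1)] by (auto simp: case_prod_beta)
qed

definition canonical_orientation :: "cw_vertex \<times> cw_vertex \<Rightarrow> complex" where
  "canonical_orientation e = source_sign h (cw_right e) (cw_right (prod.swap e))"

lemma source_sign_skew:
  assumes "e \<in> cw_edges h"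
  shows "source_sign h (cw_right (prod.swap e)) (cw_right e) = - source_sign h (cw_right e) (cw_right (prod.swap e))"
proof -
  have "snd (cw_right e) \<noteq> snd (cw_right (prod.swap e)) \<or> h (cw_right e) \<noteq> h (cw_right (prod.swap e))"
    using cw_edge_face_cycle[OF assms] unfolding face_cycle_def
  proof (elim UnE CollectE exE conjE)
    fix \<delta> assume e: "e = (corner_vertex h (cw_right e) \<delta>, corner_vertex h (cw_right e + \<delta>) (- \<delta>))" and d: "\<delta> \<in> dirs"
    have "cw_right (prod.swap e) = cw_right e + \<delta>"
      using cw_right_neighbours[of "- \<delta>" "cw_right e + \<delta>"] d e
      by (metis add_diff_cancel diff_conv_add_uminus minus_in_dirs minus_minus swap_simp)
    then show ?thesis using step_cases[OF d, of "cw_right e"] by auto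
  next
    fix \<delta> assume e: "e = (corner_vertex h (cw_right e + rot \<delta>) (- rot \<delta>), corner_vertex h (cw_right e) \<delta>)"
      and d: "\<delta> \<in> dirs" and ne: "h (cw_right e + rot \<delta>) \<noteq> h (cw_right e + \<delta>)"
    have "cw_right (prod.swap e) = cw_right e + \<delta> + rot \<delta>"
      using cw_right_wrench(2)[OF d ne] e by (metis swap_simp)
    then show ?thesis using d by (auto simp: dirs_def)
  qed
  then show ?thesis by (auto simp: source_sign_def)
qed

lemma canonical_skew:
  "e \<in> cw_edges h \<Longrightarrow> canonical_orientation (prod.swap e) = - canonical_orientation e"
  using source_sign_skew[of e] by (simp add: canonical_orientation_def)

lemma prod_canonical: "(\<Prod>e\<in>face_cycle h f. canonical_orientation e) = -1"
  unfolding prod_source_sign[of f, symmetric] canonical_orientation_def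
  by (intro prod.cong) (auto simp: face_cycle_eq)

lemma Kasteleyn_canonical: "Kasteleyn_orientation (cw_graph h p) canonical_orientation"
  unfolding Kasteleyn_orientation_def
proof (intro conjI exI ballI)
  fix e assume "e \<in> dir_edges (cw_graph h p)"
  then have "e \<in> cw_edges h" by (simp add: cw_graph_def cw_sub_edges_iff)
  then show "canonical_orientation (prod.swap e) = - canonical_orientation e" by (rule canonical_skew)
  show "canonical_orientation e \<in> {1, -1}" by (simp add: canonical_orientation_def source_sign_def)
next
  show "bipartition (cw_graph h p) {u \<in> white. u \<inter> cw_internal h p \<noteq> {}}" by (rule white_bipartition)
  fix f assume "f \<in> internal_faces (cw_graph h p)"
  then have f: "f \<in> cw_internal h p" by (simp add: cw_graph_def)
  show "(\<Prod>e\<in>{(w, b) \<in> face_boundary (cw_graph h p) f. w \<in> {u \<in> white. u \<inter> cw_internal h p \<noteq> {}}}.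
      canonical_orientation e) = (- 1) ^ (face_degree (cw_graph h p) f div 2 + 1)"
    by (subst Kasteleyn_condition[OF f white_bipartition])
      (auto simp: canonical_skew cw_sub_edges_iff prod_canonical)
qed

lemma Kasteleyn_prod:
  assumes "Kasteleyn_orientation (cw_graph h p) \<phi>" "f \<in> cw_internal h p"
  shows "(\<Prod>e\<in>face_cycle h f. \<phi> e) = -1"
proof -
  have s: "\<And>e. e \<in> cw_sub_edges h p \<Longrightarrow> \<phi> (prod.swap e) = - \<phi> e"
    using assms(1) by (simp add: Kasteleyn_orientation_def cw_graph_def)
  obtain W where W: "bipartition (cw_graph h p) W"
    "(\<Prod>e \<in> {(w, b) \<in> face_boundary (cw_graph h p) f. w \<in> W}. \<phi> e) = (-1) ^ (face_degree (cw_graph h p) f div 2 + 1)"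
    using assms by (auto simp: Kasteleyn_orientation_def cw_graph_def)
  show ?thesis using Kasteleyn_condition[OF assms(2) W(1), of \<phi>] s W(2) by simp
qed

lemma even_face_cycle: "f \<in> cw_internal h p \<Longrightarrow> even (card (face_cycle h f))"
  using card_face_cycle_white[OF _ white_bipartition, of f p] by simp

end

section \<open>Internal and open faces of the cone below a point\<close>

locale cone = heights +
  fixes px py k :: int
  assumes even_h: "even (fst f + snd f + h f)"
    and even_p: "even (px + py + k)"
    and finite_internal: "finite (cw_internal h (px, py, k))"
begin

abbreviation "II \<equiv> cw_internal h (px, py, k)"
abbreviation "EE \<equiv> cw_sub_edges h (px, py, k)"
abbreviation "FO \<equiv> cw_open h (px, py, k)"
abbreviation "GG \<equiv> cw_graph h (px, py, k)"
abbreviation "VV \<equiv> {v \<in> cw_vertices h. v \<inter> II \<noteq> {}}"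

definition dist1 :: "face \<Rightarrow> int" where
  "dist1 f = \<bar>px - fst f\<bar> + \<bar>py - snd f\<bar>"

lemma internal_iff: "f \<in> II \<longleftrightarrow> h f + dist1 f < k"
  using even_h[of f] by (cases f) (auto simp: cw_internal_def even_lattice_def dist1_def add.commute)

lemma even_level: "even (h f + dist1 f - k)"
  using even_h[of f] even_p by (auto simp: dist1_def)

lemma internal_iff2: "f \<in> II \<longleftrightarrow> h f + dist1 f \<le> k - 2"
  using internal_iff[of f] even_level[of f] by presburger

lemma dist1_step:
  assumes "\<delta> \<in> dirs"
  shows "dist1 (f + \<delta>) = dist1 f + 1 \<or> dist1 (f + \<delta>) = dist1 f - 1"
  using assms by (cases f; elim dirs_cases; auto simp: dist1_def)

lemma dist1_opposite:
  assumes "\<delta> \<in> dirs" "dist1 (f + \<delta>) = dist1 f - 1"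
  shows "dist1 (f + - \<delta>) = dist1 f + 1"
  using assms by (cases f; elim dirs_cases; auto simp: dist1_def)

lemma dist1_square:
  assumes "\<delta> \<in> dirs"
  shows "dist1 (f + \<delta> + rot \<delta>) = dist1 (f + \<delta>) + dist1 (f + rot \<delta>) - dist1 f"
  using assms by (cases f; elim dirs_cases; simp add: dist1_def)

text \<open>Between neighbours both \<open>h\<close> and \<open>dist1\<close>, the distance to the
  apex \<open>(px, py)\<close>, change by one, and their sum has the parity of \<open>k\<close>.
  Entering the cone means passing from a level of at least \<open>k\<close> to one of at most
  \<open>k - 2\<close>, so both must drop.\<close>

lemma neighbour_internal:
  assumes "\<delta> \<in> dirs" "f \<notin> II" "f + \<delta> \<in> II"
  shows "dist1 (f + \<delta>) = dist1 f - 1" "h (f + \<delta>) = h f - 1" "h f + dist1 f = k"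
  using assms dist1_step[OF assms(1), of f] step_cases[OF assms(1), of f]
  unfolding internal_iff2 using internal_iff[of f] internal_iff2[of f] by auto

lemma diagonal_internal:
  assumes "\<delta> \<in> dirs" "f \<notin> II" "f + \<delta> + rot \<delta> \<in> II" "h (f + \<delta> + rot \<delta>) = h f"
  shows "dist1 (f + \<delta>) = dist1 f - 1" "dist1 (f + rot \<delta>) = dist1 f - 1" "h f + dist1 f = k"
  using assms dist1_step[OF assms(1), of f] dist1_step[of "rot \<delta>" f] dist1_square[OF assms(1), of f]
  unfolding internal_iff2 using internal_iff[of f] internal_iff2[of f] by auto

lemma sub_edge_cycle:
  assumes "f \<notin> II" "e \<in> face_cycle h f"
  shows "e \<in> EE \<longleftrightarrow> cw_right (prod.swap e) \<in> II"
  using assms by (auto simp: face_cycle_eq cw_sub_edges_def)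

lemma open_face_edge_cases:
  assumes "f \<notin> II" "e \<in> face_cycle h f \<inter> EE"
  obtains \<delta> where "\<delta> \<in> dirs" "e = (corner_vertex h f \<delta>, corner_vertex h (f + \<delta>) (- \<delta>))"
      "f + \<delta> \<in> II"
  | \<delta> where "\<delta> \<in> dirs" "h (f + rot \<delta>) \<noteq> h (f + \<delta>)"
      "e = (corner_vertex h (f + rot \<delta>) (- rot \<delta>), corner_vertex h f \<delta>)" "f + \<delta> + rot \<delta> \<in> II"
proof -
  have e: "e \<in> face_cycle h f" "cw_right (prod.swap e) \<in> II"
    using assms sub_edge_cycle[OF assms(1), of e] by auto
  from e(1) show thesis
    unfolding face_cycle_def
  proof (elim UnE CollectE exE conjE)
    fix \<delta> assume a: "e = (corner_vertex h f \<delta>, corner_vertex h (f + \<delta>) (- \<delta>))" "\<delta> \<in> dirs"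
    then have "cw_right (prod.swap e) = f + \<delta>"
      using cw_right_neighbours[of "- \<delta>" "f + \<delta>"] by simp
    then show thesis using that(1) a e(2) by simp
  next
    fix \<delta> assume a: "e = (corner_vertex h (f + rot \<delta>) (- rot \<delta>), corner_vertex h f \<delta>)" "\<delta> \<in> dirs"
      "h (f + rot \<delta>) \<noteq> h (f + \<delta>)"
    then have "cw_right (prod.swap e) = f + \<delta> + rot \<delta>"
      using cw_right_wrench(2)[OF a(2,3)] by simp
    then show thesis using that(2) a e(2) by simp
  qed
qed

text \<open>Internal faces adjacent to \<open>f\<close> are nearer to the apex. Hence all edges in
  question belong to one quadrant at \<open>f\<close>: a wrench and the edge to the lower of the two
  neighbours beside it, or the edges to two neighbours of equal height, which meet because no wrench
  comes between them, or a single edge. The common vertex \<open>v\<close> prevents a dimer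
  configuration from containing two of them.\<close>

lemma open_face_edges:
  assumes f: "f \<notin> II"
  obtains x y v where "face_cycle h f \<inter> EE \<subseteq> {x, y}" "v \<in> {fst x, snd x}" "v \<in> {fst y, snd y}"
proof (cases "\<exists>\<delta>\<in>dirs. h (f + rot \<delta>) \<noteq> h (f + \<delta>) \<and> f + \<delta> + rot \<delta> \<in> II")
  case True
  then obtain \<delta> where d: "\<delta> \<in> dirs" and ne: "h (f + rot \<delta>) \<noteq> h (f + \<delta>)" and dI: "f + \<delta> + rot \<delta> \<in> II" by blast
  define x where "x = (corner_vertex h (f + rot \<delta>) (- rot \<delta>), corner_vertex h f \<delta>)"
  define \<eta> where "\<eta> = (if h (f + \<delta>) < h f then \<delta> else rot \<delta>)"
  define y where "y = (corner_vertex h f \<eta>, corner_vertex h (f + \<eta>) (- \<eta>))"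
  note t = diagonal_internal[OF d f dI inter_wrench(4)[OF d ne]]
  have away: "dist1 (f + - \<delta>) = dist1 f + 1" "dist1 (f + - rot \<delta>) = dist1 f + 1"
    using dist1_opposite[OF d t(1)] dist1_opposite[of "rot \<delta>"] d t(2) by auto
  have "e \<in> {x, y}" if e: "e \<in> face_cycle h f \<inter> EE" for e
    using open_face_edge_cases[OF f e]
  proof cases
    case (1 \<epsilon>)
    note n = neighbour_internal[OF 1(1) f 1(3)]
    have "\<epsilon> = \<delta> \<or> \<epsilon> = rot \<delta>" using dirs_four[OF d 1(1)] n(1) away by auto
    then have "\<epsilon> = \<eta>"
      using n(2) ne step_cases[OF d, of f] step_cases[of "rot \<delta>" f] d by (auto simp: \<eta>_def)
    then show ?thesis using 1 by (simp add: y_def)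
  next
    case (2 \<epsilon>)
    note n = diagonal_internal[OF 2(1) f 2(4) inter_wrench(4)[OF 2(1,2)]]
    have "\<epsilon> = \<delta> \<or> \<epsilon> = rot \<delta>" using dirs_four[OF d 2(1)] n(1) away by auto
    then have "\<epsilon> = \<delta>" using n(2) away by auto
    then show ?thesis using 2 by (simp add: x_def)
  qed
  then have "face_cycle h f \<inter> EE \<subseteq> {x, y}" by blast
  then show thesis
    using that[of x y "if h (f + \<delta>) < h f then snd x else fst x"] by (simp add: x_def y_def \<eta>_def)
next
  case False
  have nb: "\<exists>\<delta>\<in>dirs. e = (corner_vertex h f \<delta>, corner_vertex h (f + \<delta>) (- \<delta>)) \<and> f + \<delta> \<in> II"
    if "e \<in> face_cycle h f \<inter> EE" for e
    using open_face_edge_cases[OF f that] False by metis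
  show thesis
  proof (cases "\<exists>\<delta>\<in>dirs. f + \<delta> \<in> II \<and> f + rot \<delta> \<in> II")
    case True
    then obtain \<delta> where d: "\<delta> \<in> dirs" "f + \<delta> \<in> II" "f + rot \<delta> \<in> II" by blast
    define x where "x = (corner_vertex h f \<delta>, corner_vertex h (f + \<delta>) (- \<delta>))"
    define y where "y = (corner_vertex h f (rot \<delta>), corner_vertex h (f + rot \<delta>) (- rot \<delta>))"
    have rd: "rot \<delta> \<in> dirs" using d by simp
    note n = neighbour_internal[OF d(1) f d(2)] and n' = neighbour_internal[OF rd f d(3)]
    have away: "dist1 (f + - \<delta>) = dist1 f + 1" "dist1 (f + - rot \<delta>) = dist1 f + 1"
      using dist1_opposite[OF d(1) n(1)] dist1_opposite[OF rd n'(1)] by auto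
    have "e \<in> {x, y}" if e: "e \<in> face_cycle h f \<inter> EE" for e
    proof -
      obtain \<epsilon> where eps: "\<epsilon> \<in> dirs" "e = (corner_vertex h f \<epsilon>, corner_vertex h (f + \<epsilon>) (- \<epsilon>))" "f + \<epsilon> \<in> II"
        using nb[OF e] by blast
      have "\<epsilon> = \<delta> \<or> \<epsilon> = rot \<delta>"
        using dirs_four[OF d(1) eps(1)] neighbour_internal(1)[OF eps(1) f eps(3)] away by auto
      then show ?thesis using eps by (auto simp: x_def y_def)
    qed
    then have "face_cycle h f \<inter> EE \<subseteq> {x, y}" by blast
    moreover have "fst x = snd y"
      using wrench_iff[OF d(1), of f] n(2) n'(2) by (simp add: x_def y_def)
    ultimately show thesis using that[of x y "fst x"] by simp
  next
    case F: False
    have "e = e'" if e: "e \<in> face_cycle h f \<inter> EE" "e' \<in> face_cycle h f \<inter> EE" for e e'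
    proof -
      obtain \<delta> where d: "\<delta> \<in> dirs" "e = (corner_vertex h f \<delta>, corner_vertex h (f + \<delta>) (- \<delta>))" "f + \<delta> \<in> II"
        using nb[OF e(1)] by blast
      obtain \<epsilon> where eps: "\<epsilon> \<in> dirs" "e' = (corner_vertex h f \<epsilon>, corner_vertex h (f + \<epsilon>) (- \<epsilon>))" "f + \<epsilon> \<in> II"
        using nb[OF e(2)] by blast
      have "\<epsilon> \<noteq> - \<delta>"
        using dist1_opposite[OF d(1) neighbour_internal(1)[OF d(1) f d(3)]]
          neighbour_internal(1)[OF eps(1) f eps(3)] by auto
      moreover have "\<epsilon> \<noteq> rot \<delta>" using F d eps by auto
      moreover have "\<epsilon> \<noteq> - rot \<delta>" using F d(3) eps(1,3) by (metis minus_minus rot_minus rot_rot)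
      ultimately have "\<epsilon> = \<delta>" using dirs_four[OF d(1) eps(1)] by auto
      then show ?thesis using d eps by simp
    qed
    then obtain x where "face_cycle h f \<inter> EE \<subseteq> {x}" by blast
    then show thesis using that[of x x "fst x"] by simp
  qed
qed

text \<open>A face outside the cone never has all its edges in the graph: the neighbour in a
  direction away from the apex is not internal.\<close>

lemma open_iff: "f \<in> FO \<longleftrightarrow> f \<notin> II \<and> face_cycle h f \<inter> EE \<noteq> {}"
proof (cases "f \<in> II")
  case True
  then show ?thesis using face_cycle_sub_edges[OF True] by (auto simp: cw_open_def face_cycle_eq)
next
  case False
  obtain \<delta> where d: "\<delta> \<in> dirs" "dist1 (f + \<delta>) = dist1 f + 1"
    using dist1_step[of "(1, 0)" f] dist1_opposite[of "(1, 0)" f] that by (auto simp: dirs_def)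
  then have "f + \<delta> \<notin> II"
    using neighbour_internal(1)[OF d(1) False] by auto
  define e where "e = (corner_vertex h f \<delta>, corner_vertex h (f + \<delta>) (- \<delta>))"
  have e: "e \<in> face_cycle h f" using face_cycle_neighbour[OF d(1)] by (simp add: e_def)
  have "cw_right (prod.swap e) = f + \<delta>"
    using cw_right_neighbours[of "- \<delta>" "f + \<delta>"] d by (simp add: e_def)
  then have "e \<notin> EE" using sub_edge_cycle[OF False e] \<open>f + \<delta> \<notin> II\<close> by simp
  then show ?thesis using False e by (auto simp: cw_open_def face_cycle_eq)
qed

lemma face_degree_open:
  assumes "f \<in> FO"
  shows "\<lceil>real (face_degree GG f) / 2\<rceil> = 1"
proof -
  obtain x y v where xy: "face_cycle h f \<inter> EE \<subseteq> {x, y}"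
    using open_face_edges[of f] assms open_iff by metis
  have "card (face_cycle h f \<inter> EE) \<le> card {x, y}"
    using xy by (intro card_mono) auto
  also have "\<dots> \<le> 2" by (simp add: card_insert_if)
  finally have "card (face_cycle h f \<inter> EE) \<le> 2" .
  moreover have "card (face_cycle h f \<inter> EE) > 0"
    using assms open_iff by (simp add: card_gt_0_iff)
  ultimately show ?thesis
    unfolding face_degree_cw by (intro ceiling_unique) auto
qed

lemma right_sub_edge: "e \<in> EE \<Longrightarrow> cw_right e \<in> II \<union> FO"
  using cw_edge_face_cycle[of e] open_iff[of "cw_right e"] cw_sub_edges_iff[of e "(px, py, k)"]
  by (metis IntI UnCI empty_iff)

lemma finite_star: "finite (star f)"
  using bij_face_cycle(1)[of f] bij_betw_finite finite_face_cycle by blast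

lemma finite_VV: "finite VV"
proof -
  have "VV \<subseteq> (\<Union>f\<in>II. star f)" by blast
  then show ?thesis using finite_internal finite_star by (meson finite_UN finite_subset)
qed

lemma sub_edge_ends: "e \<in> EE \<Longrightarrow> fst e \<in> VV \<and> snd e \<in> VV"
  by (auto simp: cw_sub_edges_iff cw_edges_def)

lemma finite_EE: "finite EE"
  using sub_edge_ends by (intro finite_subset[OF _ finite_cartesian_product[OF finite_VV finite_VV]]) (auto simp: mem_Times_iff)

lemma finite_FO: "finite FO"
proof (rule finite_subset[OF _ finite_imageI[OF finite_EE, of cw_right]], rule subsetI)
  fix f assume "f \<in> FO"
  then obtain e where "cw_right e = f" "e \<in> EE" unfolding cw_open_def by blast
  then show "f \<in> cw_right ` EE" by blast
qed

text \<open>The exponents of the prefactor as natural numbers: a face has at least four edges, and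
  the rounded half degree of an open face is 1 by \<open>face_degree_open\<close>. The same numbers
  turn out to be the degrees of numerator and denominator in each weight.\<close>

definition expo :: "face \<Rightarrow> nat" where
  "expo f = (if f \<in> II then card (face_cycle h f) div 2 - 1 else if f \<in> FO then 1 else 0)"

lemma prefactor: "ratio_prefactor GG a = (\<Prod>f\<in>II \<union> FO. a f ^ expo f)"
proof -
  have 1: "int (face_degree GG f) div 2 - 1 = int (card (face_cycle h f) div 2 - 1)" if "f \<in> II" for f
    using card_face_cycle[of f] by (simp add: face_degree_internal[OF that] zdiv_int of_nat_diff)
  have "ratio_prefactor GG a = (\<Prod>f\<in>II. a f ^ expo f) * (\<Prod>f\<in>FO. a f ^ expo f)"
    unfolding ratio_prefactor_def
  proof (intro arg_cong2[where f = times] prod.cong)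
    show "a f powi (int (face_degree GG f) div 2 - 1) = a f ^ expo f" if "f \<in> II" for f
      unfolding 1[OF that] using that by (simp add: expo_def)
    show "a f powi \<lceil>real (face_degree GG f) / 2\<rceil> = a f ^ expo f" if "f \<in> FO" for f
      unfolding face_degree_open[OF that] using that open_iff by (simp add: expo_def)
  qed (simp_all add: cw_graph_def)
  also have "\<dots> = (\<Prod>f\<in>II \<union> FO. a f ^ expo f)"
    using open_iff by (intro prod.union_disjoint[symmetric] finite_internal finite_FO) auto
  finally show ?thesis .
qed

end

section \<open>The numerator and the denominator as polynomials\<close>

lemma prod_in_signs:
  assumes "\<And>e. e \<in> A \<Longrightarrow> f e \<in> {1, -1 :: 'a :: comm_ring_1}"
  shows "prod f A \<in> {1, -1}"
  using assms
proof (induction A rule: infinite_finite_induct)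
  case (insert x F)
  then have "f x \<in> {1, -1}" "prod f F \<in> {1, -1}" by auto
  then show ?case using insert(1,2) by auto
qed auto

context cone
begin

abbreviation "DD \<equiv> oriented_dimers GG"

lemma dimer_sub: "M \<in> DD \<Longrightarrow> M \<subseteq> EE"
  by (simp add: oriented_dimers_def cw_graph_def)

lemma dimer_unique:
  assumes "M \<in> DD" "e \<in> M" "e' \<in> M" "v \<in> {fst e, snd e}" "v \<in> {fst e', snd e'}"
  shows "e = e'"
proof -
  have "v \<in> VV" using assms(4) sub_edge_ends[of e] dimer_sub[OF assms(1)] assms(2) by auto
  then have "\<exists>!e. e \<in> M \<and> (fst e = v \<or> snd e = v)"
    using assms(1) by (simp add: oriented_dimers_def cw_graph_def)
  then show ?thesis using assms(2-5) by auto
qed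

lemma dimer_covers:
  assumes "M \<in> DD" "v \<in> VV"
  obtains e where "e \<in> M" "v \<in> {fst e, snd e}"
proof -
  have "\<exists>!e. e \<in> M \<and> (fst e = v \<or> snd e = v)"
    using assms by (simp add: oriented_dimers_def cw_graph_def)
  then show thesis using that by auto
qed

lemma dimerI:
  assumes "M \<subseteq> EE" "\<And>v. v \<in> VV \<Longrightarrow> \<exists>!e. e \<in> M \<and> (fst e = v \<or> snd e = v)"
  shows "M \<in> DD"
  using assms by (simp add: oriented_dimers_def cw_graph_def)

lemma finite_DD: "finite DD"
  using dimer_sub by (intro finite_subset[OF _ finite_Pow_iff[THEN iffD2, OF finite_EE]]) auto

lemma edge_no_loop: "e \<in> cw_edges h \<Longrightarrow> fst e \<noteq> snd e"
  using card_cw_vertex[of "fst e"] by (auto simp: cw_edges_def)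

lemma count_open: 
  assumes "M \<in> DD" "f \<notin> II"
  shows "card (M \<inter> face_cycle h f) \<le> 1"
proof -
  obtain x y v where xy: "face_cycle h f \<inter> EE \<subseteq> {x, y}" "v \<in> {fst x, snd x}" "v \<in> {fst y, snd y}"
    using open_face_edges[OF assms(2)] by metis
  have "e = e'" if "e \<in> M \<inter> face_cycle h f" "e' \<in> M \<inter> face_cycle h f" for e e'
    using dimer_unique[OF assms(1), of e e' v] xy dimer_sub[OF assms(1)] that by blast
  then show ?thesis
    by (metis card.empty card_1_singleton_iff card_le_Suc0_iff_eq finite_Int finite_face_cycle One_nat_def)
qed

text \<open>Edges of \<open>M\<close> are disjoint, and each covers two vertices of
  \<open>f\<close>. If \<open>f\<close> has \<open>d\<close> vertices, at most \<open>d / 2\<close>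
  edges fit; more than \<open>d / 2 - 1\<close> forces equality, and then every vertex is
  covered.\<close>

lemma full_face:
  assumes M: "M \<in> DD" and f: "f \<in> II" and full: "expo f < card (M \<inter> face_cycle h f)"
  shows "2 * card (M \<inter> face_cycle h f) = card (face_cycle h f)"
    and "star f \<subseteq> fst ` (M \<inter> face_cycle h f) \<union> snd ` (M \<inter> face_cycle h f)"
proof -
  let ?A = "M \<inter> face_cycle h f"
  have inj: "inj_on fst ?A" "inj_on snd ?A"
    using bij_betw_imp_inj_on[OF bij_face_cycle(1)] bij_betw_imp_inj_on[OF bij_face_cycle(2)]
    by (meson inf_le2 inj_on_subset)+
  have sub: "fst ` ?A \<union> snd ` ?A \<subseteq> star f" using face_cycle_ends by blast
  have disj: "fst ` ?A \<inter> snd ` ?A = {}"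
  proof (rule ccontr)
    assume "fst ` ?A \<inter> snd ` ?A \<noteq> {}"
    then obtain e e' where e: "e \<in> ?A" "e' \<in> ?A" "fst e = snd e'" by blast
    then have "e = e'" using dimer_unique[OF M, of e e' "fst e"] by auto
    then show False using e edge_no_loop[of e] face_cycle_edge(1)[of e f] by auto
  qed
  have c: "card (fst ` ?A \<union> snd ` ?A) = 2 * card ?A"
    by (subst card_Un_disjoint[OF _ _ disj]) (simp_all add: card_image inj)
  have s: "card (star f) = card (face_cycle h f)"
    using bij_betw_same_card[OF bij_face_cycle(1)[of f]] by simp
  have "card (face_cycle h f) \<le> 2 * card ?A"
    using full f even_face_cycle[OF f] card_face_cycle[of f] by (auto simp: expo_def elim!: evenE)
  moreover have "2 * card ?A \<le> card (face_cycle h f)"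
    using card_mono[OF finite_star sub] c s by simp
  ultimately show eq: "2 * card ?A = card (face_cycle h f)" by simp
  have "fst ` ?A \<union> snd ` ?A = star f"
    using sub finite_star c s eq by (intro card_subset_eq) auto
  then show "star f \<subseteq> fst ` ?A \<union> snd ` ?A" by simp
qed

text \<open>Exchanging the edges around \<open>f\<close> in a configuration with more than \<open>expo f\<close> of them is an involution
  which changes the sign of the weight. The remaining configurations have at most the degree of the
  prefactor in each weight.\<close>

definition rotate :: "face \<Rightarrow> (cw_vertex \<times> cw_vertex) set \<Rightarrow> (cw_vertex \<times> cw_vertex) set" where
  "rotate f M = (M - face_cycle h f) \<union> (face_cycle h f - M)"

text \<open>All vertices of \<open>f\<close> are covered by cycle edges in \<open>M\<close>, so
  exactly one of the incoming and the outgoing cycle edge at each of them is used. The rotation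
  replaces it by the other one and touches no other vertex.\<close>

lemma rotate_dimer:
  assumes M: "M \<in> DD" and f: "f \<in> II" and full: "expo f < card (M \<inter> face_cycle h f)"
  shows "rotate f M \<in> DD"
proof (rule dimerI)
  let ?R = "face_cycle h f"
  show "rotate f M \<subseteq> EE"
    using dimer_sub[OF M] face_cycle_sub_edges[OF f] by (auto simp: rotate_def)
  fix v assume v: "v \<in> VV"
  show "\<exists>!e. e \<in> rotate f M \<and> (fst e = v \<or> snd e = v)"
  proof (cases "f \<in> v")
    case False
    have no: "fst e \<noteq> v" "snd e \<noteq> v" if "e \<in> ?R" for e
      using face_cycle_ends[OF that] False by auto
    obtain e where e: "e \<in> M" "v \<in> {fst e, snd e}" using dimer_covers[OF M v] .
    show ?thesis
    proof (rule ex1I[of _ e])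
      show "e \<in> rotate f M \<and> (fst e = v \<or> snd e = v)" using e no[of e] by (auto simp: rotate_def)
      fix e' assume "e' \<in> rotate f M \<and> (fst e' = v \<or> snd e' = v)"
      then show "e' = e" using no[of e'] e dimer_unique[OF M, of e' e v] by (auto simp: rotate_def)
    qed
  next
    case True
    then have vs: "v \<in> cw_vertices h" "v \<in> star f" using v by auto
    obtain eo where eo: "eo \<in> ?R" "fst eo = v" "\<And>e. e \<in> ?R \<Longrightarrow> fst e = v \<Longrightarrow> e = eo"
      using face_cycle_out[OF vs(1) True] by (elim ex1E) blast
    obtain ei where ei: "ei \<in> ?R" "snd ei = v" "\<And>e. e \<in> ?R \<Longrightarrow> snd e = v \<Longrightarrow> e = ei"
      using face_cycle_in[OF vs(1) True] by (elim ex1E) blast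
    have ne: "eo \<noteq> ei" using eo(2) ei(2) edge_no_loop[OF face_cycle_edge(1)[OF eo(1)]] by auto
    have one: "eo \<in> M \<and> ei \<notin> M \<or> ei \<in> M \<and> eo \<notin> M"
    proof -
      have "v \<in> fst ` (M \<inter> ?R) \<or> v \<in> snd ` (M \<inter> ?R)" using full_face(2)[OF assms] vs(2) by blast
      then have "eo \<in> M \<or> ei \<in> M" using eo(3) ei(3) by blast
      moreover have "\<not> (eo \<in> M \<and> ei \<in> M)"
        using dimer_unique[OF M, of eo ei v] eo(2) ei(2) ne by auto
      ultimately show ?thesis by blast
    qed
    have M_R: "e \<in> ?R" if "e \<in> M" "fst e = v \<or> snd e = v" for e
    proof -
      have v': "v \<in> {fst e, snd e}" using that(2) by auto
      from one have "e = eo \<or> e = ei"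
        using dimer_unique[OF M that(1) _ v', of eo] dimer_unique[OF M that(1) _ v', of ei] eo(2) ei(2) by blast
      then show ?thesis using eo(1) ei(1) by blast
    qed
    have inR: "e = eo \<or> e = ei" if "e \<in> ?R" "fst e = v \<or> snd e = v" for e using that eo(3) ei(3) by blast
    from one show ?thesis
    proof
      assume a: "eo \<in> M \<and> ei \<notin> M"
      show ?thesis
      proof (rule ex1I[of _ ei])
        show "ei \<in> rotate f M \<and> (fst ei = v \<or> snd ei = v)" using ei(1,2) a by (simp add: rotate_def)
        fix e assume "e \<in> rotate f M \<and> (fst e = v \<or> snd e = v)"
        then show "e = ei" using M_R[of e] inR[of e] a by (auto simp: rotate_def)
      qed
    next
      assume a: "ei \<in> M \<and> eo \<notin> M"
      show ?thesis
      proof (rule ex1I[of _ eo])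
        show "eo \<in> rotate f M \<and> (fst eo = v \<or> snd eo = v)" using eo(1,2) a by (simp add: rotate_def)
        fix e assume "e \<in> rotate f M \<and> (fst e = v \<or> snd e = v)"
        then show "e = eo" using M_R[of e] inR[of e] a by (auto simp: rotate_def)
      qed
    qed
  qed
qed

lemma face_cycles_disjoint: "f \<noteq> g \<Longrightarrow> face_cycle h f \<inter> face_cycle h g = {}"
  by (auto simp: face_cycle_eq)

lemma count_rotate:
  assumes "M \<in> DD" "f \<in> II" "expo f < card (M \<inter> face_cycle h f)"
  shows "card (rotate f M \<inter> face_cycle h g) = card (M \<inter> face_cycle h g)"
proof (cases "f = g")
  case True
  have "rotate f M \<inter> face_cycle h g = face_cycle h f - M \<inter> face_cycle h f"
    using True by (auto simp: rotate_def)
  then have "card (rotate f M \<inter> face_cycle h g) = card (face_cycle h f) - card (M \<inter> face_cycle h f)"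
    by (simp add: card_Diff_subset)
  then show ?thesis using full_face(1)[OF assms] True by simp
next
  case False
  have "rotate f M \<inter> face_cycle h g = M \<inter> face_cycle h g"
    using face_cycles_disjoint[OF False] by (auto simp: rotate_def)
  then show ?thesis by simp
qed

definition dimer_weight ::
  "(cw_vertex \<times> cw_vertex \<Rightarrow> complex) \<Rightarrow> (face \<Rightarrow> complex) \<Rightarrow> (cw_vertex \<times> cw_vertex) set \<Rightarrow> complex" where
  "dimer_weight \<phi> a M = (\<Prod>e\<in>M. \<phi> e * a (cw_right e))"

lemma finite_dimer: "M \<in> DD \<Longrightarrow> finite M"
  using dimer_sub finite_EE finite_subset by blast

text \<open>The signs around \<open>f\<close> have product -1, so the two halves of the cycle have
  opposite products, while both contribute the same power of \<open>a f\<close>.\<close>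

lemma weight_rotate:
  assumes M: "M \<in> DD" and f: "f \<in> II" and full: "expo f < card (M \<inter> face_cycle h f)"
    and K: "Kasteleyn_orientation GG \<phi>"
  shows "dimer_weight \<phi> a (rotate f M) = - dimer_weight \<phi> a M"
proof -
  let ?R = "face_cycle h f"
  have sgn: "\<phi> e \<in> {1, -1}" if "e \<in> ?R" for e
    using K face_cycle_sub_edges[OF f] that by (auto simp: Kasteleyn_orientation_def cw_graph_def)
  have w: "dimer_weight \<phi> a N = (\<Prod>e\<in>N. \<phi> e) * a f ^ card N" if "N \<subseteq> ?R" for N
    unfolding dimer_weight_def prod.distrib
    by (subst prod.cong[OF refl, of N "\<lambda>e. a (cw_right e)" "\<lambda>_. a f"]) (use that in \<open>auto simp: face_cycle_eq\<close>)
  have "(\<Prod>e\<in>M \<inter> ?R. \<phi> e) * (\<Prod>e\<in>?R - M. \<phi> e) = -1"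
  proof -
    have "(M \<inter> ?R) \<union> (?R - M) = ?R" "(M \<inter> ?R) \<inter> (?R - M) = {}" by auto
    then show ?thesis
      using prod.union_disjoint[of "M \<inter> ?R" "?R - M" \<phi>] Kasteleyn_prod[OF K f] by simp
  qed
  moreover have "(\<Prod>e\<in>M \<inter> ?R. \<phi> e) \<in> {1, -1}"
    by (rule prod_in_signs) (use sgn in auto)
  ultimately have p: "(\<Prod>e\<in>?R - M. \<phi> e) = - (\<Prod>e\<in>M \<inter> ?R. \<phi> e)" by (auto simp: minus_equation_iff)
  have c: "card (?R - M) = card (M \<inter> ?R)"
    using full_face(1)[OF M f full] card_Diff_subset_Int[of ?R M] by (simp add: Int_commute)
  have "dimer_weight \<phi> a (rotate f M) = dimer_weight \<phi> a (M - ?R) * dimer_weight \<phi> a (?R - M)"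
    unfolding dimer_weight_def rotate_def using finite_dimer[OF M] by (intro prod.union_disjoint) auto
  also have "\<dots> = - (dimer_weight \<phi> a (M - ?R) * dimer_weight \<phi> a (M \<inter> ?R))"
    by (simp add: w p c)
  also have "dimer_weight \<phi> a (M - ?R) * dimer_weight \<phi> a (M \<inter> ?R) = dimer_weight \<phi> a M"
    unfolding dimer_weight_def
    by (subst prod.union_disjoint[symmetric]) (use finite_dimer[OF M] in \<open>auto intro: prod.cong\<close>)
  finally show ?thesis .
qed

definition good_dimers :: "(cw_vertex \<times> cw_vertex) set set" where
  "good_dimers = {M \<in> DD. \<forall>f. card (M \<inter> face_cycle h f) \<le> expo f}"

lemma count_other:
  assumes "M \<in> DD" "f \<notin> II \<union> FO"
  shows "M \<inter> face_cycle h f = {}"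
  using dimer_sub[OF assms(1)] assms(2) open_iff[of f] by blast

lemma sum_bad_dimers:
  assumes K: "Kasteleyn_orientation GG \<phi>"
  shows "(\<Sum>M\<in>DD - good_dimers. dimer_weight \<phi> a M) = 0"
proof -
  define bad where "bad M = {f \<in> II. expo f < card (M \<inter> face_cycle h f)}" for M
  \<comment> \<open>The chosen face depends only on the set \<open>bad M\<close>, which a rotation
    preserves. So the same face is chosen again after rotating, which makes the map an
    involution.\<close>
  define g where "g M = (SOME f. f \<in> bad M)" for M
  have bad: "M \<in> DD - good_dimers \<longleftrightarrow> M \<in> DD \<and> bad M \<noteq> {}" for M
  proof -
    have "card (M \<inter> face_cycle h f) \<le> expo f" if "M \<in> DD" "f \<notin> II" for f
      using count_open[OF that] count_other[OF that(1), of f] that(2) by (auto simp: expo_def)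
    then show ?thesis unfolding good_dimers_def bad_def by (auto simp: not_le[symmetric])
  qed
  have g: "g M \<in> II" "expo (g M) < card (M \<inter> face_cycle h (g M))" if "M \<in> DD - good_dimers" for M
    using someI_ex[of "\<lambda>f. f \<in> bad M"] that bad[of M] unfolding g_def by (auto simp: bad_def)
  have br: "bad (rotate (g M) M) = bad M" if "M \<in> DD - good_dimers" for M
    unfolding bad_def using count_rotate[OF _ g[OF that]] that by simp
  have gr: "g (rotate (g M) M) = g M" if "M \<in> DD - good_dimers" for M
    by (rule trans[OF g_def]) (simp only: br[OF that] g_def[symmetric])
  have rr: "rotate f (rotate f M) = M" for f M by (auto simp: rotate_def)
  have in_bad: "rotate (g M) M \<in> DD - good_dimers" if M: "M \<in> DD - good_dimers" for M
    unfolding bad br[OF M] using rotate_dimer[OF _ g[OF M]] M bad[of M] by blast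
  have "(\<Sum>M\<in>DD - good_dimers. dimer_weight \<phi> a M) = (\<Sum>M\<in>DD - good_dimers. dimer_weight \<phi> a (rotate (g M) M))"
    by (rule sum.reindex_bij_witness[where i = "\<lambda>M. rotate (g M) M" and j = "\<lambda>M. rotate (g M) M"])
      (use in_bad gr rr in auto)
  also have "\<dots> = - (\<Sum>M\<in>DD - good_dimers. dimer_weight \<phi> a M)"
    unfolding sum_negf[symmetric] using weight_rotate[OF _ g K] by (intro sum.cong) auto
  finally show ?thesis by simp
qed

lemma dimer_Z_good:
  assumes K: "Kasteleyn_orientation GG \<phi>"
  shows "dimer_Z GG a \<phi> = (\<Sum>M\<in>good_dimers. (\<Prod>e\<in>M. \<phi> e) * (\<Prod>f\<in>II \<union> FO. a f ^ card (M \<inter> face_cycle h f)))"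
proof -
  have w: "dimer_weight \<phi> a M = (\<Prod>e\<in>M. \<phi> e) * (\<Prod>f\<in>II \<union> FO. a f ^ card (M \<inter> face_cycle h f))" if "M \<in> DD" for M
  proof -
    have "(\<Prod>e\<in>M. a (cw_right e)) = (\<Prod>f\<in>II \<union> FO. \<Prod>e\<in>{e \<in> M. cw_right e = f}. a (cw_right e))"
    proof (rule prod.group[symmetric])
      show "cw_right ` M \<subseteq> II \<union> FO" using dimer_sub[OF that] right_sub_edge by blast
    qed (use finite_dimer[OF that] finite_internal finite_FO in auto)
    also have "\<dots> = (\<Prod>f\<in>II \<union> FO. a f ^ card (M \<inter> face_cycle h f))"
    proof (intro prod.cong refl)
      fix f
      have "{e \<in> M. cw_right e = f} = M \<inter> face_cycle h f"
        using dimer_sub[OF that] by (auto simp: face_cycle_eq cw_sub_edges_iff)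
      then show "(\<Prod>e\<in>{e \<in> M. cw_right e = f}. a (cw_right e)) = a f ^ card (M \<inter> face_cycle h f)"
        by (metis (mono_tags, lifting) mem_Collect_eq prod.cong prod_constant)
    qed
    finally show ?thesis by (simp add: dimer_weight_def prod.distrib)
  qed
  have "dimer_Z GG a \<phi> = (\<Sum>M\<in>DD. dimer_weight \<phi> a M)"
    by (simp add: dimer_Z_def dimer_weight_def cw_graph_def)
  also have "\<dots> = (\<Sum>M\<in>DD - good_dimers. dimer_weight \<phi> a M) + (\<Sum>M\<in>good_dimers. dimer_weight \<phi> a M)"
    by (rule sum.subset_diff) (auto simp: good_dimers_def finite_DD)
  also have "\<dots> = (\<Sum>M\<in>good_dimers. dimer_weight \<phi> a M)" using sum_bad_dimers[OF K] by simp
  also have "\<dots> = (\<Sum>M\<in>good_dimers. (\<Prod>e\<in>M. \<phi> e) * (\<Prod>f\<in>II \<union> FO. a f ^ card (M \<inter> face_cycle h f)))"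
    by (intro sum.cong w) (auto simp: good_dimers_def)
  finally show ?thesis .
qed

text \<open>Homogeneous of degree \<open>expo f\<close> in each pair \<open>(u f, v f)\<close>; the
  truncated subtraction is exact on \<open>good_dimers\<close>. The denominator is this polynomial,
  and the numerator is the same one with \<open>u\<close> and \<open>v\<close> exchanged, up to a
  power of the imaginary unit.\<close>

definition hom_poly :: "(cw_vertex \<times> cw_vertex \<Rightarrow> complex) \<Rightarrow> (face \<Rightarrow> complex) \<Rightarrow> (face \<Rightarrow> complex) \<Rightarrow> complex" where
  "hom_poly \<phi> u v = (\<Sum>M\<in>good_dimers. (\<Prod>e\<in>M. \<phi> e) *
     (\<Prod>f\<in>II \<union> FO. u f ^ card (M \<inter> face_cycle h f) * v f ^ (expo f - card (M \<inter> face_cycle h f))))"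

lemma hom_poly:
  assumes K: "Kasteleyn_orientation GG \<phi>" and v: "\<And>f. v f \<noteq> 0"
  shows "ratio_prefactor GG v * dimer_Z GG (\<lambda>f. u f / v f) \<phi> = hom_poly \<phi> u v"
  unfolding prefactor dimer_Z_good[OF K] hom_poly_def sum_distrib_left
proof (intro sum.cong refl)
  fix M assume M: "M \<in> good_dimers"
  have eq: "(\<Prod>f\<in>II \<union> FO. v f ^ expo f) * (\<Prod>f\<in>II \<union> FO. (u f / v f) ^ card (M \<inter> face_cycle h f)) =
      (\<Prod>f\<in>II \<union> FO. u f ^ card (M \<inter> face_cycle h f) * v f ^ (expo f - card (M \<inter> face_cycle h f)))"
    unfolding prod.distrib[symmetric]
  proof (intro prod.cong refl)
    fix f
    have "card (M \<inter> face_cycle h f) \<le> expo f" using M unfolding good_dimers_def by blast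
    then show "v f ^ expo f * (u f / v f) ^ card (M \<inter> face_cycle h f) =
        u f ^ card (M \<inter> face_cycle h f) * v f ^ (expo f - card (M \<inter> face_cycle h f))"
      using v[of f] by (simp add: power_divide power_diff)
  qed
  show "(\<Prod>f\<in>II \<union> FO. v f ^ expo f) * (prod \<phi> M * (\<Prod>f\<in>II \<union> FO. (u f / v f) ^ card (M \<inter> face_cycle h f))) =
      prod \<phi> M * (\<Prod>f\<in>II \<union> FO. u f ^ card (M \<inter> face_cycle h f) * v f ^ (expo f - card (M \<inter> face_cycle h f)))"
    unfolding eq[symmetric] by (rule mult.left_commute)
qed

lemma ratio_fraction_hom_poly:
  assumes "Kasteleyn_orientation GG \<phi>" "\<And>f. fst (w f) \<noteq> 0 \<and> snd (w f) \<noteq> 0"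
  shows "ratio_fraction GG \<phi> w = (\<i> ^ card (vertices GG) * hom_poly \<phi> (\<lambda>f. snd (w f)) (\<lambda>f. fst (w f)),
     hom_poly \<phi> (\<lambda>f. fst (w f)) (\<lambda>f. snd (w f)))"
  unfolding ratio_fraction_def
  using hom_poly[OF assms(1), of "\<lambda>f. fst (w f)" "\<lambda>f. snd (w f)"] hom_poly[OF assms(1), of "\<lambda>f. snd (w f)" "\<lambda>f. fst (w f)"] assms(2)
  by (simp add: mult.assoc)

lemma tendsto_hom_poly:
  assumes "\<And>f. ((\<lambda>t. u t f) \<longlongrightarrow> u0 f) F" "\<And>f. ((\<lambda>t. v t f) \<longlongrightarrow> v0 f) F"
  shows "((\<lambda>t. hom_poly \<phi> (u t) (v t)) \<longlongrightarrow> hom_poly \<phi> u0 v0) F"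
  proof -
  have A: "((\<lambda>t. u t f ^ m * v t f ^ n) \<longlongrightarrow> u0 f ^ m * v0 f ^ n) F" for f m n
    by (rule tendsto_mult[OF tendsto_power[OF assms(1)] tendsto_power[OF assms(2)]])
  show ?thesis
    unfolding hom_poly_def
    by (rule tendsto_sum) (rule tendsto_mult[OF tendsto_const tendsto_prod[OF A]])
qed

end

section \<open>Flat sign functions are gauge transformations\<close>

context cone
begin

lemma face_cycle_potential:
  fixes \<epsilon> :: "cw_vertex \<times> cw_vertex \<Rightarrow> complex"
  assumes sgn: "\<And>e. e \<in> face_cycle h f \<Longrightarrow> \<epsilon> e \<in> {1, -1}" and flat: "(\<Prod>e\<in>face_cycle h f. \<epsilon> e) = 1"
  obtains g where "\<And>u. g u \<in> {1, -1 :: complex}" "\<And>e. e \<in> face_cycle h f \<Longrightarrow> \<epsilon> e = g (fst e) * g (snd e)"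
proof -
  define P where "P \<delta> = corner_vertex h f \<delta>" for \<delta>
  define N where "N \<delta> = corner_vertex h (f + \<delta>) (- \<delta>)" for \<delta>
  define a where "a \<delta> = \<epsilon> (P \<delta>, N \<delta>)" for \<delta>
  define wr where "wr \<delta> \<longleftrightarrow> h (f + rot \<delta>) \<noteq> h (f + \<delta>)" for \<delta>
  define b where "b \<delta> = (if wr \<delta> then \<epsilon> (N (rot \<delta>), P \<delta>) else 1)" for \<delta>
  define D0 D1 D2 D3 :: face where "D0 = (1, 0)" and "D1 = (0, 1)" and "D2 = (-1, 0)" and "D3 = (0, -1)"
  have dirs: "dirs = {D0, D1, D2, D3}" by (simp add: dirs_def D0_def D1_def D2_def D3_def)
  have dist: "D0 \<noteq> D1" "D0 \<noteq> D2" "D0 \<noteq> D3" "D1 \<noteq> D2" "D1 \<noteq> D3" "D2 \<noteq> D3"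
    by (simp_all add: D0_def D1_def D2_def D3_def)
  have r: "rot D0 = D1" "rot D1 = D2" "rot D2 = D3" "rot D3 = D0"
    by (simp_all add: D0_def D1_def D2_def D3_def)
  have nb: "(P \<delta>, N \<delta>) \<in> face_cycle h f" if "\<delta> \<in> dirs" for \<delta>
    using face_cycle_neighbour[OF that] by (simp add: P_def N_def)
  have wb: "(N (rot \<delta>), P \<delta>) \<in> face_cycle h f" if "\<delta> \<in> dirs" "wr \<delta>" for \<delta>
    using face_cycle_wrench[OF that(1)] that(2) by (simp add: P_def N_def wr_def)
  have as: "a \<delta> \<in> {1, -1}" if "\<delta> \<in> dirs" for \<delta> using sgn[OF nb[OF that]] by (simp add: a_def)
  have bs: "b \<delta> \<in> {1, -1}" if "\<delta> \<in> dirs" for \<delta> using sgn[OF wb[OF that]] by (simp add: b_def)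
  have "(\<Prod>\<delta>\<in>dirs. a \<delta>) * (\<Prod>\<delta>\<in>{\<delta>\<in>dirs. wr \<delta>}. \<epsilon> (N (rot \<delta>), P \<delta>)) = 1"
    using flat unfolding face_cycle_images wr_def
    by (subst (asm) prod.union_disjoint[OF _ _ face_cycle_disjoint])
      (simp_all add: prod.reindex[OF inj_corner2(1)] prod.reindex[OF inj_corner2(2)] a_def P_def N_def)
  also have "(\<Prod>\<delta>\<in>{\<delta>\<in>dirs. wr \<delta>}. \<epsilon> (N (rot \<delta>), P \<delta>)) = (\<Prod>\<delta>\<in>dirs. b \<delta>)"
    by (simp add: b_def prod.inter_filter)
  finally have prod: "a D0 * a D1 * a D2 * a D3 * (b D0 * b D1 * b D2 * b D3) = 1"
    using dist by (simp add: dirs mult.assoc)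
  \<comment> \<open>The potential is accumulated counterclockwise along the boundary, starting with
    the value 1 at \<open>P D0\<close>. Here \<open>n\<close> is the value at \<open>N\<close> and
    \<open>q\<close> the value at \<open>P\<close>; flatness is used once, to close the
    loop.\<close>
  define n where "n \<delta> = (if \<delta> = D1 then b D0 else if \<delta> = D2 then b D0 * a D1 * b D1
    else if \<delta> = D3 then b D0 * a D1 * b D1 * a D2 * b D2 else b D0 * a D1 * b D1 * a D2 * b D2 * a D3 * b D3)" for \<delta>
  define q where "q \<delta> = n \<delta> * a \<delta>" for \<delta>
  have sq: "a \<delta> * a \<delta> = 1" "b \<delta> * b \<delta> = 1" if "\<delta> \<in> dirs" for \<delta> using as[OF that] bs[OF that] by auto
  have sq': "a \<delta> * (a \<delta> * z) = z" "b \<delta> * (b \<delta> * z) = z" if "\<delta> \<in> dirs" for \<delta> z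
    using sq[OF that] by (simp_all add: mult.assoc[symmetric])
  have D: "D0 \<in> dirs" "D1 \<in> dirs" "D2 \<in> dirs" "D3 \<in> dirs" by (simp_all add: dirs)
  have n_q: "n (rot \<delta>) = q \<delta> * b \<delta>" if "\<delta> \<in> dirs" for \<delta>
    using that unfolding dirs
  proof (elim insertE emptyE)
    assume "\<delta> = D0"
    moreover have "b D0 = b D0 * a D1 * b D1 * a D2 * b D2 * a D3 * b D3 * a D0 * b D0"
      using prod by (simp add: ac_simps)
    ultimately show ?thesis using dist by (simp add: r q_def n_def)
  qed (use dist in \<open>simp_all add: r q_def n_def sq' D\<close>)
  have nsgn: "n \<delta> \<in> {1, -1}" for \<delta>
  proof -
    have mul: "y * z \<in> {1, -1 :: complex}" if "y \<in> {1, -1}" "z \<in> {1, -1}" for y z using that by auto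
    have "b D0 \<in> {1, -1}" "b D0 * a D1 * b D1 \<in> {1, -1}" "b D0 * a D1 * b D1 * a D2 * b D2 \<in> {1, -1}"
      "b D0 * a D1 * b D1 * a D2 * b D2 * a D3 * b D3 \<in> {1, -1}"
      by (intro mul as bs D)+
    then show ?thesis unfolding n_def by presburger
  qed
  have qsgn: "q \<delta> \<in> {1, -1}" if "\<delta> \<in> dirs" for \<delta> using as[OF that] nsgn[of \<delta>] unfolding q_def by auto
  have injP: "inj_on P dirs" using inj_corner[of f] unfolding P_def by (simp add: inj_on_def)
  have injN: "\<delta> = \<eta>" if "\<delta> \<in> dirs" "\<eta> \<in> dirs" "N \<delta> = N \<eta>" for \<delta> \<eta>
  proof -
    have "- rot \<delta> = - rot \<eta>"
      using corner_unique[of "- rot \<delta>" "- rot \<eta>" "N \<delta>" f] that by (simp add: N_def)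
    then show ?thesis by (metis minus_minus rot_rot neg_equal_iff_equal)
  qed
  have PN: "\<eta> = rot \<delta> \<and> \<not> wr \<delta>" if "\<delta> \<in> dirs" "\<eta> \<in> dirs" "P \<delta> = N \<eta>" for \<delta> \<eta>
  proof -
    have "\<delta> = - rot \<eta>"
      using corner_unique[of "\<delta>" "- rot \<eta>" "P \<delta>" f] that by (simp add: N_def P_def)
    then have "\<eta> = rot \<delta>" by simp
    moreover have "\<not> wr \<delta>"
      using wrench_iff[OF that(1), of f] that(3) calculation by (simp add: wr_def P_def N_def)
    ultimately show ?thesis by simp
  qed
  \<comment> \<open>Without a wrench in the square of \<delta>, the vertices
    \<open>P \<delta>\<close> and \<open>N (rot \<delta>)\<close> coincide. There
    \<open>b \<delta> = 1\<close>, so \<open>n_q\<close> says that the two prescribed values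
    agree.\<close>
  define g where "g u = (if u \<in> P ` dirs then q (inv_into dirs P u)
    else if u \<in> N ` dirs then n (SOME \<eta>. \<eta> \<in> dirs \<and> u = N \<eta>) else 1)" for u
  have gP: "g (P \<delta>) = q \<delta>" if "\<delta> \<in> dirs" for \<delta>
    using that injP by (simp add: g_def)
  have gN: "g (N \<eta>) = n \<eta>" if "\<eta> \<in> dirs" for \<eta>
  proof (cases "N \<eta> \<in> P ` dirs")
    case True
    then obtain \<delta> where d: "\<delta> \<in> dirs" "N \<eta> = P \<delta>" by blast
    then have "\<eta> = rot \<delta> \<and> \<not> wr \<delta>" using PN[OF d(1) that] by simp
    then show ?thesis using n_q[OF d(1)] gP[OF d(1)] d by (simp add: b_def)
  next
    case False
    have "(SOME \<eta>'. \<eta>' \<in> dirs \<and> N \<eta> = N \<eta>') = \<eta>"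
      by (rule some_equality) (use that injN in auto)
    then show ?thesis using False that by (simp add: g_def)
  qed
  have gsgn: "g u \<in> {1, -1}" for u
    using qsgn[of "inv_into dirs P u"] nsgn inv_into_into[of u P dirs] unfolding g_def by (simp split: if_splits)
  moreover have "\<epsilon> e = g (fst e) * g (snd e)" if e: "e \<in> face_cycle h f" for e
  proof -
    consider \<delta> where "\<delta> \<in> dirs" "e = (P \<delta>, N \<delta>)" | \<delta> where "\<delta> \<in> dirs" "wr \<delta>" "e = (N (rot \<delta>), P \<delta>)"
      using e unfolding face_cycle_def P_def N_def wr_def by blast
    then show ?thesis
    proof cases
      case (1 \<delta>)
      have "g (P \<delta>) * g (N \<delta>) = a \<delta>"
        unfolding gP[OF 1(1)] gN[OF 1(1)] q_def using nsgn[of \<delta>] by auto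
      then show ?thesis using 1 by (simp add: a_def)
    next
      case (2 \<delta>)
      have "g (N (rot \<delta>)) * g (P \<delta>) = b \<delta>"
        using gP[OF 2(1)] gN[of "rot \<delta>"] 2(1) n_q[OF 2(1)] qsgn[OF 2(1)] by auto
      then show ?thesis using 2 by (simp add: b_def)
    qed
  qed
  ultimately show thesis using that by blast
qed

text \<open>A discrete Poincare lemma. The set \<open>J\<close> is built up face by face, each new
  face being farthest from the apex. Its boundary meets the older faces in vertices connected by
  shared edges, along which the old potential and the one around the new face differ by a constant
  sign; this sign can be absorbed in the latter. Closure of \<open>J\<close> under steps towards the
  apex provides the connectedness.\<close>

lemma flat_trivial_aux:
  fixes \<epsilon> :: "cw_vertex \<times> cw_vertex \<Rightarrow> complex"
  assumes sgn: "\<And>e. e \<in> EE \<Longrightarrow> \<epsilon> e \<in> {1, -1}" and sym: "\<And>e. e \<in> EE \<Longrightarrow> \<epsilon> (prod.swap e) = \<epsilon> e"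
    and flat: "\<And>f. f \<in> II \<Longrightarrow> (\<Prod>e\<in>face_cycle h f. \<epsilon> e) = 1"
  shows "finite J \<Longrightarrow> J \<subseteq> II \<Longrightarrow> (\<And>g \<delta>. g \<in> J \<Longrightarrow> \<delta> \<in> dirs \<Longrightarrow> dist1 (g + \<delta>) = dist1 g - 1 \<Longrightarrow> g + \<delta> \<in> J) \<Longrightarrow>
    \<exists>\<gamma>. (\<forall>u. \<gamma> u \<in> {1, -1 :: complex}) \<and> (\<forall>g\<in>J. \<forall>e\<in>face_cycle h g. \<epsilon> e = \<gamma> (fst e) * \<gamma> (snd e))"
proof (induction "card J" arbitrary: J)
  case 0
  then have "J = {}" by simp
  then show ?case by (intro exI[of _ "\<lambda>_. 1"]) simp
next
  case (Suc n)
  then have "J \<noteq> {}" by auto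
  \<comment> \<open>A farthest face can be removed without destroying closure, as no other face of
    \<open>J\<close> needs it on its way to the apex.\<close>
  then obtain f where f: "f \<in> J" "\<And>g. g \<in> J \<Longrightarrow> dist1 g \<le> dist1 f"
  proof -
    have fin: "finite (dist1 ` J)" using Suc.prems(1) by simp
    obtain f where "f \<in> J" "dist1 f = Max (dist1 ` J)"
      using Max_in[OF fin] \<open>J \<noteq> {}\<close> by fastforce
    then show thesis using that[of f] Max_ge[OF fin] by simp
  qed
  define J0 where "J0 = J - {f}"
  have "\<exists>\<gamma>. (\<forall>u. \<gamma> u \<in> {1, -1 :: complex}) \<and> (\<forall>g\<in>J0. \<forall>e\<in>face_cycle h g. \<epsilon> e = \<gamma> (fst e) * \<gamma> (snd e))"
  proof (rule Suc.hyps(1))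
    show "n = card J0" using Suc.hyps(2) f(1) Suc.prems(1) by (simp add: J0_def)
    show "finite J0" "J0 \<subseteq> II" using Suc.prems(1,2) by (auto simp: J0_def)
    fix g \<delta> assume g: "g \<in> J0" "\<delta> \<in> dirs" "dist1 (g + \<delta>) = dist1 g - 1"
    then have "g + \<delta> \<in> J" using Suc.prems(3)[of g \<delta>] by (auto simp: J0_def)
    moreover have "g + \<delta> \<noteq> f" using f(2)[of g] g by (auto simp: J0_def)
    ultimately show "g + \<delta> \<in> J0" by (simp add: J0_def)
  qed
  then obtain \<gamma>0 where g0: "\<And>u. \<gamma>0 u \<in> {1, -1 :: complex}"
    "\<And>g e. g \<in> J0 \<Longrightarrow> e \<in> face_cycle h g \<Longrightarrow> \<epsilon> e = \<gamma>0 (fst e) * \<gamma>0 (snd e)" by blast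
  have fI: "f \<in> II" using f(1) Suc.prems(2) by blast
  obtain \<gamma>1 where g1: "\<And>u. \<gamma>1 u \<in> {1, -1 :: complex}"
    "\<And>e. e \<in> face_cycle h f \<Longrightarrow> \<epsilon> e = \<gamma>1 (fst e) * \<gamma>1 (snd e)"
    using face_cycle_potential[OF _ flat[OF fI]] sgn face_cycle_sub_edges[OF fI] by (metis subsetD)
  \<comment> \<open>Compares the potential of the older faces with the one around \<open>f\<close>.
    On an edge shared with an older face both represent \<epsilon>, so \<sigma> agrees at its
    ends.\<close>
  define \<sigma> where "\<sigma> u = \<gamma>0 u * \<gamma>1 u" for u
  have old: "\<sigma> (fst e) = \<sigma> (snd e)" if e: "e \<in> face_cycle h f" "cw_right (prod.swap e) \<in> J0" for e
  proof -
    have E: "e \<in> EE" using face_cycle_sub_edges[OF fI] e(1) by blast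
    have "prod.swap e \<in> face_cycle h (cw_right (prod.swap e))"
      using cw_edge_face_cycle cw_edges_swap face_cycle_edge(1)[OF e(1)] by blast
    then have "\<epsilon> (prod.swap e) = \<gamma>0 (fst e) * \<gamma>0 (snd e)" using g0(2)[OF e(2)] by (simp add: mult.commute)
    then have "\<gamma>0 (fst e) * \<gamma>0 (snd e) = \<gamma>1 (fst e) * \<gamma>1 (snd e)" using sym[OF E] g1(2)[OF e(1)] by simp
    then show ?thesis
      unfolding \<sigma>_def using g0(1)[of "fst e"] g0(1)[of "snd e"] g1(1)[of "fst e"] g1(1)[of "snd e"] by auto
  qed
  have oldN: "\<sigma> (corner_vertex h f \<delta>) = \<sigma> (corner_vertex h (f + \<delta>) (- \<delta>))" if "\<delta> \<in> dirs" "f + \<delta> \<in> J0" for \<delta>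
    using old[OF face_cycle_neighbour[OF that(1)]] that cw_right_neighbours[of "- \<delta>" "f + \<delta>"] by simp
  have oldW: "\<sigma> (corner_vertex h (f + rot \<delta>) (- rot \<delta>)) = \<sigma> (corner_vertex h f \<delta>)"
    if "\<delta> \<in> dirs" "f + \<delta> + rot \<delta> \<in> J0" for \<delta>
    using old[OF face_cycle_wrench[OF that(1)]] that wrench_iff[OF that(1), of f] cw_right_wrench(2)[OF that(1), of f]
    by (cases "h (f + rot \<delta>) = h (f + \<delta>)") simp_all
  have toward: "f + \<delta> \<in> J0" if "\<delta> \<in> dirs" "dist1 (f + \<delta>) = dist1 f - 1" for \<delta>
    using Suc.prems(3)[OF f(1) that] square_distinct(1)[OF that(1)] by (simp add: J0_def)
  have near: "dist1 g \<le> dist1 f" if "g \<in> J0" for g using f(2) that by (simp add: J0_def)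
  have twd: "\<sigma> (corner_vertex h f (rot \<delta>)) = \<sigma> (corner_vertex h f \<delta>)"
    if d: "\<delta> \<in> dirs" "dist1 (f + \<delta>) = dist1 f - 1" "dist1 (f + rot \<delta>) = dist1 f - 1" for \<delta>
  proof -
    have "dist1 (f + \<delta> + rot \<delta>) = dist1 (f + \<delta>) - 1" using dist1_square[OF d(1), of f] d by simp
    then have "f + \<delta> + rot \<delta> \<in> J"
      using Suc.prems(3)[of "f + \<delta>" "rot \<delta>"] toward[OF d(1,2)] d(1) by (simp add: J0_def)
    then have "f + \<delta> + rot \<delta> \<in> J0" using square_distinct(4)[OF d(1)] by (simp add: J0_def add.assoc)
    then show ?thesis using oldW[OF d(1)] oldN[of "rot \<delta>"] toward[of "rot \<delta>"] d by simp
  qed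
  have tw_eq: "\<sigma> (corner_vertex h f \<delta>) = \<sigma> (corner_vertex h f \<eta>)"
    if d: "\<delta> \<in> dirs" "dist1 (f + \<delta>) = dist1 f - 1" "\<eta> \<in> dirs" "dist1 (f + \<eta>) = dist1 f - 1" for \<delta> \<eta>
  proof -
    have "\<eta> \<noteq> - \<delta>" using dist1_opposite[OF d(1,2)] d(4) by auto
    then consider "\<eta> = \<delta>" | "\<eta> = rot \<delta>" | "\<delta> = rot \<eta>" using dirs_four[OF d(1,3)] by fastforce
    then show ?thesis using twd d by cases auto
  qed
  \<comment> \<open>Each shared vertex is linked by shared edges to the edge towards a neighbour
    nearer to the apex; by \<open>tw_eq\<close> it does not matter which.\<close>
  have conn: "\<exists>\<delta>\<in>dirs. dist1 (f + \<delta>) = dist1 f - 1 \<and> \<sigma> u = \<sigma> (corner_vertex h f \<delta>)"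
    if u: "u \<in> star f" "u \<inter> J0 \<noteq> {}" for u
  proof -
    obtain g where g: "g \<in> u" "g \<in> J0" using u(2) by blast
    obtain \<delta> where d: "\<delta> \<in> dirs" "u \<in> {corner_vertex h f \<delta>, corner_vertex h (f + rot \<delta>) (- rot \<delta>)}"
      using cw_vertex_cases[of u f] u(1) by auto
    have nbr: ?thesis if "\<eta> \<in> dirs" "g = f + \<eta>" for \<eta>
    proof -
      have "dist1 (f + \<eta>) = dist1 f - 1" using dist1_step[OF that(1), of f] near[OF g(2)] that(2) by auto
      moreover have "u = corner_vertex h f \<eta> \<or> u = corner_vertex h (f + \<eta>) (- \<eta>)"
        using vertex_of_neighbours[of u f \<eta>] u(1) g(1) that by auto
      ultimately show ?thesis using oldN[OF that(1)] g(2) that by auto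
    qed
    have "g \<in> {f, f + \<delta>, f + rot \<delta>, f + \<delta> + rot \<delta>}"
      using corner_vertex_square[OF d(1), of f] d(2) g(1) square_base(1)[OF d(1), of f] by auto
    then consider "g = f + \<delta>" | "g = f + rot \<delta>" | "g = f + \<delta> + rot \<delta>" using g(2) by (auto simp: J0_def)
    then show ?thesis
    proof cases
      case 3
      have eq: "\<sigma> (corner_vertex h (f + rot \<delta>) (- rot \<delta>)) = \<sigma> (corner_vertex h f \<delta>)"
        using oldW[OF d(1)] g(2) 3 by simp
      have "dist1 (f + \<delta>) = dist1 f - 1 \<or> dist1 (f + rot \<delta>) = dist1 f - 1"
        using dist1_square[OF d(1), of f] near[OF g(2)] 3 dist1_step[OF d(1), of f] dist1_step[of "rot \<delta>" f] d(1) by auto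
      then show ?thesis
      proof
        assume "dist1 (f + \<delta>) = dist1 f - 1"
        then show ?thesis using d eq by auto
      next
        assume t: "dist1 (f + rot \<delta>) = dist1 f - 1"
        then have "\<sigma> (corner_vertex h f (rot \<delta>)) = \<sigma> (corner_vertex h (f + rot \<delta>) (- rot \<delta>))"
          using oldN[of "rot \<delta>"] toward[of "rot \<delta>"] d(1) by simp
        then show ?thesis using d eq t by (intro bexI[of _ "rot \<delta>"]) auto
      qed
    qed (use nbr[of \<delta>] nbr[of "rot \<delta>"] d(1) in auto)
  qed
  obtain s where s: "s \<in> {1, -1 :: complex}" "\<And>u. u \<in> star f \<Longrightarrow> u \<inter> J0 \<noteq> {} \<Longrightarrow> \<sigma> u = s"
  proof (cases "\<exists>\<delta>\<in>dirs. dist1 (f + \<delta>) = dist1 f - 1")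
    case True
    then obtain \<delta> where d: "\<delta> \<in> dirs" "dist1 (f + \<delta>) = dist1 f - 1" by blast
    show thesis
    proof (rule that[of "\<sigma> (corner_vertex h f \<delta>)"])
      show "\<sigma> (corner_vertex h f \<delta>) \<in> {1, -1}"
        using g0(1)[of "corner_vertex h f \<delta>"] g1(1)[of "corner_vertex h f \<delta>"] unfolding \<sigma>_def by auto
      fix u assume "u \<in> star f" "u \<inter> J0 \<noteq> {}"
      then show "\<sigma> u = \<sigma> (corner_vertex h f \<delta>)" using conn[of u] tw_eq[OF _ _ d] by metis
    qed
  next
    case False
    \<comment> \<open>No neighbour is nearer to the apex, so no vertex of \<open>f\<close> is shared
      and any sign will do.\<close>
    then show thesis using that[of 1] conn by blast
  qed
  define \<gamma> where "\<gamma> u = (if f \<in> u \<and> u \<inter> J0 = {} then s * \<gamma>1 u else \<gamma>0 u)" for u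
  have gf: "\<gamma> u = s * \<gamma>1 u" if "u \<in> star f" for u
  proof (cases "u \<inter> J0 = {}")
    case False
    have "\<gamma>0 u * \<gamma>1 u = s" using s(2)[OF that False] by (simp add: \<sigma>_def)
    then have "\<gamma>0 u = s * \<gamma>1 u" using g1(1)[of u] by auto
    then show ?thesis using False by (simp add: \<gamma>_def)
  qed (use that in \<open>simp add: \<gamma>_def\<close>)
  show ?case
  proof (intro exI conjI allI ballI)
    show "\<gamma> u \<in> {1, -1}" for u using g0(1)[of u] g1(1)[of u] s(1) unfolding \<gamma>_def by auto
    fix g e assume g: "g \<in> J" and e: "e \<in> face_cycle h g"
    show "\<epsilon> e = \<gamma> (fst e) * \<gamma> (snd e)"
    proof (cases "g = f")
      case True
      then have "\<epsilon> e = \<gamma>1 (fst e) * \<gamma>1 (snd e)" using g1(2) e by simp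
      moreover have "\<gamma> (fst e) = s * \<gamma>1 (fst e)" "\<gamma> (snd e) = s * \<gamma>1 (snd e)"
        using gf face_cycle_ends e True by blast+
      ultimately show ?thesis using s(1) by auto
    next
      case False
      then have gJ: "g \<in> J0" using g by (simp add: J0_def)
      have "g \<in> fst e" "g \<in> snd e" using face_cycle_ends[OF e] by auto
      then have "\<gamma> (fst e) = \<gamma>0 (fst e)" "\<gamma> (snd e) = \<gamma>0 (snd e)" using gJ by (auto simp: \<gamma>_def)
      then show ?thesis using g0(2)[OF gJ e] by simp
    qed
  qed
qed

lemma flat_trivial:
  fixes \<epsilon> :: "cw_vertex \<times> cw_vertex \<Rightarrow> complex"
  assumes sgn: "\<And>e. e \<in> EE \<Longrightarrow> \<epsilon> e \<in> {1, -1}" and sym: "\<And>e. e \<in> EE \<Longrightarrow> \<epsilon> (prod.swap e) = \<epsilon> e"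
    and flat: "\<And>f. f \<in> II \<Longrightarrow> (\<Prod>e\<in>face_cycle h f. \<epsilon> e) = 1"
  obtains \<gamma> where "\<And>u. \<gamma> u \<in> {1, -1 :: complex}" "\<And>e. e \<in> EE \<Longrightarrow> \<epsilon> e = \<gamma> (fst e) * \<gamma> (snd e)"
proof -
  \<comment> \<open>One step towards the apex lowers the distance by one and raises the height by at
    most one.\<close>
  have cl: "g + \<delta> \<in> II" if "g \<in> II" "\<delta> \<in> dirs" "dist1 (g + \<delta>) = dist1 g - 1" for g \<delta>
    using that step_cases[OF that(2), of g] unfolding internal_iff by auto
  obtain \<gamma> where g: "\<And>u. \<gamma> u \<in> {1, -1 :: complex}"
    "\<And>g e. g \<in> II \<Longrightarrow> e \<in> face_cycle h g \<Longrightarrow> \<epsilon> e = \<gamma> (fst e) * \<gamma> (snd e)"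
    using flat_trivial_aux[of \<epsilon> II] assms finite_internal cl by blast
  have "\<epsilon> e = \<gamma> (fst e) * \<gamma> (snd e)" if e: "e \<in> EE" for e
  proof (cases "cw_right e \<in> II")
    case True
    then show ?thesis using g(2)[OF True] cw_edge_face_cycle[of e] e by (simp add: cw_sub_edges_iff)
  next
    case False
    then have r: "cw_right (prod.swap e) \<in> II" using e by (auto simp: cw_sub_edges_def)
    have "prod.swap e \<in> face_cycle h (cw_right (prod.swap e))"
      using e cw_edge_face_cycle cw_edges_swap by (simp add: cw_sub_edges_iff)
    then show ?thesis using g(2)[OF r] sym[OF e] by (simp add: mult.commute)
  qed
  then show thesis using that g(1) by blast
qed

end

section \<open>The partition function as a hafnian\<close>

text \<open>An oriented matching is a perfect matching together with a choice of direction for each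
  of its edges. By distributivity the choices can be made inside the product. A pair that is no edge
  gets the empty sum, so the hafnian may run over all pairs.\<close>

lemma sum_oriented_matchings:
  fixes w :: "'v \<times> 'v \<Rightarrow> 'a :: comm_semiring_1"
  assumes fin: "finite V" and E: "E \<subseteq> V \<times> V" and loop: "\<And>e. e \<in> E \<Longrightarrow> fst e \<noteq> snd e"
  shows "(\<Sum>N | N \<subseteq> E \<and> (\<forall>v\<in>V. \<exists>!e. e \<in> N \<and> (fst e = v \<or> snd e = v)). \<Prod>e\<in>N. w e) =
    hafnian V (\<lambda>s. \<Sum>e | e \<in> E \<and> {fst e, snd e} = s. w e)"
proof -
  define und where "und e = {fst e, snd e}" for e :: "'v \<times> 'v"
  define D where "D = {N. N \<subseteq> E \<and> (\<forall>v\<in>V. \<exists>!e. e \<in> N \<and> (fst e = v \<or> snd e = v))}"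
  define ori where "ori s = {e. e \<in> E \<and> und e = s}" for s
  have finE: "finite E" using fin E finite_subset by blast
  have fin_ori: "finite (ori s)" for s by (rule finite_subset[OF _ finE]) (auto simp: ori_def)
  have uniq: "e = e'" if "N \<in> D" "e \<in> N" "e' \<in> N" "v \<in> und e" "v \<in> und e'" for N e e' v
  proof -
    have "v \<in> V" using that(1,2,4) E by (auto simp: D_def und_def)
    then have "\<exists>!e. e \<in> N \<and> (fst e = v \<or> snd e = v)" using that(1) by (simp add: D_def)
    then obtain d where "\<And>e. e \<in> N \<Longrightarrow> fst e = v \<or> snd e = v \<Longrightarrow> e = d" by (elim ex1E) blast
    moreover have "fst e = v \<or> snd e = v" "fst e' = v \<or> snd e' = v"
      using that(4,5) by (auto simp: und_def)
    ultimately have "e = d" "e' = d" using that(2,3) by blast+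
    then show ?thesis by simp
  qed
  have inj: "inj_on und N" if "N \<in> D" for N
  proof (rule inj_onI)
    fix e e' assume e: "e \<in> N" "e' \<in> N" "und e = und e'"
    have "fst e \<in> und e" by (simp add: und_def)
    then show "e = e'" using uniq[OF that e(1,2), of "fst e"] e(3) by simp
  qed
  have pm: "und ` N \<in> perfect_matchings V" if N: "N \<in> D" for N
  proof -
    have "\<Union>(und ` N) = V"
    proof
      show "\<Union>(und ` N) \<subseteq> V" using N E by (auto simp: D_def und_def)
      show "V \<subseteq> \<Union>(und ` N)"
      proof
        fix v assume "v \<in> V"
        then have "\<exists>!e. e \<in> N \<and> (fst e = v \<or> snd e = v)" using N by (simp add: D_def)
        then show "v \<in> \<Union>(und ` N)" by (auto simp: und_def)
      qed
    qed
    moreover have "disjoint (und ` N)"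
    proof (rule disjointI)
      fix s t assume "s \<in> und ` N" "t \<in> und ` N" "s \<noteq> t"
      then show "s \<inter> t = {}" using uniq[OF N] by blast
    qed
    moreover have "card s = 2" if s: "s \<in> und ` N" for s
    proof -
      obtain e where "e \<in> N" "s = und e" using s by blast
      then show ?thesis using loop[of e] N by (auto simp: D_def und_def card_insert_if)
    qed
    moreover have "{} \<notin> und ` N" by (auto simp: und_def)
    ultimately show ?thesis by (simp add: perfect_matchings_def partition_on_def)
  qed
  have "hafnian V (\<lambda>s. \<Sum>e\<in>ori s. w e) = (\<Sum>M\<in>perfect_matchings V. \<Sum>c\<in>PiE M ori. \<Prod>s\<in>M. w (c s))"
    unfolding hafnian_def using finite_perfect_matching[OF fin] fin_ori
    by (intro sum.cong refl prod_sum_PiE) auto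
  also have "\<dots> = (\<Sum>(M, c)\<in>(SIGMA M:perfect_matchings V. PiE M ori). \<Prod>s\<in>M. w (c s))"
    using finite_perfect_matchings[OF fin] finite_perfect_matching[OF fin] fin_ori
    by (intro sum.Sigma) (auto intro: finite_PiE)
  also have "\<dots> = (\<Sum>N\<in>D. \<Prod>e\<in>N. w e)"
  proof (rule sum.reindex_bij_witness[where
        j = "\<lambda>(M, c). c ` M" and i = "\<lambda>N. (und ` N, restrict (inv_into N und) (und ` N))"])
    fix N assume N: "N \<in> D"
    have c: "inv_into N und (und e) = e" if "e \<in> N" for e using inj[OF N] that by simp
    show "(case (und ` N, restrict (inv_into N und) (und ` N)) of (M, c) \<Rightarrow> c ` M) = N"
      using c by (force simp: image_image)
    show "(und ` N, restrict (inv_into N und) (und ` N)) \<in> (SIGMA M:perfect_matchings V. PiE M ori)"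
      using pm[OF N] c N by (auto simp: ori_def D_def)
  next
    fix a assume "a \<in> (SIGMA M:perfect_matchings V. PiE M ori)"
    then obtain M c where a: "a = (M, c)" "M \<in> perfect_matchings V" "c \<in> PiE M ori" by auto
    have cs: "c s \<in> E" "und (c s) = s" if "s \<in> M" for s
      using a(3) that PiE_mem[of c M ori s] by (auto simp: ori_def)
    have injc: "inj_on c M" using cs(2) by (metis inj_onI)
    have D: "c ` M \<in> D"
      unfolding D_def mem_Collect_eq
    proof (intro conjI ballI)
      show "c ` M \<subseteq> E" using cs by blast
      fix v assume "v \<in> V"
      then obtain s where s: "s \<in> M" "v \<in> s" using a(2) by (auto simp: perfect_matchings_def partition_on_def)
      show "\<exists>!e. e \<in> c ` M \<and> (fst e = v \<or> snd e = v)"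
      proof (rule ex1I[of _ "c s"])
        have "v \<in> und (c s)" using s cs(2)[OF s(1)] by simp
        then show "c s \<in> c ` M \<and> (fst (c s) = v \<or> snd (c s) = v)" using s(1) by (auto simp: und_def)
        fix e assume "e \<in> c ` M \<and> (fst e = v \<or> snd e = v)"
        then obtain t where t: "t \<in> M" "e = c t" "v \<in> und (c t)" by (auto simp: und_def)
        then have "t = s" using perfect_matching_unique[OF a(2) t(1) s(1), of v] s cs(2)[OF t(1)] by simp
        then show "e = c s" using t by simp
      qed
    qed
    then show "(case a of (M, c) \<Rightarrow> c ` M) \<in> D" by (simp add: a)
    have u: "und ` c ` M = M" using cs(2) by (force simp: image_image)
    have "restrict (inv_into (c ` M) und) M = c"
    proof
      fix s
      show "restrict (inv_into (c ` M) und) M s = c s"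
      proof (cases "s \<in> M")
        case True
        then have "inv_into (c ` M) und (und (c s)) = c s" using inj[OF D] by simp
        then show ?thesis using True cs(2) by simp
      next
        case False
        then show ?thesis using a(3) by (auto simp: PiE_def extensional_def)
      qed
    qed
    then show "(und ` (case a of (M, c) \<Rightarrow> c ` M), restrict (inv_into (case a of (M, c) \<Rightarrow> c ` M) und) (und ` (case a of (M, c) \<Rightarrow> c ` M))) = a"
      by (simp add: a u)
    show "(\<Prod>e\<in>(case a of (M, c) \<Rightarrow> c ` M). w e) = (case a of (M, c) \<Rightarrow> \<Prod>s\<in>M. w (c s))"
      by (simp add: a prod.reindex[OF injc])
  qed
  finally show ?thesis by (simp add: D_def ori_def und_def)
qed

text \<open>A function of the unordered pair of faces: for a pair, the inner product has a single
  factor, the sign of the direction with \<open>g\<close> on the right.\<close>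

definition pair_weight :: "(face \<Rightarrow> int) \<Rightarrow> (face \<Rightarrow> complex) \<Rightarrow> face set \<Rightarrow> complex" where
  "pair_weight h a s = (\<Sum>g\<in>s. (\<Prod>g'\<in>s - {g}. source_sign h g g') * a g)"

text \<open>To be applied to the common faces \<open>s\<close> of two vertices, with
  \<open>I\<close> the internal faces. It vanishes unless the vertices are joined in the graph, so
  no list of edges has to be carried along.\<close>

definition edge_weight :: "(face \<Rightarrow> int) \<Rightarrow> face set \<Rightarrow> (face \<Rightarrow> complex) \<Rightarrow> face set \<Rightarrow> complex" where
  "edge_weight h I a s = (if card s = 2 \<and> s \<inter> I \<noteq> {} then pair_weight h a s else 0)"

lemma pair_weight_pair:
  "f \<noteq> g \<Longrightarrow> pair_weight h a {f, g} = source_sign h f g * a f + source_sign h g f * a g"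
proof -
  assume "f \<noteq> g"
  then have "{f, g} - {f} = {g}" "{f, g} - {g} = {f}" by auto
  then show ?thesis using \<open>f \<noteq> g\<close> by (simp add: pair_weight_def)
qed

context cone
begin

lemma dimer_Z_hafnian:
  "dimer_Z GG a \<phi> = hafnian VV (\<lambda>s. \<Sum>e | e \<in> EE \<and> {fst e, snd e} = s. \<phi> e * a (cw_right e))"
proof -
  have "dimer_Z GG a \<phi> = (\<Sum>N | N \<subseteq> EE \<and> (\<forall>v\<in>VV. \<exists>!e. e \<in> N \<and> (fst e = v \<or> snd e = v)).
      \<Prod>e\<in>N. \<phi> e * a (cw_right e))"
    by (simp add: dimer_Z_def oriented_dimers_def cw_graph_def)
  also have "\<dots> = hafnian VV (\<lambda>s. \<Sum>e | e \<in> EE \<and> {fst e, snd e} = s. \<phi> e * a (cw_right e))"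
  proof (rule sum_oriented_matchings[OF finite_VV])
    show "EE \<subseteq> VV \<times> VV" using sub_edge_ends by (auto simp: mem_Times_iff)
    show "fst e \<noteq> snd e" if "e \<in> EE" for e using edge_no_loop[of e] that by (simp add: cw_sub_edges_iff)
  qed
  finally show ?thesis .
qed

lemma oriented_pair:
  assumes "u \<noteq> v"
  shows "{e. e \<in> EE \<and> {fst e, snd e} = {u, v}} = (if (u, v) \<in> EE then {(u, v), (v, u)} else {})"
proof (rule set_eqI)
  fix e
  have "{fst e, snd e} = {u, v} \<longleftrightarrow> e = (u, v) \<or> e = (v, u)"
    by (cases e) (simp add: doubleton_eq_iff)
  moreover have "(v, u) \<in> EE \<longleftrightarrow> (u, v) \<in> EE"
    using cw_sub_edges_swap[of "(u, v)" "(px, py, k)"] by simp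
  ultimately show "e \<in> {e. e \<in> EE \<and> {fst e, snd e} = {u, v}} \<longleftrightarrow>
      e \<in> (if (u, v) \<in> EE then {(u, v), (v, u)} else {})"
    by (cases "(u, v) \<in> EE") auto
qed

lemma dimer_Z_canonical:
  "dimer_Z GG a canonical_orientation = hafnian VV (\<lambda>e. edge_weight h II a (\<Inter>e))"
  unfolding dimer_Z_hafnian
proof (rule hafnian_cong)
  fix u v assume uv: "u \<in> VV" "v \<in> VV" "u \<noteq> v"
  show "(\<Sum>e | e \<in> EE \<and> {fst e, snd e} = {u, v}. canonical_orientation e * a (cw_right e)) =
      edge_weight h II a (\<Inter>{u, v})"
  proof (cases "(u, v) \<in> EE")
    case True
    then have e: "(u, v) \<in> cw_edges h" "u \<inter> v \<inter> II \<noteq> {}" by (auto simp: cw_sub_edges_iff)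
    note i = cw_edge_inter[OF e(1), unfolded fst_conv snd_conv swap_simp]
    have "(\<Sum>e | e \<in> EE \<and> {fst e, snd e} = {u, v}. canonical_orientation e * a (cw_right e)) =
        source_sign h (cw_right (u, v)) (cw_right (v, u)) * a (cw_right (u, v)) +
        source_sign h (cw_right (v, u)) (cw_right (u, v)) * a (cw_right (v, u))"
      unfolding oriented_pair[OF uv(3)] using True uv(3) by (simp add: canonical_orientation_def)
    also have "\<dots> = pair_weight h a (u \<inter> v)"
      unfolding i(1) using i(2) by (simp add: pair_weight_pair)
    finally show ?thesis using e by (simp add: edge_weight_def cw_edges_def)
  next
    case False
    then have "\<not> (card (u \<inter> v) = 2 \<and> u \<inter> v \<inter> II \<noteq> {})" using uv by (simp add: cw_sub_edges_iff cw_edges_def)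
    then show ?thesis unfolding oriented_pair[OF uv(3)] using False by (auto simp: edge_weight_def)
  qed
qed

text \<open>Any two Kasteleyn orientations differ by a flat sign, hence by a gauge transformation.\<close>

lemma dimer_Z_Kasteleyn:
  assumes K: "Kasteleyn_orientation GG \<phi>"
  obtains s where "s \<in> {1, -1}" "\<And>a. dimer_Z GG a \<phi> = s * dimer_Z GG a canonical_orientation"
proof -
  define \<epsilon> where "\<epsilon> e = \<phi> e * canonical_orientation e" for e
  have \<phi>: "\<phi> e \<in> {1, -1}" "\<phi> (prod.swap e) = - \<phi> e" if "e \<in> EE" for e
    using K that by (auto simp: Kasteleyn_orientation_def cw_graph_def)
  have c: "canonical_orientation e \<in> {1, -1}" "canonical_orientation (prod.swap e) = - canonical_orientation e"
    if "e \<in> EE" for e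
    using canonical_skew[of e] that by (auto simp: canonical_orientation_def source_sign_def cw_sub_edges_iff)
  have \<epsilon>: "\<epsilon> e \<in> {1, -1}" "\<epsilon> (prod.swap e) = \<epsilon> e" if "e \<in> EE" for e
    using \<phi>[OF that] c[OF that] by (auto simp: \<epsilon>_def)
  have "(\<Prod>e\<in>face_cycle h f. \<epsilon> e) = 1" if "f \<in> II" for f
    using Kasteleyn_prod[OF K that] prod_canonical[of f] by (simp add: \<epsilon>_def prod.distrib)
  with \<epsilon> obtain \<gamma> where g: "\<And>u. \<gamma> u \<in> {1, -1 :: complex}"
    "\<And>e. e \<in> EE \<Longrightarrow> \<epsilon> e = \<gamma> (fst e) * \<gamma> (snd e)"
    using flat_trivial[of \<epsilon>] by metis
  have \<phi>c: "\<phi> e = \<gamma> (fst e) * \<gamma> (snd e) * canonical_orientation e" if "e \<in> EE" for e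
  proof -
    have "\<phi> e = \<epsilon> e * canonical_orientation e" using c(1)[OF that] by (auto simp: \<epsilon>_def)
    then show ?thesis using g(2)[OF that] by simp
  qed
  have "dimer_Z GG a \<phi> = (\<Prod>u\<in>VV. \<gamma> u) * dimer_Z GG a canonical_orientation" for a
    unfolding dimer_Z_hafnian hafnian_gauge[OF finite_VV, symmetric]
  proof (rule hafnian_cong)
    fix u v :: cw_vertex assume uv: "u \<noteq> v"
    show "(\<Sum>e | e \<in> EE \<and> {fst e, snd e} = {u, v}. \<phi> e * a (cw_right e)) =
      (\<Prod>u\<in>{u, v}. \<gamma> u) * (\<Sum>e | e \<in> EE \<and> {fst e, snd e} = {u, v}. canonical_orientation e * a (cw_right e))"
      unfolding sum_distrib_left
    proof (intro sum.cong refl)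
      fix e assume "e \<in> {e. e \<in> EE \<and> {fst e, snd e} = {u, v}}"
      then have e: "e \<in> EE" "{fst e, snd e} = {u, v}" by auto
      have "(\<Prod>u\<in>{u, v}. \<gamma> u) = \<gamma> (fst e) * \<gamma> (snd e)"
        using e(2) uv by (auto simp: doubleton_eq_iff mult.commute)
      then show "\<phi> e * a (cw_right e) = (\<Prod>u\<in>{u, v}. \<gamma> u) * (canonical_orientation e * a (cw_right e))"
        using \<phi>c[OF e(1)] by (simp add: mult.assoc)
    qed
  qed
  moreover have "(\<Prod>u\<in>VV. \<gamma> u) \<in> {1, -1}" by (rule prod_in_signs) (use g in auto)
  ultimately show thesis using that by blast
qed

end

section \<open>The spider move\<close>

lemma hafnian_odd:
  assumes "finite V" "odd (card V)"
  shows "hafnian V c = 0"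
proof -
  have "perfect_matchings V = {}"
  proof (rule ccontr)
    assume "perfect_matchings V \<noteq> {}"
    then obtain M where M: "M \<in> perfect_matchings V" by blast
    then have p: "\<Union>M = V" "disjoint M" "\<forall>e\<in>M. card e = 2"
      by (auto simp: perfect_matchings_def partition_on_def)
    have "card (\<Union>M) = sum card M"
      using p(2,3) by (intro card_Union_disjoint) (auto intro: card_ge_0_finite)
    then have "card V = 2 * card M" using p by simp
    then show False using assms(2) by simp
  qed
  then show ?thesis by (simp add: hafnian_def)
qed

definition square :: "face \<Rightarrow> face \<Rightarrow> face set" where
  "square f \<delta> = {f, f + \<delta>, f + rot \<delta>, f + \<delta> + rot \<delta>}"

definition outer :: "face \<Rightarrow> face \<Rightarrow> face set" where
  "outer f \<delta> = {f + \<delta>, f + rot \<delta>, f + \<delta> + rot \<delta>}"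

lemma square_inter_rot: "\<delta> \<in> dirs \<Longrightarrow> square f \<delta> \<inter> square f (rot \<delta>) = {f, f + rot \<delta>}"
  by (cases f; elim dirs_cases; auto simp: square_def)

lemma square_inter_opposite: "\<delta> \<in> dirs \<Longrightarrow> square f \<delta> \<inter> square f (- \<delta>) = {f}"
  by (cases f; elim dirs_cases; auto simp: square_def)

lemma square_inter:
  assumes "\<delta> \<in> dirs" "\<eta> \<in> dirs" "\<delta> \<noteq> \<eta>"
  obtains g where "square f \<delta> \<inter> square f \<eta> \<subseteq> {f, g}"
proof -
  have "square f \<delta> \<inter> square f (- rot \<delta>) = {f, f + \<delta>}"
    using square_inter_rot[of "- rot \<delta>" f] assms(1) by (simp add: Int_commute)
  then show thesis
    using dirs_four[OF assms(1,2)] assms(3) that square_inter_rot[OF assms(1), of f]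
      square_inter_opposite[OF assms(1), of f] by (metis insert_absorb2 order_refl)
qed

text \<open>The vertices \<open>A \<delta>\<close> around a face \<open>f\<close>: crosses for \<open>\<delta> \<in> T\<close>, ends of a wrench with other end
  \<open>outer f \<delta>\<close> for \<open>\<delta> \<in> B\<close>, vertices without further edges for \<open>\<delta> \<in> C\<close>. A spider move exchanges
  \<open>T\<close> and \<open>B\<close>.\<close>

locale face_star =
  fixes f :: face and A :: "face \<Rightarrow> face set" and K T B C :: "face set" and Base :: "face set set"
    and W :: "face set \<Rightarrow> complex"
  assumes K: "K \<subseteq> dirs" "K = T \<union> B \<union> C" "T \<inter> B = {}" "T \<inter> C = {}" "B \<inter> C = {}"
    and finite_Base: "finite Base"
    and Base: "\<And>v. v \<in> Base \<Longrightarrow> f \<notin> v" "\<And>v \<delta>. v \<in> Base \<Longrightarrow> \<delta> \<in> dirs \<Longrightarrow> \<not> {f + \<delta>, f + rot \<delta>} \<subseteq> v"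
    and A_T: "\<And>\<delta>. \<delta> \<in> T \<Longrightarrow> A \<delta> = square f \<delta>"
    and A_B: "\<And>\<delta>. \<delta> \<in> B \<Longrightarrow> A \<delta> = {f, f + \<delta>, f + rot \<delta>}"
    and A_K: "\<And>\<delta>. \<delta> \<in> K \<Longrightarrow> {f, f + \<delta>, f + rot \<delta>} \<subseteq> A \<delta> \<and> A \<delta> \<subseteq> square f \<delta>"
    and W_card: "\<And>s. card s \<noteq> 2 \<Longrightarrow> W s = 0"
    and W_C: "\<And>\<delta> s. \<delta> \<in> C \<Longrightarrow> s \<subseteq> outer f \<delta> \<Longrightarrow> W s = 0"
begin

lemma fin: "finite K" "finite T" "finite B" "finite C"
proof -
  show "finite K" by (rule finite_subset[OF K(1)]) simp
  then show "finite T" "finite B" "finite C" unfolding K(2) by auto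
qed

lemma in_dirs: "\<delta> \<in> K \<Longrightarrow> \<delta> \<in> dirs" "\<delta> \<in> T \<Longrightarrow> \<delta> \<in> dirs" "\<delta> \<in> B \<Longrightarrow> \<delta> \<in> dirs" "\<delta> \<in> C \<Longrightarrow> \<delta> \<in> dirs"
  using K by auto

lemma outer_eq: "\<delta> \<in> dirs \<Longrightarrow> outer f \<delta> = square f \<delta> - {f}"
  using square_distinct[of \<delta>] by (auto simp: outer_def square_def add.assoc)

lemma square_pair:
  assumes "\<delta> \<in> dirs" "\<eta> \<in> dirs" "{f + \<delta>, f + rot \<delta>} \<subseteq> square f \<eta>"
  shows "\<eta> = \<delta>"
proof (rule ccontr)
  assume "\<eta> \<noteq> \<delta>"
  then obtain g where g: "square f \<delta> \<inter> square f \<eta> \<subseteq> {f, g}" using square_inter[of \<delta> \<eta>] assms by metis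
  have "{f + \<delta>, f + rot \<delta>} \<subseteq> square f \<delta> \<inter> square f \<eta>" using assms(3) by (auto simp: square_def)
  then have "{f + \<delta>, f + rot \<delta>} \<subseteq> {f, g}" using g by blast
  then show False using square_distinct[OF assms(1)] by auto
qed

lemma A_inj: "inj_on A K"
proof (rule inj_onI)
  fix \<delta> \<eta> assume a: "\<delta> \<in> K" "\<eta> \<in> K" "A \<delta> = A \<eta>"
  then have "{f + \<delta>, f + rot \<delta>} \<subseteq> square f \<eta>" using A_K by blast
  then show "\<delta> = \<eta>" using square_pair[of \<delta> \<eta>] a in_dirs by auto
qed

lemma outer_inj: "inj_on (outer f) dirs"
proof (rule inj_onI)
  fix \<delta> \<eta> assume a: "\<delta> \<in> dirs" "\<eta> \<in> dirs" "outer f \<delta> = outer f \<eta>"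
  have "{f + \<delta>, f + rot \<delta>} \<subseteq> outer f \<delta>" by (simp add: outer_def)
  moreover have "outer f \<eta> \<subseteq> square f \<eta>" by (auto simp: outer_def square_def)
  ultimately have "{f + \<delta>, f + rot \<delta>} \<subseteq> square f \<eta>" unfolding a(3) by (rule subset_trans)
  then show "\<delta> = \<eta>" using square_pair[of \<delta> \<eta>] a by auto
qed

lemma f_notin_outer: "\<delta> \<in> dirs \<Longrightarrow> f \<notin> outer f \<delta>"
  by (simp add: outer_eq)

lemma f_in_A: "\<delta> \<in> K \<Longrightarrow> f \<in> A \<delta>"
  using A_K by blast

lemma outer_notin_Base: "\<delta> \<in> dirs \<Longrightarrow> outer f \<delta> \<notin> Base"
  using Base(2)[of "outer f \<delta>" \<delta>] by (auto simp: outer_def)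

definition cw :: "face set set \<Rightarrow> complex" where "cw e = W (\<Inter>e)"
definition inn :: "face set set \<Rightarrow> complex" where "inn e = (if f \<in> \<Inter>e then W (\<Inter>e) else 0)"
definition out :: "face set set \<Rightarrow> complex" where "out e = (if f \<in> \<Inter>e then 0 else W (\<Inter>e))"
definition V :: "face set set" where "V = Base \<union> A ` K \<union> outer f ` B"

lemma finite_V: "finite V"
  using finite_Base fin by (simp add: V_def)

text \<open>Edges bordering \<open>f\<close> join vertices that contain \<open>f\<close>, which are
  the corners \<open>A \<delta>\<close>. The set \<open>S\<close> records the corners that are
  matched by such edges.\<close>

lemma split_inner:
  "hafnian V cw = (\<Sum>S\<in>Pow K. hafnian (A ` S) inn * hafnian (V - A ` S) out)"
proof -
  have "hafnian V cw = hafnian V (\<lambda>e. inn e + out e)"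
    by (rule hafnian_cong) (simp add: cw_def inn_def out_def)
  also have "\<dots> = (\<Sum>U\<in>Pow V. hafnian U inn * hafnian (V - U) out)"
    by (rule hafnian_add[OF finite_V])
  also have "\<dots> = (\<Sum>U\<in>Pow (A ` K). hafnian U inn * hafnian (V - U) out)"
  proof (rule sum.mono_neutral_right)
    show "Pow (A ` K) \<subseteq> Pow V" by (auto simp: V_def)
    show "\<forall>U\<in>Pow V - Pow (A ` K). hafnian U inn * hafnian (V - U) out = 0"
    proof
      fix U assume U: "U \<in> Pow V - Pow (A ` K)"
      then obtain v where v: "v \<in> U" "v \<notin> A ` K" by auto
      then have "f \<notin> v" using U Base(1) f_notin_outer in_dirs by (auto simp: V_def)
      then have "hafnian U inn = 0"
        using U finite_V by (intro hafnian_isolated[OF _ v(1)]) (auto simp: inn_def intro: finite_subset)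
      then show "hafnian U inn * hafnian (V - U) out = 0" by simp
    qed
  qed (simp add: finite_V)
  also have "\<dots> = (\<Sum>S\<in>Pow K. hafnian (A ` S) inn * hafnian (V - A ` S) out)"
    by (rule sum.reindex_bij_betw[symmetric, where h = "image A"])
      (simp add: bij_betw_def inj_on_image_Pow[OF A_inj] image_Pow_surj)
  finally show ?thesis .
qed

text \<open>An edge at \<open>A \<delta> = {f, f + \<delta>, f + rot \<delta>}\<close> not bordering
  \<open>f\<close> must separate the other two faces. Besides \<open>A \<delta>\<close>, only the
  far end of the wrench contains both.\<close>

lemma out_pendant:
  assumes d: "\<delta> \<in> B" and u: "u \<in> V" "u \<noteq> A \<delta>" "u \<noteq> outer f \<delta>"
  shows "out {A \<delta>, u} = 0"
proof (rule ccontr)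
  assume "out {A \<delta>, u} \<noteq> 0"
  then have nf: "f \<notin> A \<delta> \<inter> u" and nz: "W (A \<delta> \<inter> u) \<noteq> 0" by (auto simp: out_def split: if_splits)
  have c: "card (A \<delta> \<inter> u) = 2" using W_card nz by blast
  have sub: "A \<delta> \<inter> u \<subseteq> {f + \<delta>, f + rot \<delta>}" using nf A_B[OF d] by auto
  have "card {f + \<delta>, f + rot \<delta>} = 2" using square_distinct[OF in_dirs(3)[OF d]] by simp
  then have eq: "A \<delta> \<inter> u = {f + \<delta>, f + rot \<delta>}" using sub c by (intro card_subset_eq) auto
  have fA: "f \<in> A \<delta>" using A_B[OF d] by simp
  have "u \<notin> Base" using Base(2)[of u \<delta>] eq in_dirs(3)[OF d] by blast
  moreover have "u \<notin> A ` K" using nf fA f_in_A by blast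
  ultimately obtain \<eta> where e: "\<eta> \<in> B" "u = outer f \<eta>" using u(1) by (auto simp: V_def)
  have "{f + \<delta>, f + rot \<delta>} \<subseteq> square f \<eta>" using eq e in_dirs(3)[OF e(1)] outer_eq by blast
  then have "\<eta> = \<delta>" using square_pair[of \<delta> \<eta>] d e(1) in_dirs by auto
  then show False using e u by simp
qed

lemma remove_pendants:
  assumes "S \<subseteq> K" "D \<subseteq> B - S"
  shows "hafnian (V - A ` S) out =
    (\<Prod>\<delta>\<in>D. W {f + \<delta>, f + rot \<delta>}) * hafnian (V - A ` S - A ` D - outer f ` D) out"
proof -
  have "finite D" using assms(2) fin(3) finite_subset by blast
  then show ?thesis using assms(2)
  proof (induction D rule: finite_induct)
    case (insert \<delta> D)
    let ?U = "V - A ` S - A ` D - outer f ` D"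
    have d: "\<delta> \<in> B" "\<delta> \<in> K" "\<delta> \<notin> S" "\<delta> \<in> dirs" using insert K in_dirs by auto
    have DB: "D \<subseteq> B" "D \<subseteq> K" "D \<subseteq> dirs" using insert K in_dirs by auto
    have notA: "A \<delta> \<notin> outer f ` D" "outer f \<delta> \<notin> A ` K"
      using f_in_A f_notin_outer d DB by blast+
    have 1: "A \<delta> \<in> ?U"
      using d(2,3) notA(1) insert(2) inj_on_image_mem_iff[OF A_inj d(2) assms(1)]
        inj_on_image_mem_iff[OF A_inj d(2) DB(2)] by (simp add: V_def)
    have 2: "outer f \<delta> \<in> ?U"
    proof -
      have "outer f \<delta> \<notin> A ` S" "outer f \<delta> \<notin> A ` D" using notA(2) assms(1) DB(2) by blast+
      then show ?thesis
        using d(1) insert(2) inj_on_image_mem_iff[OF outer_inj d(4) DB(3)] by (simp add: V_def)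
    qed
    have ne: "A \<delta> \<noteq> outer f \<delta>" using notA d by blast
    have "hafnian ?U out = out {A \<delta>, outer f \<delta>} * hafnian (?U - {A \<delta>, outer f \<delta>}) out"
      by (rule hafnian_pendant[OF _ 1 2 ne]) (use finite_V out_pendant[OF d(1)] in auto)
    moreover have "A \<delta> \<inter> outer f \<delta> = {f + \<delta>, f + rot \<delta>}"
      using A_B[OF d(1)] f_notin_outer[OF d(4)] by (auto simp: outer_def)
    then have "out {A \<delta>, outer f \<delta>} = W {f + \<delta>, f + rot \<delta>}"
      using f_notin_outer[OF d(4)] square_distinct(1,2)[OF d(4)] by (simp add: out_def)
    moreover have "?U - {A \<delta>, outer f \<delta>} = V - A ` S - A ` insert \<delta> D - outer f ` insert \<delta> D" by auto
    ultimately show ?case using insert by (simp add: mult.assoc mult.commute mult.left_commute)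
  qed simp
qed

text \<open>All edges of such a corner border \<open>f\<close>, so it has to be matched inside
  \<open>S\<close>.\<close>

lemma isolated_C:
  assumes "\<delta> \<in> C" "\<delta> \<notin> S" "S \<subseteq> K"
  shows "hafnian (V - A ` S) out = 0"
proof (rule hafnian_isolated)
  have dK: "\<delta> \<in> K" using assms(1) K by blast
  show "A \<delta> \<in> V - A ` S"
    using assms dK A_inj unfolding inj_on_def V_def by blast
  fix u
  show "out {A \<delta>, u} = 0"
  proof (cases "f \<in> u")
    case False
    then have "A \<delta> \<inter> u \<subseteq> outer f \<delta>" using A_K[OF dK] outer_eq[OF in_dirs(1)[OF dK]] by blast
    then show ?thesis using W_C[OF assms(1)] by (simp add: out_def)
  qed (use f_in_A[OF dK] in \<open>simp add: out_def\<close>)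
qed (simp add: finite_V)

text \<open>At this stage the corners still containing \<open>f\<close> are crosses, of which only
  edges away from \<open>f\<close> are left. Deleting \<open>f\<close> turns each into the outer end
  of a wrench. The result no longer mentions \<open>A\<close>, so it can be compared with the
  expansion after a flip.\<close>

lemma relabel:
  assumes S: "S \<subseteq> K" "C \<subseteq> S"
  shows "hafnian (V - A ` S - A ` (B - S) - outer f ` (B - S)) out =
    hafnian (Base \<union> outer f ` (T - S) \<union> outer f ` (B \<inter> S)) cw"
proof -
  let ?R = "Base \<union> A ` (T - S) \<union> outer f ` (B \<inter> S)"
  let ?\<rho> = "\<lambda>u. u - {f}"
  have A_ne: "A \<delta> \<notin> Base" "A \<delta> \<noteq> outer f \<eta>" if "\<delta> \<in> K" "\<eta> \<in> dirs" for \<delta> \<eta>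
    using f_in_A[OF that(1)] Base(1) f_notin_outer[OF that(2)] by auto
  have R: "V - A ` S - A ` (B - S) - outer f ` (B - S) = ?R"
  proof (rule set_eqI)
    fix u
    show "u \<in> V - A ` S - A ` (B - S) - outer f ` (B - S) \<longleftrightarrow> u \<in> ?R"
    proof (cases "f \<in> u")
      case True
      then have nb: "u \<notin> Base" "u \<notin> outer f ` B" "u \<notin> outer f ` (B - S)" "u \<notin> outer f ` (B \<inter> S)"
        using Base(1) f_notin_outer in_dirs(3) by auto
      have "u \<in> A ` K - A ` S - A ` (B - S) \<longleftrightarrow> u \<in> A ` (T - S)"
      proof -
        have "A ` K - A ` S - A ` (B - S) = A ` (K - S - (B - S))"
          using A_inj S K by (subst inj_on_image_set_diff[OF A_inj], blast, blast)+ simp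
        moreover have "K - S - (B - S) = T - S" using K S by blast
        ultimately show ?thesis by simp
      qed
      then show ?thesis using nb by (auto simp: V_def)
    next
      case False
      then have na: "u \<notin> A ` K" "u \<notin> A ` S" "u \<notin> A ` (B - S)" "u \<notin> A ` (T - S)"
        using f_in_A S K by auto
      have "u \<in> outer f ` B - outer f ` (B - S) \<longleftrightarrow> u \<in> outer f ` (B \<inter> S)"
      proof -
        have "outer f ` B - outer f ` (B - S) = outer f ` (B - (B - S))"
          using K by (subst inj_on_image_set_diff[OF inj_on_subset[OF outer_inj], of B]) auto
        moreover have "B - (B - S) = B \<inter> S" by blast
        ultimately show ?thesis by simp
      qed
      moreover have "u \<notin> outer f ` (B - S)" if "u \<in> Base" using that outer_notin_Base in_dirs(3) by auto
      ultimately show ?thesis using na by (auto simp: V_def)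
    qed
  qed
  have \<rho>A: "?\<rho> (A \<delta>) = outer f \<delta>" if "\<delta> \<in> T" for \<delta>
    using A_T[OF that] outer_eq[OF in_dirs(2)[OF that]] by simp
  have \<rho>o: "?\<rho> u = u" if "f \<notin> u" for u using that by simp
  have im: "?\<rho> ` ?R = Base \<union> outer f ` (T - S) \<union> outer f ` (B \<inter> S)"
  proof -
    have "?\<rho> ` Base = Base" using Base(1) by (force simp: image_iff)
    moreover have "?\<rho> ` A ` (T - S) = outer f ` (T - S)" unfolding image_image by (rule image_cong) (use \<rho>A in auto)
    moreover have "?\<rho> ` outer f ` (B \<inter> S) = outer f ` (B \<inter> S)"
      unfolding image_image by (rule image_cong) (use f_notin_outer in_dirs(3) in auto)
    ultimately show ?thesis by (simp add: image_Un)
  qed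
  have inj: "inj_on ?\<rho> ?R"
  proof (rule inj_onI)
    fix u v assume uv: "u \<in> ?R" "v \<in> ?R" "?\<rho> u = ?\<rho> v"
    have *: False if x: "x \<in> ?R" "f \<in> x" and y: "y \<in> ?R" "f \<notin> y" and e: "?\<rho> x = ?\<rho> y" for x y
    proof -
      obtain \<delta> where d: "\<delta> \<in> T - S" "x = A \<delta>" using x Base(1) f_notin_outer in_dirs(3) by blast
      then have yo: "y = outer f \<delta>" using e y(2) \<rho>A[of \<delta>] by simp
      have "y \<notin> A ` (T - S)" using y(2) f_in_A K by blast
      then obtain \<eta> where "\<eta> \<in> B \<inter> S" "y = outer f \<eta>" using y(1) yo outer_notin_Base d in_dirs(2) by auto
      then have "\<eta> = \<delta>" using yo outer_inj d in_dirs unfolding inj_on_def by auto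
      then show False using d \<open>\<eta> \<in> B \<inter> S\<close> by blast
    qed
    show "u = v" using *[of u v] *[of v u] uv by (cases "f \<in> u"; cases "f \<in> v") auto
  qed
  have "hafnian ?R out = hafnian ?R (\<lambda>e. cw (?\<rho> ` e))"
  proof (rule hafnian_cong)
    fix u v assume uv: "u \<in> ?R" "v \<in> ?R" "u \<noteq> v"
    have i: "\<Inter>(?\<rho> ` {u, v}) = u \<inter> v - {f}" by auto
    show "out {u, v} = cw (?\<rho> ` {u, v})"
    proof (cases "f \<in> u \<inter> v")
      case False
      then have "u \<inter> v - {f} = u \<inter> v" by blast
      then show ?thesis unfolding cw_def i using False by (auto simp: out_def)
    next
      case True
      have ex: "\<exists>\<delta>\<in>T - S. x = A \<delta>" if "x \<in> ?R" "f \<in> x" for x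
        using that Base(1) f_notin_outer in_dirs(3) by blast
      have "f \<in> u" "f \<in> v" using True by auto
      obtain \<delta> where d1: "\<delta> \<in> T" "u = A \<delta>" using ex[OF uv(1) \<open>f \<in> u\<close>] by blast
      obtain \<eta> where d2: "\<eta> \<in> T" "v = A \<eta>" using ex[OF uv(2) \<open>f \<in> v\<close>] by blast
      note d = d1(1) d2(1) d1(2) d2(2)
      then have "\<delta> \<noteq> \<eta>" using uv(3) by blast
      \<comment> \<open>Two crosses were joined at most by an edge bordering \<open>f\<close>, which
        \<open>out\<close> ignores. After the deletion they share at most one face, and weights are
        zero unless there are two.\<close>
      then obtain g where "square f \<delta> \<inter> square f \<eta> \<subseteq> {f, g}"
        using square_inter[of \<delta> \<eta>] d in_dirs(2) by metis
      then have "u \<inter> v - {f} \<subseteq> {g}" using d A_T by auto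
      then have "card (u \<inter> v - {f}) \<le> 1" using card_mono[of "{g}"] by fastforce
      then have "W (u \<inter> v - {f}) = 0" by (intro W_card) simp
      then show ?thesis using True unfolding cw_def i by (simp add: out_def)
    qed
  qed
  then show ?thesis unfolding R hafnian_image[OF inj, symmetric] im .
qed

text \<open>The first two factors are local. The last one depends only on \<open>T - S\<close> and
  \<open>B \<inter> S\<close>: exchanging \<open>T\<close> with \<open>B\<close> and
  \<open>S\<close> with its complement leaves it unchanged, which matches the terms before and after
  a flip.\<close>

lemma expansion:
  "hafnian V cw = (\<Sum>S | C \<subseteq> S \<and> S \<subseteq> K. hafnian (A ` S) inn * (\<Prod>\<delta>\<in>B - S. W {f + \<delta>, f + rot \<delta>}) *
     hafnian (Base \<union> outer f ` (T - S) \<union> outer f ` (B \<inter> S)) cw)"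
proof -
  have "hafnian V cw = (\<Sum>S | C \<subseteq> S \<and> S \<subseteq> K. hafnian (A ` S) inn * hafnian (V - A ` S) out)"
    unfolding split_inner by (rule sum.mono_neutral_right) (use fin isolated_C in auto)
  also have "\<dots> = (\<Sum>S | C \<subseteq> S \<and> S \<subseteq> K. hafnian (A ` S) inn * (\<Prod>\<delta>\<in>B - S. W {f + \<delta>, f + rot \<delta>}) *
     hafnian (Base \<union> outer f ` (T - S) \<union> outer f ` (B \<inter> S)) cw)"
  proof (intro sum.cong refl)
    fix S assume "S \<in> {S. C \<subseteq> S \<and> S \<subseteq> K}"
    then have S: "S \<subseteq> K" "C \<subseteq> S" by auto
    show "hafnian (A ` S) inn * hafnian (V - A ` S) out =
        hafnian (A ` S) inn * (\<Prod>\<delta>\<in>B - S. W {f + \<delta>, f + rot \<delta>}) *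
        hafnian (Base \<union> outer f ` (T - S) \<union> outer f ` (B \<inter> S)) cw"
      unfolding remove_pendants[OF S(1) subset_refl] relabel[OF S] by (rule mult.assoc[symmetric])
  qed
  finally show ?thesis .
qed

end

section \<open>The four-cycle around a face and the algebra of a flip\<close>

definition quad_poly :: "(face \<Rightarrow> complex) \<Rightarrow> face set \<Rightarrow> complex" where
  "quad_poly \<alpha> S = (if S = {} then 1
     else if S = dirs then \<alpha> (1, 0) * \<alpha> (-1, 0) + \<alpha> (0, 1) * \<alpha> (0, -1)
     else if card S = 2 then (\<Sum>\<delta> | \<delta> \<in> S \<and> rot \<delta> \<in> S. \<alpha> \<delta>) else 0)"

context face_star
begin

lemma inn_edge:
  assumes "\<delta> \<in> K" "\<eta> \<in> K"
  shows "\<eta> = rot \<delta> \<Longrightarrow> inn {A \<delta>, A \<eta>} = W {f, f + rot \<delta>}" "\<eta> = - \<delta> \<Longrightarrow> inn {A \<delta>, A \<eta>} = 0"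
proof -
  have d: "\<delta> \<in> dirs" "\<eta> \<in> dirs" using assms in_dirs by auto
  show "inn {A \<delta>, A \<eta>} = W {f, f + rot \<delta>}" if "\<eta> = rot \<delta>"
  proof -
    have "A \<delta> \<inter> A \<eta> = {f, f + rot \<delta>}"
      using A_K[OF assms(1)] A_K[OF assms(2)] square_inter_rot[OF d(1), of f] that by blast
    then show ?thesis by (simp add: inn_def)
  qed
  show "inn {A \<delta>, A \<eta>} = 0" if "\<eta> = - \<delta>"
  proof -
    have "A \<delta> \<inter> A \<eta> = {f}"
      using A_K[OF assms(1)] A_K[OF assms(2)] square_inter_opposite[OF d(1), of f] that by blast
    then show ?thesis using W_card[of "{f}"] by (simp add: inn_def)
  qed
qed

text \<open>The corners in cyclic order form a four-cycle, consecutive corners \<delta> and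
  \<open>rot \<delta>\<close> being joined by the edge between \<open>f\<close> and
  \<open>f + rot \<delta>\<close>; opposite corners share only \<open>f\<close>. So
  \<open>quad_poly\<close> is the partition function of the subgraph of this cycle induced by
  \<open>S\<close>: two matchings for the full cycle, at most one for a pair, none for odd
  sets.\<close>

lemma hafnian_inner:
  assumes S: "S \<subseteq> K"
  shows "hafnian (A ` S) inn = quad_poly (\<lambda>\<delta>. W {f, f + rot \<delta>}) S"
proof -
  have inj: "inj_on A S" using A_inj S inj_on_subset by blast
  have fS: "finite S" using S fin finite_subset by blast
  have SD: "S \<subseteq> dirs" using S K by blast
  have "card dirs = 4" by (simp add: dirs_def)
  then have c4: "card S \<le> 4" using card_mono[OF finite_dirs SD] by simp
  consider "S = {}" | "S = dirs" | "card S = 2" | "odd (card S)"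
  proof -
    have "S = dirs" if "card S = 4" using card_subset_eq[OF finite_dirs SD] that \<open>card dirs = 4\<close> by simp
    moreover have "S = {}" if "card S = 0" using that fS by simp
    moreover have "card S = 0 \<or> card S = 1 \<or> card S = 2 \<or> card S = 3 \<or> card S = 4" using c4 by linarith
    ultimately show thesis using that by fastforce
  qed
  then show ?thesis
  proof cases
    case 1
    then show ?thesis by (simp add: quad_poly_def)
  next
    case 2
    let ?E = "(1, 0) :: face" and ?N = "(0, 1) :: face" and ?W = "(-1, 0) :: face" and ?S = "(0, -1) :: face"
    have im: "A ` S = {A ?E, A ?N, A ?W, A ?S}" using 2 by (simp add: dirs_def)
    have inK: "?E \<in> K" "?N \<in> K" "?W \<in> K" "?S \<in> K" using 2 S by (auto simp: dirs_def)
    have "distinct [A ?E, A ?N, A ?W, A ?S]"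
      using A_inj inK by (simp add: inj_on_eq_iff)
    then have "hafnian (A ` S) inn = inn {A ?E, A ?N} * inn {A ?W, A ?S} + inn {A ?N, A ?W} * inn {A ?S, A ?E}"
      unfolding im
    proof (rule hafnian_four_cycle)
      show "inn {A ?E, A ?W} = 0" by (rule inn_edge(2)) (simp_all add: inK)
      show "inn {A ?N, A ?S} = 0" by (rule inn_edge(2)) (simp_all add: inK)
    qed
    moreover have "inn {A ?E, A ?N} = W {f, f + ?N}" "inn {A ?N, A ?W} = W {f, f + ?W}"
      "inn {A ?W, A ?S} = W {f, f + ?S}" "inn {A ?S, A ?E} = W {f, f + ?E}"
      using inn_edge(1)[OF inK(1,2)] inn_edge(1)[OF inK(2,3)] inn_edge(1)[OF inK(3,4)] inn_edge(1)[OF inK(4,1)]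
      by simp_all
    moreover have "quad_poly \<alpha> S = \<alpha> ?E * \<alpha> ?W + \<alpha> ?N * \<alpha> ?S" for \<alpha>
      using 2 by (simp add: quad_poly_def) (simp add: dirs_def)
    ultimately show ?thesis by simp
  next
    case 3
    then obtain \<delta> \<eta> where de: "S = {\<delta>, \<eta>}" "\<delta> \<noteq> \<eta>" by (auto simp: card_2_iff)
    have inK: "\<delta> \<in> K" "\<eta> \<in> K" "\<delta> \<in> dirs" "\<eta> \<in> dirs" using de S SD by auto
    have S': "S \<noteq> {}" "S \<noteq> dirs" using 3 \<open>card dirs = 4\<close> by auto
    have "A \<delta> \<noteq> A \<eta>" using A_inj inK de(2) by (simp add: inj_on_eq_iff)
    then have h: "hafnian (A ` S) inn = inn {A \<delta>, A \<eta>}" using de by simp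
    have rr: "rot x \<noteq> x" "rot (rot x) \<noteq> x" if "x \<in> dirs" for x using that by (auto simp: dirs_def)
    consider "\<eta> = rot \<delta>" | "\<delta> = rot \<eta>" | "\<eta> = - \<delta>" using dirs_four[OF inK(3,4)] de(2) by fastforce
    then show ?thesis
    proof cases
      case 1
      have "{x. x \<in> S \<and> rot x \<in> S} = {\<delta>}" using rr[OF inK(3)] rr[OF inK(4)] 1 de by auto
      then show ?thesis using h inn_edge(1)[OF inK(1,2) 1] S' 3 by (simp add: quad_poly_def)
    next
      case 2
      have "{x. x \<in> S \<and> rot x \<in> S} = {\<eta>}" using rr[OF inK(3)] rr[OF inK(4)] 2 de by auto
      then show ?thesis using h inn_edge(1)[OF inK(2,1) 2] S' 3 by (simp add: quad_poly_def insert_commute)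
    next
      case 3
      have "{x. x \<in> S \<and> rot x \<in> S} = {}" using 3 de inK(3) by (auto simp: dirs_def)
      then have "(\<Sum>x | x \<in> S \<and> rot x \<in> S. W {f, f + rot x}) = 0" by (simp only: sum.empty)
      then show ?thesis using h inn_edge(2)[OF inK(1,2) 3] S' \<open>card S = 2\<close> by (simp add: quad_poly_def)
    qed
  next
    case 4
    then have "hafnian (A ` S) inn = 0" using fS by (intro hafnian_odd) (simp_all add: card_image[OF inj])
    moreover have "S \<noteq> dirs" "S \<noteq> {}" "card S \<noteq> 2" using 4 \<open>card dirs = 4\<close> by auto
    ultimately show ?thesis by (simp add: quad_poly_def)
  qed
qed

end

abbreviation "dE \<equiv> (1, 0) :: face"
abbreviation "dN \<equiv> (0, 1) :: face"
abbreviation "dW \<equiv> (-1, 0) :: face"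
abbreviation "dS \<equiv> (0, -1) :: face"

lemma quad_poly_simps:
  "quad_poly \<alpha> {} = 1" "quad_poly \<alpha> dirs = \<alpha> dE * \<alpha> dW + \<alpha> dN * \<alpha> dS"
  "quad_poly \<alpha> {dE, dN} = \<alpha> dE" "quad_poly \<alpha> {dN, dW} = \<alpha> dN" "quad_poly \<alpha> {dW, dS} = \<alpha> dW"
  "quad_poly \<alpha> {dS, dE} = \<alpha> dS" "quad_poly \<alpha> {dE, dW} = 0" "quad_poly \<alpha> {dN, dS} = 0"
proof -
  have nd: "S \<noteq> dirs" if "card S = 2" for S
  proof
    assume "S = dirs"
    moreover have "card dirs = 4" by (simp add: dirs_def)
    ultimately show False using that by simp
  qed
  have two: "quad_poly \<alpha> S = (\<Sum>\<delta>\<in>S. if rot \<delta> \<in> S then \<alpha> \<delta> else 0)" if "card S = 2" for S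
  proof -
    have "finite S" using that by (simp add: card_ge_0_finite)
    then show ?thesis using that nd[OF that] by (auto simp: quad_poly_def sum.inter_filter)
  qed
  show "quad_poly \<alpha> {} = 1" by (simp add: quad_poly_def)
  show "quad_poly \<alpha> dirs = \<alpha> dE * \<alpha> dW + \<alpha> dN * \<alpha> dS"
    by (simp add: quad_poly_def) (simp add: dirs_def)
  show "quad_poly \<alpha> {dE, dN} = \<alpha> dE" "quad_poly \<alpha> {dN, dW} = \<alpha> dN" "quad_poly \<alpha> {dW, dS} = \<alpha> dW"
    "quad_poly \<alpha> {dS, dE} = \<alpha> dS" "quad_poly \<alpha> {dE, dW} = 0" "quad_poly \<alpha> {dN, dS} = 0"
    by (subst two; simp)+
qed

lemma quad_poly_odd: "odd (card S) \<Longrightarrow> S \<noteq> {} \<Longrightarrow> quad_poly \<alpha> S = 0"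
proof -
  assume "odd (card S)" "S \<noteq> {}"
  moreover have "card dirs = 4" by (simp add: dirs_def)
  ultimately show ?thesis by (auto simp: quad_poly_def)
qed

lemma two_dirs:
  assumes "S \<subseteq> dirs" "card S = 2"
  shows "S \<in> {{dE, dN}, {dN, dW}, {dW, dS}, {dS, dE}, {dE, dW}, {dN, dS}}"
proof -
  obtain \<delta> \<eta> where S: "S = {\<delta>, \<eta>}" "\<delta> \<noteq> \<eta>" using assms(2) by (auto simp: card_2_iff)
  have "\<delta> \<in> dirs" "\<eta> \<in> dirs" using assms(1) S by auto
  then show ?thesis using S(2) unfolding S(1) by (elim dirs_cases; simp add: doubleton_eq_iff)
qed

text \<open>Here \<open>w\<close> and \<open>w'\<close> are the old and new weights of the face, and
  \<open>e\<close>, \<open>n\<close>, \<open>u\<close>, \<open>s\<close> those to its east, north,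
  west and south. The formula is read off from the case \<open>S = {dE, dN}\<close> of
  \<open>quad_flip\<close>, where both four-cycles contribute a single edge, \<open>w - n\<close>
  before and \<open>s - w'\<close> after the flip. The west, north and south legs enter on one side
  or the other according to \<open>T\<close>.\<close>

definition flip_ratio :: "face set \<Rightarrow> complex \<Rightarrow> complex \<Rightarrow> complex \<Rightarrow> complex \<Rightarrow> complex \<Rightarrow> complex \<Rightarrow> complex" where
  "flip_ratio T w w' e n u s = (w - n) * (s - e) / (s - w') * (if dW \<in> T then 1 else s - u) /
     ((if dN \<in> T then u - n else 1) * (if dS \<in> T then s - e else 1))"

text \<open>The identities of the spider move. The factor \<open>s - u\<close> may vanish for a solution of the dSKP
  equation, and \<open>e - n\<close> as well; this is why one must not divide by them.\<close>

lemma quad_flip: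
  fixes w w' e n u s :: complex and l \<alpha> \<alpha>' :: "face \<Rightarrow> complex"
  assumes skp: "(w - n) * (u - w') * (s - e) / ((n - u) * (w' - s) * (e - w)) = -1"
    and l: "l dE = e - n" "l dN = u - n" "l dW = s - u" "l dS = s - e"
    and \<alpha>: "\<alpha> dE = w - n" "\<alpha> dN = w - u" "\<alpha> dW = s - w" "\<alpha> dS = w - e"
    and \<alpha>': "\<alpha>' dE = w' - n" "\<alpha>' dN = u - w'" "\<alpha>' dW = s - w'" "\<alpha>' dS = e - w'"
    and T: "T \<subseteq> dirs" "dE \<notin> T" and S: "S \<subseteq> dirs"
  shows "quad_poly \<alpha> S * (\<Prod>\<delta>\<in>dirs - S. if \<delta> \<in> T then 1 else l \<delta>) =
    flip_ratio T w w' e n u s * (quad_poly \<alpha>' (dirs - S) * (\<Prod>\<delta>\<in>S. if \<delta> \<in> T then l \<delta> else 1))"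
proof -
  have "(n - u) * (w' - s) * (e - w) \<noteq> 0" using skp by force
  then have nz: "n \<noteq> u" "w' \<noteq> s" "e \<noteq> w" by auto
  then have R: "(w - n) * (u - w') * (s - e) = - ((n - u) * (w' - s) * (e - w))"
    using skp by (simp add: divide_eq_eq)
  have nz2: "w \<noteq> n" "u \<noteq> w'" "s \<noteq> e" using R nz by auto
  \<comment> \<open>The part of the ratio that does not depend on \<open>T\<close>. Each identity
    for it is checked after multiplication by \<open>s - w'\<close>, which does not vanish, and is
    then a polynomial consequence of \<open>R\<close>.\<close>
  define r0 where "r0 = (w - n) * (s - e) / (s - w')"
  define D where "D = (w - n) * (s - w) + (w - u) * (w - e)"
  define D' where "D' = (w' - n) * (s - w') + (u - w') * (e - w')"
  have r0: "r0 * (s - w') = (w - n) * (s - e)" using nz by (simp add: r0_def)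
  have cancel: "x = y" if "x * (s - w') = y * (s - w')" for x y using that nz by simp
  have i1: "D = r0 * (s - u)"
  proof (rule cancel)
    have "r0 * (s - u) * (s - w') = (w - n) * (s - e) * (s - u)" using r0 by algebra
    then show "D * (s - w') = r0 * (s - u) * (s - w')" using R unfolding D_def by algebra
  qed
  have i3: "r0 * (s - u) * (w' - n) = (s - w) * (e - n) * (u - n)"
  proof (rule cancel)
    have "r0 * (s - u) * (w' - n) * (s - w') = (w - n) * (s - e) * (s - u) * (w' - n)" using r0 by algebra
    then show "r0 * (s - u) * (w' - n) * (s - w') = (s - w) * (e - n) * (u - n) * (s - w')" using R by algebra
  qed
  have i4: "r0 * (s - u) * (e - w') = (w - u) * (e - n) * (s - e)"
  proof (rule cancel)
    have "r0 * (s - u) * (e - w') * (s - w') = (w - n) * (s - e) * (s - u) * (e - w')" using r0 by algebra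
    then show "r0 * (s - u) * (e - w') * (s - w') = (w - u) * (e - n) * (s - e) * (s - w')" using R by algebra
  qed
  have i5: "r0 * (u - w') = (w - e) * (u - n)"
  proof (rule cancel)
    have "r0 * (u - w') * (s - w') = (w - n) * (s - e) * (u - w')" using r0 by algebra
    then show "r0 * (u - w') * (s - w') = (w - e) * (u - n) * (s - w')" using R by algebra
  qed
  have i6: "r0 * D' = (e - n) * (u - n) * (s - e)"
  proof (rule cancel)
    have "r0 * D' * (s - w') = (w - n) * (s - e) * D'" using r0 by algebra
    then show "r0 * D' * (s - w') = (e - n) * (u - n) * (s - e) * (s - w')" using R unfolding D'_def by algebra
  qed
  \<comment> \<open>For each leg, \<open>t\<close> is its factor when the direction lies in
    \<open>S\<close> and \<open>c\<close> its factor when it does not; the product of both is the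
    weight of the leg.\<close>
  define tN tW tS where "tN = (if dN \<in> T then l dN else 1)" and "tW = (if dW \<in> T then l dW else 1)"
    and "tS = (if dS \<in> T then l dS else 1)"
  define cN cW cS where "cN = (if dN \<in> T then 1 else l dN)" and "cW = (if dW \<in> T then 1 else l dW)"
    and "cS = (if dS \<in> T then 1 else l dS)"
  have tc: "cN * tN = l dN" "cW * tW = l dW" "cS * tS = l dS"
    by (simp_all add: tN_def tW_def tS_def cN_def cW_def cS_def)
  have tnz: "tN \<noteq> 0" "tS \<noteq> 0" using nz nz2 by (simp_all add: tN_def tS_def l)
  have fr: "flip_ratio T w w' e n u s = r0 * cW / (tN * tS)"
    by (simp add: flip_ratio_def r0_def cW_def tN_def tS_def l)
  \<comment> \<open>Only the north and south factors are cleared, and these do not vanish. The west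
    leg stays as the factor \<open>cW\<close> of the ratio, and the east leg is never divided by
    because \<open>dE\<close> is not in \<open>T\<close>.\<close>
  have goal: "X = flip_ratio T w w' e n u s * Y" if "X * (tN * tS) = r0 * cW * Y" for X Y
    unfolding fr using that tnz by (simp add: field_simps)
  have j1: "quad_poly \<alpha> dirs = r0 * l dW" using i1 by (simp add: quad_poly_simps \<alpha> l D_def)
  have j2: "r0 * \<alpha>' dW = \<alpha> dE * l dS" using r0 by (simp add: \<alpha> \<alpha>' l)
  have j3: "r0 * l dW * \<alpha>' dE = \<alpha> dW * l dE * l dN" using i3 by (simp add: \<alpha> \<alpha>' l)
  have j4: "r0 * l dW * \<alpha>' dS = \<alpha> dN * l dE * l dS" using i4 by (simp add: \<alpha> \<alpha>' l)
  have j5: "r0 * \<alpha>' dN = \<alpha> dS * l dN" using i5 by (simp add: \<alpha> \<alpha>' l)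
  have j6: "r0 * quad_poly \<alpha>' dirs = l dE * l dN * l dS" using i6 by (simp add: quad_poly_simps \<alpha>' l D'_def)
  have dirs: "dirs = {dE, dN, dW, dS}" by (simp add: dirs_def)
  have c: "(if dE \<in> T then 1 else l dE) = l dE" "(if dE \<in> T then l dE else 1) = 1" using T(2) by simp_all
  note p = c tN_def[symmetric] tW_def[symmetric] tS_def[symmetric] cN_def[symmetric] cW_def[symmetric] cS_def[symmetric]
  note q = quad_poly_simps(1,3-8)
  consider "S = {}" | "S = dirs" | "S = {dE, dN}" | "S = {dN, dW}" | "S = {dW, dS}" | "S = {dS, dE}"
    | "S = {dE, dW}" | "S = {dN, dS}" | "odd (card S)"
  proof -
    note th = that
    have c: "card dirs = 4" by (simp add: dirs)
    have "finite S" using S finite_dirs finite_subset by blast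
    then have "S = {}" if "card S = 0" using that by simp
    moreover have "S = dirs" if "card S = 4" using card_subset_eq[OF finite_dirs S] that c by simp
    moreover have "card S = 0 \<or> card S = 1 \<or> card S = 2 \<or> card S = 3 \<or> card S = 4"
      using card_mono[OF finite_dirs S] c by linarith
    ultimately consider "S = {}" | "S = dirs" | "card S = 2" | "odd (card S)" by fastforce
    then show thesis
    proof cases
      case 3
      from two_dirs[OF S this] show thesis
        unfolding insert_iff empty_iff by (elim disjE FalseE) (erule th)+
    qed (erule th)+
  qed
  then show ?thesis
  proof cases
    case 1
    have P: "(\<Prod>\<delta>\<in>dirs. if \<delta> \<in> T then 1 else l \<delta>) = l dE * (cN * (cW * cS))"
      by (simp add: dirs p)
    have ds: "dirs - S = dirs" using 1 by simp
    show ?thesis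
      unfolding ds P unfolding 1 q prod.empty by (rule goal) (use j6 tc in algebra)
  next
    case 2
    have P: "(\<Prod>\<delta>\<in>dirs. if \<delta> \<in> T then l \<delta> else 1) = tN * (tW * tS)"
      by (simp add: dirs p)
    have ds: "dirs - S = {}" using 2 by simp
    show ?thesis
      unfolding ds unfolding 2 P q prod.empty by (rule goal) (use j1 tc in algebra)
  next
    case 3
    have ds: "dirs - S = {dW, dS}" unfolding 3 dirs by auto
    have P: "(\<Prod>\<delta>\<in>{dW, dS}. if \<delta> \<in> T then 1 else l \<delta>) = cW * cS" "(\<Prod>\<delta>\<in>S. if \<delta> \<in> T then l \<delta> else 1) = tN"
      unfolding 3 by (simp_all add: p)
    show ?thesis
      unfolding P(2) ds P(1) unfolding 3 q by (rule goal) (use j2 tc in algebra)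
  next
    case 4
    have ds: "dirs - S = {dS, dE}" unfolding 4 dirs by auto
    have P: "(\<Prod>\<delta>\<in>{dS, dE}. if \<delta> \<in> T then 1 else l \<delta>) = cS * l dE" "(\<Prod>\<delta>\<in>S. if \<delta> \<in> T then l \<delta> else 1) = tN * tW"
      unfolding 4 by (simp_all add: p)
    show ?thesis
      unfolding P(2) ds P(1) unfolding 4 q by (rule goal) (use j4 tc in algebra)
  next
    case 5
    have ds: "dirs - S = {dE, dN}" unfolding 5 dirs by auto
    have P: "(\<Prod>\<delta>\<in>{dE, dN}. if \<delta> \<in> T then 1 else l \<delta>) = l dE * cN" "(\<Prod>\<delta>\<in>S. if \<delta> \<in> T then l \<delta> else 1) = tW * tS"
      unfolding 5 by (simp_all add: p)
    show ?thesis
      unfolding P(2) ds P(1) unfolding 5 q by (rule goal) (use j3 tc in algebra)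
  next
    case 6
    have ds: "dirs - S = {dN, dW}" unfolding 6 dirs by auto
    have P: "(\<Prod>\<delta>\<in>{dN, dW}. if \<delta> \<in> T then 1 else l \<delta>) = cN * cW" "(\<Prod>\<delta>\<in>S. if \<delta> \<in> T then l \<delta> else 1) = tS"
      unfolding 6 by (simp_all add: p)
    show ?thesis
      unfolding P(2) ds P(1) unfolding 6 q by (rule goal) (use j5 tc in algebra)
  next
    case 7
    have "dirs - S = {dN, dS}" unfolding 7 dirs by auto
    then show ?thesis using 7 by (simp add: q)
  next
    case 8
    have "dirs - S = {dE, dW}" unfolding 8 dirs by auto
    then show ?thesis using 8 by (simp add: q)
  next
    case 9
    have c: "card dirs = 4" by (simp add: dirs)
    have "card (dirs - S) = 4 - card S"
      unfolding c[symmetric] by (rule card_Diff_subset[OF finite_subset[OF S finite_dirs] S])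
    moreover have "card S \<le> 4" using card_mono[OF finite_dirs S] c by simp
    ultimately have o: "odd (card (dirs - S))" using 9 by simp
    then have "S \<noteq> {}" "dirs - S \<noteq> {}" using 9 by (metis card.empty even_zero)+
    then show ?thesis by (simp add: quad_poly_odd[OF 9] quad_poly_odd[OF o])
  qed
qed

text \<open>A diagonal pair determines its unit square, and \<open>f\<close> is one of the remaining
  corners of that square. So no vertex from a square away from \<open>f\<close> contains such a
  pair.\<close>

lemma diagonal_square:
  assumes "\<delta> \<in> dirs" "f + \<delta> \<in> unit_square q" "f + rot \<delta> \<in> unit_square q"
  shows "f \<in> unit_square q"
  using assms by (cases f; cases q; elim dirs_cases; auto)

text \<open>By the choice of the last face, the north-east vertex of \<open>f\<close> is not turned from a cross into a wrench.
  Otherwise one would have to divide by the difference of the weights to the east and to the north,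
  which may vanish.\<close>

locale flip = cone +
  fixes f :: face
  assumes f_int: "f \<in> II" and f_min: "\<And>g. g \<in> II \<Longrightarrow> h f \<le> h g"
    and f_last: "\<And>g. g \<in> II \<Longrightarrow> h g = h f \<Longrightarrow> fst g + snd g \<le> fst f + snd f"
begin

definition h' :: "face \<Rightarrow> int" where "h' = h(f := h f + 2)"

lemma h'_simps [simp]: "h' f = h f + 2" "g \<noteq> f \<Longrightarrow> h' g = h g"
  by (simp_all add: h'_def)

text \<open>A neighbour one lower would also be internal, against the minimality of
  \<open>f\<close>.\<close>

lemma nbr: "\<delta> \<in> dirs \<Longrightarrow> h (f + \<delta>) = h f + 1"
  using step_cases[of \<delta> f] f_min[of "f + \<delta>"] f_int dist1_step[of \<delta> f] unfolding internal_iff by fastforce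

lemma nbr_ne [simp]: "\<delta> \<in> dirs \<Longrightarrow> f + \<delta> \<noteq> f" "\<delta> \<in> dirs \<Longrightarrow> f + \<delta> + rot \<delta> \<noteq> f" "\<delta> \<in> dirs \<Longrightarrow> f + rot \<delta> \<noteq> f"
  using square_distinct[of \<delta>] by (simp_all add: add.assoc)

lemma diag: "\<delta> \<in> dirs \<Longrightarrow> h (f + \<delta> + rot \<delta>) = h f \<or> h (f + \<delta> + rot \<delta>) = h f + 2"
  using step_cases[of "rot \<delta>" "f + \<delta>"] nbr[of \<delta>] by auto

lemma new_nbr [simp]:
  "\<delta> \<in> dirs \<Longrightarrow> h' (f + \<delta>) = h f + 1" "\<delta> \<in> dirs \<Longrightarrow> h' (f + rot \<delta>) = h f + 1"
  "\<delta> \<in> dirs \<Longrightarrow> h' (f + \<delta> + rot \<delta>) = h (f + \<delta> + rot \<delta>)"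
  using nbr[of \<delta>] nbr[of "rot \<delta>"] square_distinct[of \<delta>] by (simp_all add: add.assoc)

sublocale new: cone h' px py k
proof
  fix \<delta> g assume d: "\<delta> \<in> dirs"
  have "h (g + \<delta>) = h f + 1" if "g = f" using nbr d that by simp
  moreover have "h g = h f + 1" if "g + \<delta> = f"
    using nbr[of "- \<delta>"] d that by (metis add_diff_cancel diff_conv_add_uminus minus_in_dirs)
  moreover have "g + \<delta> \<noteq> g" using square_distinct(1)[OF d] by simp
  ultimately show "\<bar>h' (g + \<delta>) - h' g\<bar> = 1"
    using step[OF d, of g] by (cases "g = f"; cases "g + \<delta> = f") auto
next
  fix g show "even (fst g + snd g + h' g)" using even_h[of g] by (cases "g = f") auto
next
  show "even (px + py + k)" by (rule even_p)
next
  have "cw_internal h' (px, py, k) \<subseteq> II"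
    by (auto simp: cw_internal_def even_lattice_def h'_def split: if_splits)
  then show "finite (cw_internal h' (px, py, k))" using finite_internal finite_subset by blast
qed

lemma new_II: "g \<noteq> f \<Longrightarrow> g \<in> new.II \<longleftrightarrow> g \<in> II" "f \<in> new.II \<longleftrightarrow> h f + 2 + dist1 f < k"
  by (simp_all add: internal_iff new.internal_iff)

text \<open>The corners of \<open>f\<close> that meet another internal face, see
  \<open>outer_live\<close>. If the flip takes \<open>f\<close> out of the cone, the remaining
  corners disappear from the graph; before the flip they form the set \<open>C\<close> of
  \<open>face_star\<close>.\<close>

definition live :: "face set" where "live = {\<delta>\<in>dirs. f + \<delta> \<in> II \<or> f + rot \<delta> \<in> II}"
definition TT :: "face set" where "TT = {\<delta>\<in>live. h (f + \<delta> + rot \<delta>) = h f}"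
definition BB :: "face set" where "BB = {\<delta>\<in>live. h (f + \<delta> + rot \<delta>) \<noteq> h f}"

lemma live_dirs: "live \<subseteq> dirs" and live_split: "live = TT \<union> BB" "TT \<inter> BB = {}"
  by (auto simp: live_def TT_def BB_def)

lemma diag_live: "\<delta> \<in> dirs \<Longrightarrow> f + \<delta> + rot \<delta> \<in> II \<Longrightarrow> \<delta> \<in> live"
  using dist1_square[of \<delta> f] dist1_step[of \<delta> f] dist1_step[of "rot \<delta>" f] nbr[of \<delta>] nbr[of "rot \<delta>"] diag[of \<delta>]
    f_int internal_iff2[of f] even_level[of f]
  by (auto simp: live_def internal_iff)

lemma live_new: "f \<in> new.II \<Longrightarrow> live = dirs"
proof -
  assume "f \<in> new.II"
  then have "f + \<delta> \<in> II" if "\<delta> \<in> dirs" for \<delta>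
    using nbr[OF that] dist1_step[OF that, of f] unfolding new_II(2) internal_iff by auto
  then show ?thesis by (auto simp: live_def)
qed

text \<open>If the flip takes \<open>f\<close> out of the cone, the level of \<open>f\<close> was
  exactly \<open>k - 2\<close>. Its neighbours are one higher, so they are internal iff they are
  nearer to the apex.\<close>

lemma old_new: "f \<notin> new.II \<Longrightarrow> \<delta> \<in> dirs \<Longrightarrow> f + \<delta> \<in> II \<longleftrightarrow> dist1 (f + \<delta>) = dist1 f - 1"
  using nbr[of \<delta>] dist1_step[of \<delta> f] f_int internal_iff[of f] internal_iff2[of f] new_II(2) even_level[of f]
  unfolding internal_iff by auto

text \<open>A cross at the north-east corner would come with an internal diagonal face as low as
  \<open>f\<close> but with a larger coordinate sum.\<close>

lemma TT_last: "dE \<notin> TT"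
proof
  assume "dE \<in> TT"
  then have l: "dE \<in> live" "h (f + dE + dN) = h f" by (auto simp: TT_def)
  have dd: "dE \<in> dirs" "dN \<in> dirs" "rot dE = dN" by (auto simp: dirs_def)
  have "f + dE + dN \<in> II"
    using l dd nbr[OF dd(1)] nbr[OF dd(2)] dist1_square[OF dd(1), of f] dist1_step[OF dd(1), of f] dist1_step[OF dd(2), of f]
    by (auto simp: live_def internal_iff)
  from f_last[OF this l(2)] show False by simp
qed

abbreviation "A \<equiv> corner_vertex h f"
abbreviation "A' \<equiv> corner_vertex h' f"

text \<open>The diagonal face has height \<open>h f\<close> or \<open>h f + 2\<close>. The first
  case is a cross before the flip and a wrench after it, the second the other way round.\<close>

lemma A_eq: "\<delta> \<in> dirs \<Longrightarrow> A \<delta> = (if h (f + \<delta> + rot \<delta>) = h f then square f \<delta> else {f, f + \<delta>, f + rot \<delta>})"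
  using nbr[of \<delta>] nbr[of "rot \<delta>"] by (auto simp: corner_vertex_simps square_def)

lemma A'_eq: "\<delta> \<in> dirs \<Longrightarrow> A' \<delta> = (if h (f + \<delta> + rot \<delta>) = h f then {f, f + \<delta>, f + rot \<delta>} else square f \<delta>)"
  using diag[of \<delta>] by (auto simp: new.corner_vertex_simps square_def)

definition rest :: "cw_vertex set" where
  "rest = (\<Union>q \<in> {q. f \<notin> unit_square q}. square_vertices h q)"

lemma rest_sub: "v \<in> rest \<Longrightarrow> \<exists>q. f \<notin> unit_square q \<and> v \<subseteq> unit_square q"
  by (auto simp: rest_def square_vertices_def split: if_splits simp del: unit_square.simps)

lemma opposite_in: "z \<in> unit_square q \<Longrightarrow> opposite_corner q z \<in> unit_square q"
  by (cases q; cases z) auto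

lemma rest_new: "rest = (\<Union>q \<in> {q. f \<notin> unit_square q}. square_vertices h' q)"
proof -
  have "square_vertices h q = square_vertices h' q" if "f \<notin> unit_square q" for q
  proof -
    have "h z = h' z" if "z \<in> unit_square q" for z using that \<open>f \<notin> unit_square q\<close> by (cases "z = f") auto
    then have *: "h (opposite_corner q z) = h z \<longleftrightarrow> h' (opposite_corner q z) = h' z" if "z \<in> unit_square q" for z
      using that opposite_in[OF that] by simp
    have "{unit_square q - {z} | z. z \<in> unit_square q \<and> h (opposite_corner q z) \<noteq> h z} =
        {unit_square q - {z} | z. z \<in> unit_square q \<and> h' (opposite_corner q z) \<noteq> h' z}"
      using * by blast
    then show ?thesis unfolding square_vertices_def using * by simp
  qed
  then show ?thesis by (simp add: rest_def)
qed

lemma UN_if: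
  fixes x y :: "'a \<Rightarrow> 'b"
  shows "(\<Union>z\<in>D. {x z} \<union> (if P z then {y z} else {})) = x ` D \<union> y ` {z \<in> D. P z}"
  by (auto split: if_splits)

lemma cw_vertices_squares:
  "cw_vertices g = (\<Union>q \<in> {q. f \<notin> unit_square q}. square_vertices g q) \<union> (\<Union>\<delta>\<in>dirs. square_vertices g (square_base f \<delta>))"
proof -
  have "f \<in> unit_square q \<Longrightarrow> \<exists>\<delta>\<in>dirs. q = square_base f \<delta>" for q using square_base_ex by blast
  then show ?thesis unfolding cw_vertices_def by blast
qed

lemma cw_vertices_old:
  "cw_vertices h = rest \<union> A ` dirs \<union> outer f ` {\<delta>\<in>dirs. h (f + \<delta> + rot \<delta>) \<noteq> h f}"
proof -
  have "square_vertices h (square_base f \<delta>) = {A \<delta>} \<union> (if h (f + \<delta> + rot \<delta>) \<noteq> h f then {outer f \<delta>} else {})"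
    if "\<delta> \<in> dirs" for \<delta>
    using that nbr[of \<delta>] nbr[of "rot \<delta>"] by (simp add: square_vertices_base A_eq square_def outer_def)
  then have "(\<Union>\<delta>\<in>dirs. square_vertices h (square_base f \<delta>)) =
      A ` dirs \<union> outer f ` {\<delta>\<in>dirs. h (f + \<delta> + rot \<delta>) \<noteq> h f}"
    by (simp only: UN_if cong: SUP_cong)
  then show ?thesis unfolding cw_vertices_squares rest_def[symmetric] by (simp add: Un_assoc)
qed

lemma cw_vertices_new:
  "cw_vertices h' = rest \<union> A' ` dirs \<union> outer f ` {\<delta>\<in>dirs. h (f + \<delta> + rot \<delta>) = h f}"
proof -
  have "square_vertices h' (square_base f \<delta>) = {A' \<delta>} \<union> (if h (f + \<delta> + rot \<delta>) = h f then {outer f \<delta>} else {})"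
    if "\<delta> \<in> dirs" for \<delta>
    using that diag[of \<delta>] by (auto simp: new.square_vertices_base A'_eq square_def outer_def)
  then have "(\<Union>\<delta>\<in>dirs. square_vertices h' (square_base f \<delta>)) =
      A' ` dirs \<union> outer f ` {\<delta>\<in>dirs. h (f + \<delta> + rot \<delta>) = h f}"
    by (simp only: UN_if cong: SUP_cong)
  then show ?thesis unfolding cw_vertices_squares rest_new[symmetric] by (simp add: Un_assoc)
qed

definition Base :: "cw_vertex set" where "Base = {v \<in> rest. v \<inter> II \<noteq> {}}"

lemma outer_live: "\<delta> \<in> dirs \<Longrightarrow> outer f \<delta> \<inter> II \<noteq> {} \<longleftrightarrow> \<delta> \<in> live"
  using diag_live[of \<delta>] by (auto simp: outer_def live_def)

lemma VV_old: "VV = Base \<union> A ` dirs \<union> outer f ` BB"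
proof -
  have "A \<delta> \<inter> II \<noteq> {}" if "\<delta> \<in> dirs" for \<delta> using corner_mem(1)[OF that] f_int by blast
  then show ?thesis
    unfolding cw_vertices_old Base_def BB_def using outer_live live_dirs by blast
qed

lemma VV_new: "new.VV = Base \<union> A' ` (TT \<union> BB) \<union> outer f ` TT"
proof -
  have fr: "f \<notin> v" if "v \<in> rest" for v using rest_sub[OF that] by blast
  have out: "outer f \<delta> \<inter> new.II = outer f \<delta> \<inter> II" if "\<delta> \<in> dirs" for \<delta>
  proof -
    have "f \<notin> outer f \<delta>" using square_distinct[OF that] by (simp add: outer_def add.assoc)
    then have "x \<in> new.II \<longleftrightarrow> x \<in> II" if "x \<in> outer f \<delta>" for x using new_II(1)[of x] that by metis
    then show ?thesis by blast
  qed
  have "A' \<delta> \<inter> new.II \<noteq> {} \<longleftrightarrow> \<delta> \<in> live" if d: "\<delta> \<in> dirs" for \<delta>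
  proof (cases "f \<in> new.II")
    case True
    then show ?thesis using live_new new.corner_mem(1)[OF d] d by blast
  next
    case False
    have "{f + \<delta>, f + rot \<delta>} \<subseteq> A' \<delta>" "A' \<delta> \<subseteq> insert f (outer f \<delta>)"
      unfolding A'_eq[OF d] by (auto simp: square_def outer_def)
    moreover have "{f + \<delta>, f + rot \<delta>} \<inter> new.II \<noteq> {} \<longleftrightarrow> \<delta> \<in> live"
      using new_II(1)[OF nbr_ne(1)[OF d]] new_II(1)[OF nbr_ne(3)[OF d]] d by (auto simp: live_def)
    ultimately show ?thesis using False out[OF d] outer_live[OF d] by blast
  qed
  then have "{v \<in> A' ` dirs. v \<inter> new.II \<noteq> {}} = A' ` live"
    using live_dirs by auto
  moreover have "{v \<in> outer f ` {\<delta>\<in>dirs. h (f + \<delta> + rot \<delta>) = h f}. v \<inter> new.II \<noteq> {}} = outer f ` TT"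
  proof -
    have "outer f \<delta> \<inter> new.II \<noteq> {} \<longleftrightarrow> \<delta> \<in> live" if "\<delta> \<in> dirs" for \<delta>
      using out[OF that] outer_live[OF that] by simp
    then have "{\<delta> \<in> {\<delta>\<in>dirs. h (f + \<delta> + rot \<delta>) = h f}. outer f \<delta> \<inter> new.II \<noteq> {}} = TT"
      using live_dirs unfolding TT_def by blast
    then show ?thesis by blast
  qed
  moreover have "{v \<in> rest. v \<inter> new.II \<noteq> {}} = Base"
  proof -
    have "v \<inter> new.II = v \<inter> II" if "v \<in> rest" for v
    proof -
      have "x \<in> new.II \<longleftrightarrow> x \<in> II" if "x \<in> v" for x
        using fr[OF \<open>v \<in> rest\<close>] that by (intro new_II(1)) auto
      then show ?thesis by blast
    qed
    then show ?thesis unfolding Base_def by auto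
  qed
  moreover have "new.VV = {v \<in> rest. v \<inter> new.II \<noteq> {}} \<union> {v \<in> A' ` dirs. v \<inter> new.II \<noteq> {}} \<union>
      {v \<in> outer f ` {\<delta>\<in>dirs. h (f + \<delta> + rot \<delta>) = h f}. v \<inter> new.II \<noteq> {}}"
    unfolding cw_vertices_new by blast
  ultimately show ?thesis by (simp only: live_split(1))
qed

end

text \<open>Only pairs of consecutive corners within \<open>S\<close> enter. This matters after a
  flip, when an inner edge that has left the graph has edge weight 0 but still a pair
  weight.\<close>

lemma quad_poly_cong:
  assumes "\<And>\<delta>. \<delta> \<in> S \<Longrightarrow> rot \<delta> \<in> S \<Longrightarrow> \<alpha> \<delta> = \<beta> \<delta>"
  shows "quad_poly \<alpha> S = quad_poly \<beta> S"
proof (cases "S = dirs")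
  case True
  have "\<alpha> \<delta> = \<beta> \<delta>" if "\<delta> \<in> dirs" for \<delta> using assms[of \<delta>] that True by simp
  then have "\<alpha> dE = \<beta> dE" "\<alpha> dN = \<beta> dN" "\<alpha> dW = \<beta> dW" "\<alpha> dS = \<beta> dS" by (simp_all add: dirs_def)
  then show ?thesis unfolding True quad_poly_simps by simp
next
  case False
  have "(\<Sum>\<delta> | \<delta> \<in> S \<and> rot \<delta> \<in> S. \<alpha> \<delta>) = (\<Sum>\<delta> | \<delta> \<in> S \<and> rot \<delta> \<in> S. \<beta> \<delta>)"
    by (rule sum.cong) (use assms in auto)
  then show ?thesis using False by (simp only: quad_poly_def if_False)
qed

context flip
begin

lemma dirs_in: "dE \<in> dirs" "dN \<in> dirs" "dW \<in> dirs" "dS \<in> dirs"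
  by (simp_all add: dirs_def)

lemma edge_weight_nbr:
  assumes "\<delta> \<in> dirs"
  shows "edge_weight h II a {f, f + rot \<delta>} = pair_weight h a {f, f + rot \<delta>}"
  using f_int nbr_ne(3)[OF assms] by (simp add: edge_weight_def card_insert_if)

lemma edge_weight_nbr_new:
  assumes "\<delta> \<in> dirs" "f \<in> new.II \<or> f + rot \<delta> \<in> II"
  shows "edge_weight h' new.II a {f, f + rot \<delta>} = pair_weight h' a {f, f + rot \<delta>}"
  using assms(2) new_II(1)[OF nbr_ne(3)[OF assms(1)]] nbr_ne(3)[OF assms(1)]
  by (auto simp: edge_weight_def card_insert_if)

lemma pair_diag_ne: "\<delta> \<in> dirs \<Longrightarrow> f + \<delta> \<noteq> f + rot \<delta>"
  using square_distinct(3) by simp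

lemma pair_weight_away:
  assumes "f \<notin> s" "\<And>g. g \<noteq> f \<Longrightarrow> a g = a' g"
  shows "pair_weight h' a' s = pair_weight h a s"
  unfolding pair_weight_def
proof (intro sum.cong refl)
  fix g assume g: "g \<in> s"
  have ne: "x \<noteq> f" if "x \<in> s" for x using that assms(1) by blast
  have "source_sign h' g g' = source_sign h g g'" if "g' \<in> s" for g'
    using ne[OF g] ne[OF that] by (simp add: source_sign_def)
  then have "(\<Prod>g'\<in>s - {g}. source_sign h' g g') = (\<Prod>g'\<in>s - {g}. source_sign h g g')"
    by (intro prod.cong) auto
  then show "(\<Prod>g'\<in>s - {g}. source_sign h' g g') * a' g = (\<Prod>g'\<in>s - {g}. source_sign h g g') * a g"
    using assms(2)[OF ne[OF g]] by simp
qed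

lemma edge_weight_away:
  assumes "f \<notin> s" "\<And>g. g \<noteq> f \<Longrightarrow> a g = a' g"
  shows "edge_weight h' new.II a' s = edge_weight h II a s"
proof -
  have "s \<inter> new.II = s \<inter> II"
  proof -
    have "x \<in> new.II \<longleftrightarrow> x \<in> II" if "x \<in> s" for x using that assms(1) by (intro new_II(1)) auto
    then show ?thesis by blast
  qed
  then show ?thesis unfolding edge_weight_def by (simp add: pair_weight_away[OF assms])
qed

lemma edge_weight_leg:
  assumes "\<delta> \<in> live"
  shows "edge_weight h II a {f + \<delta>, f + rot \<delta>} = pair_weight h a {f + \<delta>, f + rot \<delta>}"
  using assms pair_diag_ne[of \<delta>] by (auto simp: edge_weight_def live_def card_insert_if)

lemma Base_sub: "v \<in> Base \<Longrightarrow> f \<notin> v"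
  using rest_sub by (auto simp: Base_def)

lemma Base_diag: "v \<in> Base \<Longrightarrow> \<delta> \<in> dirs \<Longrightarrow> \<not> {f + \<delta>, f + rot \<delta>} \<subseteq> v"
  using rest_sub[of v] diagonal_square[of \<delta> f] unfolding Base_def by blast

lemma finite_Base: "finite Base"
  by (rule finite_subset[OF _ finite_VV]) (auto simp: VV_old)

lemma star_old: "face_star f A dirs TT BB (dirs - live) Base (edge_weight h II a)"
proof
  show "{f, f + \<delta>, f + rot \<delta>} \<subseteq> A \<delta> \<and> A \<delta> \<subseteq> square f \<delta>" if "\<delta> \<in> dirs" for \<delta>
    using A_eq[OF that] by (auto simp: square_def)
  show "A \<delta> = square f \<delta>" if "\<delta> \<in> TT" for \<delta> using that A_eq[of \<delta>] live_dirs by (auto simp: TT_def)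
  show "A \<delta> = {f, f + \<delta>, f + rot \<delta>}" if "\<delta> \<in> BB" for \<delta> using that A_eq[of \<delta>] live_dirs by (auto simp: BB_def)
  show "edge_weight h II a s = 0" if "\<delta> \<in> dirs - live" "s \<subseteq> outer f \<delta>" for \<delta> s
    using that outer_live[of \<delta>] unfolding edge_weight_def by auto
qed (use live_split live_dirs finite_Base Base_sub Base_diag in \<open>auto simp: edge_weight_def\<close>)

text \<open>Crosses and wrenches have changed places. The set \<open>C\<close> is empty, because
  after the flip every corner in the graph is live.\<close>

lemma star_new: "face_star f A' (TT \<union> BB) BB TT {} Base (edge_weight h' new.II a)"
proof
  have TB: "\<delta> \<in> dirs" if "\<delta> \<in> TT \<union> BB" for \<delta> using that live_split live_dirs by auto
  show "{f, f + \<delta>, f + rot \<delta>} \<subseteq> A' \<delta> \<and> A' \<delta> \<subseteq> square f \<delta>" if "\<delta> \<in> TT \<union> BB" for \<delta>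
    using A'_eq[OF TB[OF that]] by (auto simp: square_def)
  show "A' \<delta> = square f \<delta>" if "\<delta> \<in> BB" for \<delta> using that A'_eq[of \<delta>] TB by (auto simp: BB_def)
  show "A' \<delta> = {f, f + \<delta>, f + rot \<delta>}" if "\<delta> \<in> TT" for \<delta> using that A'_eq[of \<delta>] TB by (auto simp: TT_def)
qed (use live_split live_dirs finite_Base Base_sub Base_diag in \<open>auto simp: edge_weight_def\<close>)

lemma expansion_old:
  "dimer_Z GG a canonical_orientation = (\<Sum>S | dirs - live \<subseteq> S \<and> S \<subseteq> dirs.
     quad_poly (\<lambda>\<delta>. pair_weight h a {f, f + rot \<delta>}) S * (\<Prod>\<delta>\<in>BB - S. pair_weight h a {f + \<delta>, f + rot \<delta>}) *
     hafnian (Base \<union> outer f ` (TT - S) \<union> outer f ` (BB \<inter> S)) (\<lambda>e. edge_weight h II a (\<Inter>e)))"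
proof -
  interpret S: face_star f A dirs TT BB "dirs - live" Base "edge_weight h II a" by (rule star_old)
  have c: "S.cw = (\<lambda>e. edge_weight h II a (\<Inter>e))" by (simp add: S.cw_def fun_eq_iff)
  have q: "quad_poly (\<lambda>\<delta>. edge_weight h II a {f, f + rot \<delta>}) S = quad_poly (\<lambda>\<delta>. pair_weight h a {f, f + rot \<delta>}) S"
    if "S \<subseteq> dirs" for S
    using that edge_weight_nbr by (intro quad_poly_cong) blast
  have l: "(\<Prod>\<delta>\<in>BB - S. edge_weight h II a {f + \<delta>, f + rot \<delta>}) = (\<Prod>\<delta>\<in>BB - S. pair_weight h a {f + \<delta>, f + rot \<delta>})" for S
    using edge_weight_leg live_split by (intro prod.cong) auto
  show ?thesis
    unfolding dimer_Z_canonical VV_old S.V_def[symmetric] c[symmetric] S.expansion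
    by (intro sum.cong refl) (simp add: S.hafnian_inner q l)
qed

lemma expansion_new:
  "dimer_Z new.GG a new.canonical_orientation = (\<Sum>S | S \<subseteq> live.
     quad_poly (\<lambda>\<delta>. pair_weight h' a {f, f + rot \<delta>}) S * (\<Prod>\<delta>\<in>TT - S. pair_weight h' a {f + \<delta>, f + rot \<delta>}) *
     hafnian (Base \<union> outer f ` (BB - S) \<union> outer f ` (TT \<inter> S)) (\<lambda>e. edge_weight h' new.II a (\<Inter>e)))"
proof -
  interpret S: face_star f A' "TT \<union> BB" BB TT "{}" Base "edge_weight h' new.II a" by (rule star_new)
  have c: "S.cw = (\<lambda>e. edge_weight h' new.II a (\<Inter>e))" by (simp add: S.cw_def fun_eq_iff)
  \<comment> \<open>Otherwise \<open>f\<close> has left the cone, and the internal faces making both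
    corners live are \<open>f + \<delta>\<close> and \<open>f - \<delta>\<close>. Both would be
    nearer to the apex than \<open>f\<close>, which is impossible for opposite neighbours.\<close>
  have in_new: "f \<in> new.II \<or> f + rot \<delta> \<in> II" if d: "\<delta> \<in> live" "rot \<delta> \<in> live" for \<delta>
  proof (rule ccontr)
    assume n: "\<not> (f \<in> new.II \<or> f + rot \<delta> \<in> II)"
    have dd: "\<delta> \<in> dirs" using d live_dirs by auto
    have "f + \<delta> \<in> II" "f + - \<delta> \<in> II" using d n by (auto simp: live_def)
    then have "dist1 (f + \<delta>) = dist1 f - 1" "dist1 (f + - \<delta>) = dist1 f - 1"
      using old_new[of \<delta>] old_new[of "- \<delta>"] n dd by auto
    then show False using dist1_opposite[OF dd] by simp
  qed
  have q: "quad_poly (\<lambda>\<delta>. edge_weight h' new.II a {f, f + rot \<delta>}) S = quad_poly (\<lambda>\<delta>. pair_weight h' a {f, f + rot \<delta>}) S"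
    if S: "S \<subseteq> live" for S
  proof -
    have 1: "edge_weight h' new.II a {f, f + rot \<delta>} = pair_weight h' a {f, f + rot \<delta>}" if "\<delta> \<in> S" "rot \<delta> \<in> S" for \<delta>
      using edge_weight_nbr_new[of \<delta> a] in_new[of \<delta>] that S live_dirs by blast
    show ?thesis by (rule quad_poly_cong) (rule 1)
  qed
  have l: "(\<Prod>\<delta>\<in>TT - S. edge_weight h' new.II a {f + \<delta>, f + rot \<delta>}) = (\<Prod>\<delta>\<in>TT - S. pair_weight h' a {f + \<delta>, f + rot \<delta>})" for S
  proof (intro prod.cong refl)
    fix \<delta> assume "\<delta> \<in> TT - S"
    then have d: "\<delta> \<in> live" "\<delta> \<in> dirs" using live_split live_dirs by auto
    have nf: "f \<notin> {f + \<delta>, f + rot \<delta>}" using square_distinct[OF d(2)] by simp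
    show "edge_weight h' new.II a {f + \<delta>, f + rot \<delta>} = pair_weight h' a {f + \<delta>, f + rot \<delta>}"
      unfolding edge_weight_away[OF nf refl] pair_weight_away[OF nf refl] by (rule edge_weight_leg[OF d(1)])
  qed
  show ?thesis
    unfolding new.dimer_Z_canonical VV_new S.V_def[symmetric] c[symmetric] S.expansion
    by (intro sum.cong) (auto simp: S.hafnian_inner q l live_split(1))
qed

text \<open>The flip reverses the order of heights between \<open>f\<close> and its neighbours.
  Heights decide the sign only for faces lying side by side, so just the weights to the east and
  west change sign.\<close>

lemma pair_weight_values:
  shows "pair_weight h a {f, f + dN} = a f - a (f + dN)" "pair_weight h a {f, f + dS} = a (f + dS) - a f"
    "pair_weight h a {f, f + dE} = a f - a (f + dE)" "pair_weight h a {f, f + dW} = a f - a (f + dW)"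
    "pair_weight h' a {f, f + dN} = a f - a (f + dN)" "pair_weight h' a {f, f + dS} = a (f + dS) - a f"
    "pair_weight h' a {f, f + dE} = a (f + dE) - a f" "pair_weight h' a {f, f + dW} = a (f + dW) - a f"
    "pair_weight h a {f + dE, f + dN} = a (f + dE) - a (f + dN)"
    "pair_weight h a {f + dN, f + dW} = a (f + dW) - a (f + dN)"
    "pair_weight h a {f + dW, f + dS} = a (f + dS) - a (f + dW)"
    "pair_weight h a {f + dS, f + dE} = a (f + dS) - a (f + dE)"
proof -
  have ne: "f \<noteq> f + dN" "f \<noteq> f + dS" "f \<noteq> f + dE" "f \<noteq> f + dW"
    "f + dE \<noteq> f + dN" "f + dN \<noteq> f + dW" "f + dW \<noteq> f + dS" "f + dS \<noteq> f + dE"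
    by (simp_all add: prod_eq_iff)
  have hs: "h (f + dN) = h f + 1" "h (f + dS) = h f + 1" "h (f + dE) = h f + 1" "h (f + dW) = h f + 1"
    using nbr dirs_in by auto
  have hs': "h' (f + dN) = h f + 1" "h' (f + dS) = h f + 1" "h' (f + dE) = h f + 1" "h' (f + dW) = h f + 1"
    using new_nbr(1) dirs_in by auto
  show "pair_weight h a {f, f + dN} = a f - a (f + dN)" "pair_weight h a {f, f + dS} = a (f + dS) - a f"
    "pair_weight h a {f, f + dE} = a f - a (f + dE)" "pair_weight h a {f, f + dW} = a f - a (f + dW)"
    "pair_weight h a {f + dE, f + dN} = a (f + dE) - a (f + dN)"
    "pair_weight h a {f + dN, f + dW} = a (f + dW) - a (f + dN)"
    "pair_weight h a {f + dW, f + dS} = a (f + dS) - a (f + dW)"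
    "pair_weight h a {f + dS, f + dE} = a (f + dS) - a (f + dE)"
    unfolding pair_weight_pair[OF ne(1)] pair_weight_pair[OF ne(2)] pair_weight_pair[OF ne(3)] pair_weight_pair[OF ne(4)]
      pair_weight_pair[OF ne(5)] pair_weight_pair[OF ne(6)] pair_weight_pair[OF ne(7)] pair_weight_pair[OF ne(8)]
    by (simp_all add: source_sign_def hs)
  show "pair_weight h' a {f, f + dN} = a f - a (f + dN)" "pair_weight h' a {f, f + dS} = a (f + dS) - a f"
    "pair_weight h' a {f, f + dE} = a (f + dE) - a f" "pair_weight h' a {f, f + dW} = a (f + dW) - a f"
    unfolding pair_weight_pair[OF ne(1)] pair_weight_pair[OF ne(2)] pair_weight_pair[OF ne(3)] pair_weight_pair[OF ne(4)]
    by (simp_all add: source_sign_def hs')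
qed

text \<open>Term by term: the term of \<open>S\<close> before the flip corresponds to the term of
  \<open>dirs - S\<close> after it. The hafnians coincide, and the coefficients have the common
  ratio of \<open>quad_flip\<close>. The condition that \<open>S\<close> contains all corners that
  are not live becomes the condition that its complement is live.\<close>

lemma dimer_Z_flip:
  fixes a :: "face \<Rightarrow> complex" and w' :: complex
  defines "a' \<equiv> a(f := w')"
  assumes skp: "(a f - a (f + dN)) * (a (f + dW) - w') * (a (f + dS) - a (f + dE)) /
    ((a (f + dN) - a (f + dW)) * (w' - a (f + dS)) * (a (f + dE) - a f)) = -1"
  shows "dimer_Z GG a canonical_orientation =
    flip_ratio TT (a f) w' (a (f + dE)) (a (f + dN)) (a (f + dW)) (a (f + dS)) * dimer_Z new.GG a' new.canonical_orientation"
proof -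
  let ?r = "flip_ratio TT (a f) w' (a (f + dE)) (a (f + dN)) (a (f + dW)) (a (f + dS))"
  define \<alpha> where "\<alpha> \<delta> = pair_weight h a {f, f + rot \<delta>}" for \<delta>
  define \<alpha>' where "\<alpha>' \<delta> = pair_weight h' a' {f, f + rot \<delta>}" for \<delta>
  define l where "l \<delta> = pair_weight h a {f + \<delta>, f + rot \<delta>}" for \<delta>
  have a': "a' f = w'" "\<And>g. g \<noteq> f \<Longrightarrow> a g = a' g" by (simp_all add: a'_def)
  have a'n: "a' (f + dN) = a (f + dN)" "a' (f + dS) = a (f + dS)" "a' (f + dE) = a (f + dE)" "a' (f + dW) = a (f + dW)"
    using nbr_ne(1) dirs_in by (simp_all add: a'_def)
  have l': "pair_weight h' a' {f + \<delta>, f + rot \<delta>} = l \<delta>" if "\<delta> \<in> dirs" for \<delta>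
    unfolding l_def by (rule pair_weight_away) (use square_distinct[OF that] a'(2) in auto)
  \<comment> \<open>Neither the vertices in this hafnian nor their common faces involve
    \<open>f\<close>, so the new height and the new weight of \<open>f\<close> are not seen.\<close>
  have H: "hafnian (Base \<union> outer f ` (TT - S) \<union> outer f ` (BB \<inter> S)) (\<lambda>e. edge_weight h II a (\<Inter>e)) =
      hafnian (Base \<union> outer f ` (BB - (dirs - S)) \<union> outer f ` (TT \<inter> (dirs - S))) (\<lambda>e. edge_weight h' new.II a' (\<Inter>e))"
    if S: "S \<subseteq> dirs" for S
  proof -
    have eq: "Base \<union> outer f ` (BB - (dirs - S)) \<union> outer f ` (TT \<inter> (dirs - S)) =
        Base \<union> outer f ` (TT - S) \<union> outer f ` (BB \<inter> S)"
    proof -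
      have "BB - (dirs - S) = BB \<inter> S" "TT \<inter> (dirs - S) = TT - S" using live_split live_dirs by auto
      then show ?thesis by auto
    qed
    show ?thesis
      unfolding eq
    proof (rule hafnian_cong)
      fix u v assume "u \<in> Base \<union> outer f ` (TT - S) \<union> outer f ` (BB \<inter> S)"
      moreover have "f \<notin> outer f \<delta>" if "\<delta> \<in> TT \<union> BB" for \<delta>
        using that live_split live_dirs square_distinct[of \<delta>] by (auto simp: outer_def add.assoc)
      ultimately have "f \<notin> u" using Base_sub by blast
      then show "edge_weight h II a (\<Inter>{u, v}) = edge_weight h' new.II a' (\<Inter>{u, v})"
        by (intro edge_weight_away[symmetric] a') auto
    qed
  qed
  have quad: "quad_poly \<alpha> S * (\<Prod>\<delta>\<in>BB - S. l \<delta>) = ?r * (quad_poly \<alpha>' (dirs - S) * (\<Prod>\<delta>\<in>TT - (dirs - S). l \<delta>))"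
    if S: "dirs - live \<subseteq> S" "S \<subseteq> dirs" for S
  proof -
    have r: "rot dE = dN" "rot dN = dW" "rot dW = dS" "rot dS = dE" by simp_all
    have "(\<Prod>\<delta>\<in>BB - S. l \<delta>) = (\<Prod>\<delta>\<in>dirs - S. if \<delta> \<in> TT then 1 else l \<delta>)"
      using S live_split live_dirs by (intro prod.mono_neutral_cong_left) auto
    moreover have "(\<Prod>\<delta>\<in>TT - (dirs - S). l \<delta>) = (\<Prod>\<delta>\<in>S. if \<delta> \<in> TT then l \<delta> else 1)"
      using S live_split live_dirs finite_subset[OF S(2) finite_dirs] by (intro prod.mono_neutral_cong_left) auto
    moreover have "TT \<subseteq> dirs" using live_split live_dirs by auto
    ultimately show ?thesis
      using quad_flip[OF skp, of l \<alpha> \<alpha>' TT S] TT_last S(2)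
      unfolding l_def \<alpha>_def \<alpha>'_def r pair_weight_values a' a'n by simp
  qed
  have "dimer_Z GG a canonical_orientation = (\<Sum>S | dirs - live \<subseteq> S \<and> S \<subseteq> dirs. ?r *
      (quad_poly \<alpha>' (dirs - S) * (\<Prod>\<delta>\<in>TT - (dirs - S). l \<delta>) *
       hafnian (Base \<union> outer f ` (BB - (dirs - S)) \<union> outer f ` (TT \<inter> (dirs - S))) (\<lambda>e. edge_weight h' new.II a' (\<Inter>e))))"
    unfolding expansion_old \<alpha>_def[symmetric] l_def[symmetric]
  proof (intro sum.cong refl)
    fix S assume "S \<in> {S. dirs - live \<subseteq> S \<and> S \<subseteq> dirs}"
    then have S: "dirs - live \<subseteq> S" "S \<subseteq> dirs" by auto
    show "quad_poly \<alpha> S * (\<Prod>\<delta>\<in>BB - S. l \<delta>) *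
        hafnian (Base \<union> outer f ` (TT - S) \<union> outer f ` (BB \<inter> S)) (\<lambda>e. edge_weight h II a (\<Inter>e)) =
      ?r * (quad_poly \<alpha>' (dirs - S) * (\<Prod>\<delta>\<in>TT - (dirs - S). l \<delta>) *
        hafnian (Base \<union> outer f ` (BB - (dirs - S)) \<union> outer f ` (TT \<inter> (dirs - S))) (\<lambda>e. edge_weight h' new.II a' (\<Inter>e)))"
      unfolding quad[OF S] H[OF S(2)] by (simp only: mult.assoc)
  qed
  also have "\<dots> = (\<Sum>S | S \<subseteq> live. ?r * (quad_poly \<alpha>' S * (\<Prod>\<delta>\<in>TT - S. l \<delta>) *
       hafnian (Base \<union> outer f ` (BB - S) \<union> outer f ` (TT \<inter> S)) (\<lambda>e. edge_weight h' new.II a' (\<Inter>e))))"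
    by (rule sum.reindex_bij_witness[where i = "\<lambda>S. dirs - S" and j = "\<lambda>S. dirs - S"])
      (use live_dirs in \<open>auto simp: double_diff\<close>)
  also have "\<dots> = ?r * dimer_Z new.GG a' new.canonical_orientation"
    unfolding expansion_new sum_distrib_left[symmetric]
  proof (intro arg_cong[where f = "times ?r"] sum.cong refl)
    fix S
    have "(\<Prod>\<delta>\<in>TT - S. l \<delta>) = (\<Prod>\<delta>\<in>TT - S. pair_weight h' a' {f + \<delta>, f + rot \<delta>})"
      using l' live_split live_dirs by (intro prod.cong) auto
    then show "quad_poly \<alpha>' S * (\<Prod>\<delta>\<in>TT - S. l \<delta>) *
       hafnian (Base \<union> outer f ` (BB - S) \<union> outer f ` (TT \<inter> S)) (\<lambda>e. edge_weight h' new.II a' (\<Inter>e)) =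
      quad_poly (\<lambda>\<delta>. pair_weight h' a' {f, f + rot \<delta>}) S * (\<Prod>\<delta>\<in>TT - S. pair_weight h' a' {f + \<delta>, f + rot \<delta>}) *
       hafnian (Base \<union> outer f ` (BB - S) \<union> outer f ` (TT \<inter> S)) (\<lambda>e. edge_weight h' new.II a' (\<Inter>e))"
      by (simp add: \<alpha>'_def[abs_def])
  qed
  finally show ?thesis .
qed

end

section \<open>The prefactor and the number of vertices under a flip\<close>

context cone
begin

lemma FO_iff:
  "g \<in> FO \<longleftrightarrow> g \<notin> II \<and> (\<exists>\<delta>\<in>dirs. g + \<delta> \<in> II \<or> h (g + rot \<delta>) \<noteq> h (g + \<delta>) \<and> g + \<delta> + rot \<delta> \<in> II)"
proof (cases "g \<in> II")
  case False
  have "face_cycle h g \<inter> EE \<noteq> {} \<longleftrightarrow>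
      (\<exists>\<delta>\<in>dirs. g + \<delta> \<in> II \<or> h (g + rot \<delta>) \<noteq> h (g + \<delta>) \<and> g + \<delta> + rot \<delta> \<in> II)" (is "?L \<longleftrightarrow> ?R")
  proof
    assume ?L
    then obtain e where e: "e \<in> face_cycle h g \<inter> EE" by blast
    show ?R using open_face_edge_cases[OF False e] by cases blast+
  next
    assume ?R
    then obtain \<delta> where d: "\<delta> \<in> dirs" "g + \<delta> \<in> II \<or> h (g + rot \<delta>) \<noteq> h (g + \<delta>) \<and> g + \<delta> + rot \<delta> \<in> II" by blast
    from d(2) show ?L
    proof
      assume "g + \<delta> \<in> II"
      moreover have "cw_right (corner_vertex h (g + \<delta>) (- \<delta>), corner_vertex h g \<delta>) = g + \<delta>"
        using cw_right_neighbours[of "- \<delta>" "g + \<delta>"] d(1) by simp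
      ultimately show ?L
        using face_cycle_neighbour[OF d(1), of g] sub_edge_cycle[OF False face_cycle_neighbour[OF d(1), of g]] by auto
    next
      assume w: "h (g + rot \<delta>) \<noteq> h (g + \<delta>) \<and> g + \<delta> + rot \<delta> \<in> II"
      note fw = face_cycle_wrench[OF d(1) conjunct1[OF w]]
      have "(corner_vertex h (g + rot \<delta>) (- rot \<delta>), corner_vertex h g \<delta>) \<in> EE"
        using sub_edge_cycle[OF False fw] cw_right_wrench(2)[OF d(1) conjunct1[OF w]] w by simp
      then show ?L using fw by blast
    qed
  qed
  then show ?thesis using False open_iff by simp
qed (simp add: open_iff)

lemma prefactor_on:
  assumes "finite X" "II \<union> FO \<subseteq> X"
  shows "ratio_prefactor GG a = (\<Prod>g\<in>X. a g ^ expo g)"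
  unfolding prefactor using assms by (intro prod.mono_neutral_left) (auto simp: expo_def)

end

context flip
begin

lemma diag_corner: "f + - rot \<delta> + rot (- rot \<delta>) = f + \<delta> + - rot \<delta>"
  by (simp add: algebra_simps)

lemma expo_f: "expo f = 1"
proof -
  have e: "{\<delta>\<in>dirs. h (f + rot \<delta>) \<noteq> h (f + \<delta>)} = {}" using nbr rot_in_dirs by auto
  have "card (face_cycle h f) = 4" unfolding card_face_cycle e by simp
  then show ?thesis using f_int by (simp add: expo_def)
qed

lemma new_expo_f: "new.expo f = (if live = {} then 0 else 1)"
proof (cases "f \<in> new.II")
  case True
  have e: "{\<delta>\<in>dirs. h' (f + rot \<delta>) \<noteq> h' (f + \<delta>)} = {}"
  proof -
    have "h' (f + rot \<delta>) = h' (f + \<delta>)" if "\<delta> \<in> dirs" for \<delta> using that by (simp only: new_nbr)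
    then show ?thesis by blast
  qed
  have "card (face_cycle h' f) = 4" unfolding new.card_face_cycle e by simp
  then have "new.expo f = 1" using True by (simp add: new.expo_def)
  moreover have "live \<noteq> {}" using live_new[OF True] by (auto simp: dirs_def)
  ultimately show ?thesis by simp
next
  case False
  have "f \<in> new.FO \<longleftrightarrow> live \<noteq> {}"
  proof -
    have "f \<in> new.FO \<longleftrightarrow> (\<exists>\<delta>\<in>dirs. f + \<delta> \<in> new.II)"
      unfolding new.FO_iff using False by auto
    also have "\<dots> \<longleftrightarrow> (\<exists>\<delta>\<in>dirs. f + \<delta> \<in> II)" using new_II(1) nbr_ne(1) by (metis (no_types))
    also have "\<dots> \<longleftrightarrow> live \<noteq> {}" unfolding live_def by (metis (no_types, lifting) Collect_empty_eq minus_minus rot_in_dirs rot_minus rot_rot)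
    finally show ?thesis .
  qed
  then show ?thesis using False by (simp add: new.expo_def)
qed

lemma expo_far:
  assumes g: "g \<noteq> f" "\<And>\<delta>. \<delta> \<in> dirs \<Longrightarrow> g \<noteq> f + \<delta>"
  shows "new.expo g = expo g"
proof -
  have far: "g + \<delta> \<noteq> f" if "\<delta> \<in> dirs" for \<delta>
    using g(2)[of "- \<delta>"] that by auto
  then have hh: "h' (g + \<delta>) = h (g + \<delta>)" if "\<delta> \<in> dirs" for \<delta> using that by simp
  have "{\<delta>\<in>dirs. h' (g + rot \<delta>) \<noteq> h' (g + \<delta>)} = {\<delta>\<in>dirs. h (g + rot \<delta>) \<noteq> h (g + \<delta>)}"
  proof (rule Collect_cong)
    fix \<delta> show "\<delta> \<in> dirs \<and> h' (g + rot \<delta>) \<noteq> h' (g + \<delta>) \<longleftrightarrow> \<delta> \<in> dirs \<and> h (g + rot \<delta>) \<noteq> h (g + \<delta>)"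
      using hh[of \<delta>] hh[of "rot \<delta>"] rot_in_dirs[of \<delta>] by metis
  qed
  then have c: "card (face_cycle h' g) = card (face_cycle h g)" by (simp add: card_face_cycle new.card_face_cycle)
  have I: "g \<in> new.II \<longleftrightarrow> g \<in> II" by (rule new_II(1)[OF g(1)])
  \<comment> \<open>No wrench borders \<open>f\<close>, since all neighbours of \<open>f\<close>
    have the same height. So \<open>g\<close> does not become or cease to be open through
    \<open>f\<close>.\<close>
  have "g + \<delta> + rot \<delta> \<noteq> f" if d: "\<delta> \<in> dirs" "h (g + rot \<delta>) \<noteq> h (g + \<delta>)" for \<delta>
  proof
    assume "g + \<delta> + rot \<delta> = f"
    then have "g + rot \<delta> = f + - \<delta>" "g + \<delta> = f + - rot \<delta>" by (auto simp: algebra_simps)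
    then show False using nbr[of "- \<delta>"] nbr[of "- rot \<delta>"] d by simp
  qed
  then have "g \<in> new.FO \<longleftrightarrow> g \<in> FO"
    unfolding FO_iff new.FO_iff I using hh far rot_in_dirs new_II(1) by (intro conj_cong refl bex_cong) metis
  then show ?thesis unfolding expo_def new.expo_def c I by simp
qed

text \<open>The squares of \<delta> and \<open>- rot \<delta>\<close> are the two around
  \<open>f\<close> that contain \<open>f + \<delta>\<close>. In each of them, a cross becomes a
  wrench bordering \<open>f + \<delta>\<close>, or such a wrench is contracted to a cross; the
  degree changes by 1 or -1 accordingly, and the exponent by half of the total. A neighbour that is
  not internal has exponent 1 before the flip. It keeps it exactly if one of the two corners is in
  \<open>TT\<close>, and both cannot be.\<close>

lemma expo_nbr:
  assumes d: "\<delta> \<in> dirs"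
  shows "new.expo (f + \<delta>) + 1 = expo (f + \<delta>) + of_bool (\<delta> \<in> TT) + of_bool (- rot \<delta> \<in> TT)"
proof -
  define n where "n = f + \<delta>"
  have nf: "n \<noteq> f" using nbr_ne(1)[OF d] by (simp add: n_def)
  have dd: "- rot \<delta> \<in> dirs" "rot \<delta> \<in> dirs" "- \<delta> \<in> dirs" using d by simp_all
  have dg: "f + - rot \<delta> + rot (- rot \<delta>) = f + \<delta> + - rot \<delta>" by (rule diag_corner)
  have T1: "\<delta> \<in> TT \<longleftrightarrow> (f + \<delta> \<in> II \<or> f + rot \<delta> \<in> II) \<and> h (f + \<delta> + rot \<delta>) = h f"
    using d by (simp add: TT_def live_def)
  have T2: "- rot \<delta> \<in> TT \<longleftrightarrow> (f + \<delta> \<in> II \<or> f + - rot \<delta> \<in> II) \<and> h (f + \<delta> + - rot \<delta>) = h f"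
    using dd(1) unfolding TT_def live_def mem_Collect_eq dg by auto
  have D1: "h (f + \<delta> + rot \<delta>) = h f \<or> h (f + \<delta> + rot \<delta>) = h f + 2" by (rule diag[OF d])
  have D2: "h (f + \<delta> + - rot \<delta>) = h f \<or> h (f + \<delta> + - rot \<delta>) = h f + 2"
    using diag[OF dd(1)] unfolding dg .
  have ne1: "f + \<delta> + rot \<delta> \<noteq> f" by (rule nbr_ne(2)[OF d])
  have ne2: "f + \<delta> + - rot \<delta> \<noteq> f" using nbr_ne(2)[OF dd(1)] unfolding dg .
  have half: "i div 2 + 1 = j div 2 + b + c" if "i + 2 = j + 2 * b + 2 * c" for i j b c :: nat
  proof -
    have "(i + 2) div 2 = (j + (b + c) * 2) div 2" unfolding that by simp
    then show ?thesis by simp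
  qed
  show ?thesis
  proof (cases "n \<in> II")
    case True
    let ?w = "\<lambda>h. {\<epsilon>\<in>dirs. h (n + rot \<epsilon>) \<noteq> h (n + \<epsilon>)}"
    have w_other: "\<epsilon> \<in> ?w h' \<longleftrightarrow> \<epsilon> \<in> ?w h" if "\<epsilon> \<noteq> - \<delta>" "\<epsilon> \<noteq> rot \<delta>" for \<epsilon>
    proof -
      have "n + \<epsilon> \<noteq> f" using that(1) by (auto simp: n_def add.assoc add_eq_0_iff)
      moreover have "n + rot \<epsilon> \<noteq> f"
      proof
        assume "n + rot \<epsilon> = f"
        then have "rot \<epsilon> = - \<delta>" by (auto simp: n_def add.assoc add_eq_0_iff)
        then have "\<epsilon> = rot \<delta>" by (metis minus_minus rot_minus rot_rot)
        then show False using that(2) by simp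
      qed
      ultimately show ?thesis by simp
    qed
    have n1: "n + - \<delta> = f" "n + rot (- \<delta>) = f + \<delta> + - rot \<delta>" "n + rot (rot \<delta>) = f" "n + rot \<delta> = f + \<delta> + rot \<delta>"
      by (simp_all add: n_def)
    have h'd: "h' (f + \<delta> + rot \<delta>) = h (f + \<delta> + rot \<delta>)" "h' (f + \<delta> + - rot \<delta>) = h (f + \<delta> + - rot \<delta>)"
      by (rule h'_simps(2)[OF ne1], rule h'_simps(2)[OF ne2])
    have w: "- \<delta> \<in> ?w h \<longleftrightarrow> h (f + \<delta> + - rot \<delta>) \<noteq> h f" "- \<delta> \<in> ?w h' \<longleftrightarrow> h (f + \<delta> + - rot \<delta>) = h f"
      "rot \<delta> \<in> ?w h \<longleftrightarrow> h (f + \<delta> + rot \<delta>) \<noteq> h f" "rot \<delta> \<in> ?w h' \<longleftrightarrow> h (f + \<delta> + rot \<delta>) = h f"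
      using D1 D2 dd d unfolding mem_Collect_eq n1 h'd h'_simps(1) by auto
    have split: "card (?w g) = card (?w g - {- \<delta>, rot \<delta>}) + of_bool (- \<delta> \<in> ?w g) + of_bool (rot \<delta> \<in> ?w g)" for g
    proof -
      have ne: "- \<delta> \<noteq> rot \<delta>" using d by (auto simp: dirs_def)
      have "card (?w g) = card (?w g - {- \<delta>, rot \<delta>}) + card (?w g \<inter> {- \<delta>, rot \<delta>})"
        by (subst card_Un_disjoint[symmetric]) (auto intro: arg_cong[where f = card])
      moreover have "card (?w g \<inter> {- \<delta>, rot \<delta>}) = of_bool (- \<delta> \<in> ?w g) + of_bool (rot \<delta> \<in> ?w g)"
        using ne by (cases "- \<delta> \<in> ?w g"; cases "rot \<delta> \<in> ?w g"; simp add: Int_insert_right)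
      ultimately show ?thesis by simp
    qed
    define t t' where "t \<longleftrightarrow> h (f + \<delta> + - rot \<delta>) = h f" and "t' \<longleftrightarrow> h (f + \<delta> + rot \<delta>) = h f"
    have t: "- rot \<delta> \<in> TT \<longleftrightarrow> t" "h (f + \<delta> + - rot \<delta>) = h f \<longleftrightarrow> t"
      and t': "\<delta> \<in> TT \<longleftrightarrow> t'" "h (f + \<delta> + rot \<delta>) = h f \<longleftrightarrow> t'"
      using T1 T2 True unfolding t_def t'_def n_def by blast+
    have "?w h' - {- \<delta>, rot \<delta>} = ?w h - {- \<delta>, rot \<delta>}" using w_other by blast
    then have "card (?w h' - {- \<delta>, rot \<delta>}) = card (?w h - {- \<delta>, rot \<delta>})" by (rule arg_cong)
    then have "card (?w h') + of_bool (- \<delta> \<in> ?w h) + of_bool (rot \<delta> \<in> ?w h) =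
        card (?w h) + of_bool (- \<delta> \<in> ?w h') + of_bool (rot \<delta> \<in> ?w h')"
      using split[of h] split[of h'] by linarith
    then have c: "card (?w h') + of_bool (\<not> t) + of_bool (\<not> t') = card (?w h) + of_bool t + of_bool t'"
      unfolding w unfolding t(2) t'(2) .
    have "card (face_cycle h' n) + 2 = card (face_cycle h n) + 2 * of_bool t' + 2 * of_bool t"
      unfolding card_face_cycle new.card_face_cycle using c by (cases t; cases t') simp_all
    then have "card (face_cycle h' n) + 2 = card (face_cycle h n) + 2 * of_bool (\<delta> \<in> TT) + 2 * of_bool (- rot \<delta> \<in> TT)"
      unfolding t(1) t'(1) .
    then have "card (face_cycle h' n) div 2 + 1 = card (face_cycle h n) div 2 + of_bool (\<delta> \<in> TT) + of_bool (- rot \<delta> \<in> TT)"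
      by (rule half)
    moreover have "card (face_cycle h' n) div 2 \<ge> 2" "card (face_cycle h n) div 2 \<ge> 2"
      by (simp_all add: card_face_cycle new.card_face_cycle)
    ultimately show ?thesis
      using True new_II(1)[OF nf] unfolding n_def[symmetric] expo_def new.expo_def by simp
  next
    case False
    have fn: "f \<notin> new.II" using False live_new d nbr[OF d] dist1_step[OF d, of f] unfolding n_def new_II(2) internal_iff by auto
    have nn: "n \<notin> new.II" using False new_II(1)[OF nf] by simp
    have away: "dist1 n = dist1 f + 1"
      using old_new[OF fn d] False dist1_step[OF d, of f] by (auto simp: n_def)
    have "n \<in> FO"
      unfolding FO_iff using False f_int dd(3) by (intro conjI bexI[of _ "- \<delta>"]) (auto simp: n_def)
    then have e: "expo n = 1" using False by (simp add: expo_def)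
    have T1': "\<delta> \<in> TT \<longleftrightarrow> f + rot \<delta> \<in> II \<and> h (f + \<delta> + rot \<delta>) = h f" using T1 False by (simp add: n_def)
    have T2': "- rot \<delta> \<in> TT \<longleftrightarrow> f + - rot \<delta> \<in> II \<and> h (f + \<delta> + - rot \<delta>) = h f" using T2 False by (simp add: n_def)
    have notboth: "\<not> (\<delta> \<in> TT \<and> - rot \<delta> \<in> TT)"
    proof
      assume "\<delta> \<in> TT \<and> - rot \<delta> \<in> TT"
      then have "f + rot \<delta> \<in> II" "f + - rot \<delta> \<in> II" using T1' T2' by auto
      then have "dist1 (f + rot \<delta>) = dist1 f - 1" "dist1 (f + - rot \<delta>) = dist1 f - 1"
        using old_new[OF fn dd(2)] old_new[OF fn dd(1)] by auto
      then show False using dist1_opposite[OF dd(2)] by simp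
    qed
    have n1: "n + - \<delta> = f" "n + - rot \<delta> = f + \<delta> + - rot \<delta>" "n + rot \<delta> = f + \<delta> + rot \<delta>"
      "n + - \<delta> + - rot \<delta> = f + - rot \<delta>" "n + rot \<delta> + - \<delta> = f + rot \<delta>"
      by (simp_all add: n_def algebra_simps)
    have h'd: "h' (f + \<delta> + rot \<delta>) = h (f + \<delta> + rot \<delta>)" "h' (f + \<delta> + - rot \<delta>) = h (f + \<delta> + - rot \<delta>)"
      by (rule h'_simps(2)[OF ne1], rule h'_simps(2)[OF ne2])
    have "n \<in> new.FO \<longleftrightarrow> \<delta> \<in> TT \<or> - rot \<delta> \<in> TT"
    proof
      assume "\<delta> \<in> TT \<or> - rot \<delta> \<in> TT"
      then show "n \<in> new.FO"
      proof
        assume t: "\<delta> \<in> TT"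
        have "f + rot \<delta> \<in> new.II" using T1' t new_II(1)[OF nbr_ne(3)[OF d]] by simp
        moreover have "h' (n + rot (rot \<delta>)) \<noteq> h' (n + rot \<delta>)"
          unfolding rot_rot n1 h'd h'_simps(1) using T1' t by simp
        moreover have "n + rot \<delta> + rot (rot \<delta>) = f + rot \<delta>" using n1(5) by simp
        ultimately have "h' (n + rot (rot \<delta>)) \<noteq> h' (n + rot \<delta>) \<and> n + rot \<delta> + rot (rot \<delta>) \<in> new.II" by (simp only: simp_thms)
        then show ?thesis unfolding new.FO_iff using nn dd(2) by blast
      next
        assume t: "- rot \<delta> \<in> TT"
        have "f + - rot \<delta> \<in> new.II" using T2' t new_II(1)[OF nbr_ne(1)[OF dd(1)]] by simp
        moreover have "h' (n + rot (- \<delta>)) \<noteq> h' (n + - \<delta>)"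
          unfolding rot_minus n1 h'd h'_simps(1) using T2' t by simp
        moreover have "n + - \<delta> + rot (- \<delta>) = f + - rot \<delta>" using n1(4) by simp
        ultimately have "h' (n + rot (- \<delta>)) \<noteq> h' (n + - \<delta>) \<and> n + - \<delta> + rot (- \<delta>) \<in> new.II" by (simp only: simp_thms)
        then show ?thesis unfolding new.FO_iff using nn dd(3) by blast
      qed
    next
      assume "n \<in> new.FO"
      then obtain \<epsilon> where e: "\<epsilon> \<in> dirs"
        "n + \<epsilon> \<in> new.II \<or> h' (n + rot \<epsilon>) \<noteq> h' (n + \<epsilon>) \<and> n + \<epsilon> + rot \<epsilon> \<in> new.II"
        unfolding new.FO_iff by blast
      have na: "dist1 (n + \<delta>) \<noteq> dist1 n - 1"
      proof
        assume "dist1 (n + \<delta>) = dist1 n - 1"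
        then have "dist1 (n + - \<delta>) = dist1 n + 1" by (rule dist1_opposite[OF d])
        then show False using away unfolding n1 by simp
      qed
      from e(2) show "\<delta> \<in> TT \<or> - rot \<delta> \<in> TT"
      proof
        assume i: "n + \<epsilon> \<in> new.II"
        note t = new.neighbour_internal[OF e(1) nn i]
        have hn: "h' (n + \<epsilon>) = h f" using t(2) new_nbr(1)[OF d] by (simp add: n_def)
        have "\<epsilon> \<noteq> \<delta>" using t(1) na by auto
        moreover have "\<epsilon> \<noteq> - \<delta>" using i fn n1(1) by auto
        ultimately have "\<epsilon> = rot \<delta> \<or> \<epsilon> = - rot \<delta>" using dirs_four[OF d e(1)] by blast
        then show ?thesis
        proof
          assume "\<epsilon> = rot \<delta>"
          then have "f + \<delta> + rot \<delta> \<in> II" "h (f + \<delta> + rot \<delta>) = h f"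
            using i hn n1(3) h'd new_II(1)[OF ne1] by auto
          then show ?thesis using diag_live[OF d] by (simp add: TT_def)
        next
          assume "\<epsilon> = - rot \<delta>"
          then have "f + \<delta> + - rot \<delta> \<in> II" "h (f + \<delta> + - rot \<delta>) = h f"
            using i hn n1(2) h'd new_II(1)[OF ne2] by auto
          then have "- rot \<delta> \<in> TT" using diag_live[OF dd(1)] unfolding TT_def mem_Collect_eq dg by blast
          then show ?thesis ..
        qed
      next
        assume i: "h' (n + rot \<epsilon>) \<noteq> h' (n + \<epsilon>) \<and> n + \<epsilon> + rot \<epsilon> \<in> new.II"
        note t = new.diagonal_internal[OF e(1) nn conjunct2[OF i] new.inter_wrench(4)[OF e(1) conjunct1[OF i]]]
        have "\<epsilon> \<noteq> \<delta>" "rot \<epsilon> \<noteq> \<delta>" using t(1,2) na by auto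
        moreover have "rot \<epsilon> = \<delta>" if "\<epsilon> = - rot \<delta>" using that by simp
        ultimately have "\<epsilon> = rot \<delta> \<or> \<epsilon> = - \<delta>" using dirs_four[OF d e(1)] by blast
        then show ?thesis
        proof
          assume eps: "\<epsilon> = rot \<delta>"
          have "f + rot \<delta> \<in> II" "h (f + \<delta> + rot \<delta>) \<noteq> h f + 2"
            using i n1(5) new_II(1)[OF nbr_ne(3)[OF d]] unfolding eps rot_rot n1 h'd h'_simps(1) by auto
          then show ?thesis using T1' D1 by auto
        next
          assume eps: "\<epsilon> = - \<delta>"
          have "f + - rot \<delta> \<in> II" "h (f + \<delta> + - rot \<delta>) \<noteq> h f + 2"
            using i n1(4) new_II(1)[OF nbr_ne(1)[OF dd(1)]] unfolding eps rot_minus n1 h'd h'_simps(1) by auto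
          then show ?thesis using T2' D2 by auto
        qed
      qed
    qed
    then have "new.expo n = of_bool (\<delta> \<in> TT \<or> - rot \<delta> \<in> TT)" using nn by (simp add: new.expo_def)
    then show ?thesis using e notboth unfolding n_def[symmetric] by auto
  qed
qed

text \<open>Each cross in \<open>TT\<close> becomes the two ends of a wrench, each wrench in
  \<open>BB\<close> becomes one cross, and the corners that are not live vanish. Since the fourth
  power of the imaginary unit is 1, only the sign given by the parity of \<open>card TT\<close>
  remains.\<close>

lemma card_VV: "card new.VV + 4 = card VV + 2 * card TT"
proof -
  interpret S: face_star f A dirs TT BB "dirs - live" Base "edge_weight h II (\<lambda>_. 0)" by (rule star_old)
  interpret S': face_star f A' "TT \<union> BB" BB TT "{}" Base "edge_weight h' new.II (\<lambda>_. 0)" by (rule star_new)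
  have c4: "card dirs = 4" by (simp add: dirs_def)
  have oi: "inj_on (outer f) TT" "inj_on (outer f) BB"
    using S.outer_inj inj_on_subset live_split live_dirs by (metis Un_upper1 Un_upper2 subset_trans)+
  have BA: "Base \<inter> A ` dirs = {}" "Base \<inter> A' ` (TT \<union> BB) = {}"
    using Base_sub S.f_in_A S'.f_in_A by blast+
  have BO: "(Base \<union> A ` dirs) \<inter> outer f ` BB = {}" "(Base \<union> A' ` (TT \<union> BB)) \<inter> outer f ` TT = {}"
    using S.outer_notin_Base S.f_notin_outer S.f_in_A S'.f_in_A S.in_dirs by blast+
  have "card VV = card Base + 4 + card BB"
    unfolding VV_old using S.fin finite_Base
    by (simp add: card_Un_disjoint[OF _ _ BO(1)] card_Un_disjoint[OF _ _ BA(1)] card_image oi S.A_inj c4)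
  moreover have "card new.VV = card Base + (card TT + card BB) + card TT"
    unfolding VV_new using S.fin finite_Base live_split(2)
    by (simp add: card_Un_disjoint[OF _ _ BO(2)] card_Un_disjoint[OF _ _ BA(2)] card_image oi S'.A_inj card_Un_disjoint[OF _ _ live_split(2)])
  ultimately show ?thesis by simp
qed

end

section \<open>Solutions without zeros and poles\<close>

text \<open>Inversion turns each difference \<open>x - y\<close> into
  \<open>- (x - y) / (x * y)\<close>. The monomials will be compensated by the prefactor. The
  remaining sign, one for each corner in \<open>T\<close>, will be compensated by the change of the
  number of vertices.\<close>

lemma flip_ratio_inverse:
  fixes b :: "face \<Rightarrow> complex"
  assumes nz: "w \<noteq> 0" "w' \<noteq> 0" "\<And>\<delta>. b \<delta> \<noteq> 0" and T: "T \<subseteq> dirs" "dE \<notin> T"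
  shows "flip_ratio T (inverse w) (inverse w') (inverse (b dE)) (inverse (b dN)) (inverse (b dW)) (inverse (b dS)) *
      (w * (\<Prod>\<delta>\<in>dirs. b \<delta>)) =
    (- 1) ^ card T * flip_ratio T w w' (b dE) (b dN) (b dW) (b dS) * w' * (\<Prod>\<delta>\<in>T. b \<delta> * b (rot \<delta>))"
proof -
  define e n u s where "e = b dE" and "n = b dN" and "u = b dW" and "s = b dS"
  have z: "e \<noteq> 0" "n \<noteq> 0" "u \<noteq> 0" "s \<noteq> 0" using nz by (simp_all add: e_def n_def u_def s_def)
  have iv: "inverse x - inverse y = - ((x - y) / (x * y))" if "x \<noteq> 0" "y \<noteq> 0" for x y :: complex
    using that by (simp add: field_simps)
  define gN gW gS where "gN = (if dN \<in> T then - (n * u) else 1)" and "gW = (if dW \<in> T then - (u * s) else 1)"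
    and "gS = (if dS \<in> T then - (s * e) else 1)"
  define fN fW fS where "fN = (if dN \<in> T then u - n else 1)" and "fW = (if dW \<in> T then 1 else s - u)"
    and "fS = (if dS \<in> T then s - e else 1)"
  have "(- 1) ^ card T * (\<Prod>\<delta>\<in>T. b \<delta> * b (rot \<delta>)) = (\<Prod>\<delta>\<in>T. - (b \<delta> * b (rot \<delta>)))"
    by (simp add: prod.distrib prod_uminus)
  also have "\<dots> = (\<Prod>\<delta>\<in>{dN, dW, dS}. if \<delta> \<in> T then - (b \<delta> * b (rot \<delta>)) else 1)"
  proof -
    have "{dN, dW, dS} \<inter> T = T" using T by (auto simp: dirs_def)
    then show ?thesis using prod.inter_restrict[of "{dN, dW, dS}" "\<lambda>\<delta>. - (b \<delta> * b (rot \<delta>))" T] by simp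
  qed
  also have "\<dots> = gN * gW * gS"
    by (simp add: gN_def gW_def gS_def n_def u_def s_def e_def)
  finally have g: "(- 1) ^ card T * (\<Prod>\<delta>\<in>T. b \<delta> * b (rot \<delta>)) = gN * gW * gS" .
  \<comment> \<open>The monomial \<open>w * e * n * u * s\<close> is distributed over the factors of
    the ratio: \<open>w * n * e\<close> for the part independent of \<open>T\<close>, and
    \<open>u * s\<close> for the west leg.\<close>
  have K: "(inverse w - inverse n) * (inverse s - inverse e) / (inverse s - inverse w') * (w * n * e) =
      - ((w - n) * (s - e) / (s - w') * w')"
    using nz(1,2) z by (simp add: iv)
  have W: "(if dW \<in> T then 1 else inverse s - inverse u) * (u * s) = - (fW * gW)"
    using z by (simp add: iv fW_def gW_def)
  have N: "1 / (if dN \<in> T then inverse u - inverse n else 1) = gN / fN"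
    using z by (simp add: iv fN_def gN_def)
  have S: "1 / (if dS \<in> T then inverse s - inverse e else 1) = gS / fS"
    using z by (simp add: iv fS_def gS_def)
  have p: "(\<Prod>\<delta>\<in>dirs. b \<delta>) = e * n * u * s" by (simp add: dirs_def e_def n_def u_def s_def)
  have "flip_ratio T (inverse w) (inverse w') (inverse e) (inverse n) (inverse u) (inverse s) * (w * (e * n * u * s)) =
    ((inverse w - inverse n) * (inverse s - inverse e) / (inverse s - inverse w') * (w * n * e)) *
    ((if dW \<in> T then 1 else inverse s - inverse u) * (u * s)) *
    ((1 / (if dN \<in> T then inverse u - inverse n else 1)) * (1 / (if dS \<in> T then inverse s - inverse e else 1)))"
    unfolding flip_ratio_def by (simp only: divide_inverse inverse_mult_distrib mult_1_left ac_simps)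
  also have "\<dots> = (gN * gW * gS) * flip_ratio T w w' e n u s * w'"
    unfolding K W N S flip_ratio_def fN_def[symmetric] fW_def[symmetric] fS_def[symmetric]
    by (simp add: divide_inverse ac_simps)
  finally show ?thesis unfolding p g[symmetric] e_def n_def u_def s_def by (simp only: ac_simps)
qed

text \<open>The six points occur once above and once below, so the monomials cancel, and so do the
  three signs on either side. Hence a flip applies to the inverse weights as well.\<close>

lemma skp_inverse:
  fixes w :: complex
  assumes "w \<noteq> 0" "w' \<noteq> 0" "e \<noteq> 0" "n \<noteq> 0" "u \<noteq> 0" "s \<noteq> 0"
  shows "(inverse w - inverse n) * (inverse u - inverse w') * (inverse s - inverse e) /
      ((inverse n - inverse u) * (inverse w' - inverse s) * (inverse e - inverse w)) =
    (w - n) * (u - w') * (s - e) / ((n - u) * (w' - s) * (e - w))"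
proof -
  have iv: "inverse x - inverse y = - ((x - y) / (x * y))" if "x \<noteq> 0" "y \<noteq> 0" for x y :: complex
    using that by (simp add: field_simps)
  show ?thesis using assms by (simp add: iv)
qed

context flip
begin

text \<open>The factor \<open>R\<close> collects the faces other than \<open>f\<close> with their
  new exponents. The product over \<open>TT\<close> restores the exponents of the neighbours
  according to \<open>expo_nbr\<close>, each corner lying beside two of them.\<close>

lemma prefactor_flip:
  fixes a :: "face \<Rightarrow> complex"
  obtains R where
    "ratio_prefactor GG a * (\<Prod>\<delta>\<in>TT. a (f + \<delta>) * a (f + rot \<delta>)) = a f * (\<Prod>\<delta>\<in>dirs. a (f + \<delta>)) * R"
    "ratio_prefactor new.GG (a(f := w')) = w' ^ new.expo f * R"
proof -
  define N where "N = (+) f ` dirs"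
  define X where "X = II \<union> FO \<union> new.II \<union> new.FO \<union> insert f N"
  define R where "R = (\<Prod>g\<in>X - {f}. a g ^ new.expo g)"
  have finX: "finite X"
    unfolding X_def N_def using finite_internal finite_FO new.finite_internal new.finite_FO finite_dirs by simp
  have "f \<notin> N"
  proof
    assume "f \<in> N"
    then obtain \<delta> where "f = f + \<delta>" "\<delta> \<in> dirs" unfolding N_def by (rule imageE)
    then show False using nbr_ne(1)[of \<delta>] by simp
  qed
  then have fX: "f \<in> X" and NX: "N \<subseteq> X - {f}" unfolding X_def by blast+
  have N: "(\<Prod>g\<in>N. F g) = (\<Prod>\<delta>\<in>dirs. F (f + \<delta>))" for F :: "face \<Rightarrow> complex"
    unfolding N_def by (simp add: prod.reindex inj_on_def)
  have T1: "(\<Prod>\<delta>\<in>TT. F \<delta>) = (\<Prod>\<delta>\<in>dirs. F \<delta> ^ of_bool (\<delta> \<in> TT))" for F :: "face \<Rightarrow> complex"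
  proof -
    have "(\<Prod>\<delta>\<in>TT. F \<delta>) = (\<Prod>\<delta>\<in>TT. F \<delta> ^ of_bool (\<delta> \<in> TT))" by (intro prod.cong) simp_all
    also have "\<dots> = (\<Prod>\<delta>\<in>dirs. F \<delta> ^ of_bool (\<delta> \<in> TT))"
      by (rule prod.mono_neutral_left) (auto simp: TT_def live_def finite_dirs)
    finally show ?thesis .
  qed
  have T2: "(\<Prod>\<delta>\<in>TT. a (f + rot \<delta>)) = (\<Prod>\<delta>\<in>dirs. a (f + \<delta>) ^ of_bool (- rot \<delta> \<in> TT))"
    unfolding T1
    by (rule prod.reindex_bij_witness[where i = "\<lambda>\<delta>. - rot \<delta>" and j = rot]) simp_all
  have e: "a (f + \<delta>) ^ expo (f + \<delta>) * (a (f + \<delta>) ^ of_bool (\<delta> \<in> TT) * a (f + \<delta>) ^ of_bool (- rot \<delta> \<in> TT)) =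
      a (f + \<delta>) * a (f + \<delta>) ^ new.expo (f + \<delta>)" if "\<delta> \<in> dirs" for \<delta>
    unfolding power_add[symmetric] power_Suc[symmetric] using expo_nbr[OF that]
    by (intro arg_cong[where f = "\<lambda>m. a (f + \<delta>) ^ m"]) simp
  have "ratio_prefactor GG a = (\<Prod>g\<in>X. a g ^ expo g)"
    by (rule prefactor_on[OF finX]) (auto simp: X_def)
  also have "\<dots> = a f * (\<Prod>g\<in>X - {f}. a g ^ expo g)"
    by (simp add: prod.remove[OF finX fX] expo_f)
  also have "(\<Prod>g\<in>X - {f}. a g ^ expo g) = (\<Prod>g\<in>X - {f} - N. a g ^ expo g) * (\<Prod>\<delta>\<in>dirs. a (f + \<delta>) ^ expo (f + \<delta>))"
    unfolding N[of "\<lambda>g. a g ^ expo g", symmetric] using finX NX by (intro prod.subset_diff) auto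
  also have "(\<Prod>g\<in>X - {f} - N. a g ^ expo g) = (\<Prod>g\<in>X - {f} - N. a g ^ new.expo g)"
  proof (intro prod.cong refl)
    fix g assume "g \<in> X - {f} - N"
    then have "g \<noteq> f" "\<And>\<delta>. \<delta> \<in> dirs \<Longrightarrow> g \<noteq> f + \<delta>" by (auto simp: N_def)
    then have "new.expo g = expo g" by (rule expo_far)
    then show "a g ^ expo g = a g ^ new.expo g" by simp
  qed
  finally have "ratio_prefactor GG a * (\<Prod>\<delta>\<in>TT. a (f + \<delta>) * a (f + rot \<delta>)) =
    a f * (\<Prod>g\<in>X - {f} - N. a g ^ new.expo g) *
    (\<Prod>\<delta>\<in>dirs. a (f + \<delta>) ^ expo (f + \<delta>) * (a (f + \<delta>) ^ of_bool (\<delta> \<in> TT) * a (f + \<delta>) ^ of_bool (- rot \<delta> \<in> TT)))"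
    by (simp only: prod.distrib T2 T1[of "\<lambda>\<delta>. a (f + \<delta>)"] mult_ac)
  also have "(\<Prod>\<delta>\<in>dirs. a (f + \<delta>) ^ expo (f + \<delta>) * (a (f + \<delta>) ^ of_bool (\<delta> \<in> TT) * a (f + \<delta>) ^ of_bool (- rot \<delta> \<in> TT))) =
    (\<Prod>\<delta>\<in>dirs. a (f + \<delta>)) * (\<Prod>\<delta>\<in>dirs. a (f + \<delta>) ^ new.expo (f + \<delta>))"
    unfolding prod.distrib[symmetric] by (rule prod.cong[OF refl e])
  also have "(\<Prod>\<delta>\<in>dirs. a (f + \<delta>) ^ new.expo (f + \<delta>)) = (\<Prod>g\<in>N. a g ^ new.expo g)"
    by (rule N[symmetric])
  also have "a f * (\<Prod>g\<in>X - {f} - N. a g ^ new.expo g) * ((\<Prod>\<delta>\<in>dirs. a (f + \<delta>)) * (\<Prod>g\<in>N. a g ^ new.expo g)) =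
    a f * (\<Prod>\<delta>\<in>dirs. a (f + \<delta>)) * R"
    unfolding R_def using finX NX by (subst prod.subset_diff[of N "X - {f}"]) (auto simp: ac_simps)
  finally have 1: "ratio_prefactor GG a * (\<Prod>\<delta>\<in>TT. a (f + \<delta>) * a (f + rot \<delta>)) = a f * (\<Prod>\<delta>\<in>dirs. a (f + \<delta>)) * R" .
  have "ratio_prefactor new.GG (a(f := w')) = (\<Prod>g\<in>X. (a(f := w')) g ^ new.expo g)"
    by (rule new.prefactor_on[OF finX]) (auto simp: X_def)
  also have "\<dots> = w' ^ new.expo f * R"
    unfolding R_def prod.remove[OF finX fX] by (intro arg_cong2[where f = times] prod.cong) auto
  finally show thesis using 1 that by blast
qed

text \<open>The changes of the prefactor, of the power of the imaginary unit and of the flip ratio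
  combine to the single factor \<open>w'\<close>. As long as \<open>f\<close> stays in the graph,
  the new prefactor contains exactly this factor; it is left over only when \<open>f\<close>
  disappears.\<close>

lemma ratio_flip:
  fixes a :: "face \<Rightarrow> complex" and w' :: complex
  assumes nz: "\<And>g. a g \<noteq> 0" "w' \<noteq> 0"
    and skp: "(a f - a (f + dN)) * (a (f + dW) - w') * (a (f + dS) - a (f + dE)) /
      ((a (f + dN) - a (f + dW)) * (w' - a (f + dS)) * (a (f + dE) - a f)) = -1"
  obtains r where
    "dimer_Z GG a canonical_orientation = r * dimer_Z new.GG (a(f := w')) new.canonical_orientation"
    "\<i> ^ card VV * ratio_prefactor GG a * dimer_Z GG (\<lambda>g. inverse (a g)) canonical_orientation =
      r * (if live = {} then w' else 1) * (\<i> ^ card new.VV * ratio_prefactor new.GG (a(f := w')) *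
        dimer_Z new.GG (\<lambda>g. inverse ((a(f := w')) g)) new.canonical_orientation)"
proof -
  define b where "b \<delta> = a (f + \<delta>)" for \<delta>
  define r where "r = flip_ratio TT (a f) w' (b dE) (b dN) (b dW) (b dS)"
  define r' where "r' = flip_ratio TT (inverse (a f)) (inverse w') (inverse (b dE)) (inverse (b dN)) (inverse (b dW)) (inverse (b dS))"
  define Z where "Z = dimer_Z new.GG (\<lambda>g. inverse ((a(f := w')) g)) new.canonical_orientation"
  define T where "T = (\<Prod>\<delta>\<in>TT. b \<delta> * b (rot \<delta>))"
  define D where "D = (\<Prod>\<delta>\<in>dirs. b \<delta>)"
  have 1: "dimer_Z GG a canonical_orientation = r * dimer_Z new.GG (a(f := w')) new.canonical_orientation"
    unfolding r_def b_def by (rule dimer_Z_flip[OF skp])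
  have inv: "(\<lambda>g. inverse ((a(f := w')) g)) = (\<lambda>g. inverse (a g))(f := inverse w')" by auto
  have 2: "dimer_Z GG (\<lambda>g. inverse (a g)) canonical_orientation = r' * Z"
    unfolding r'_def b_def Z_def inv by (rule dimer_Z_flip) (use skp in \<open>simp only: skp_inverse[OF nz(1) nz(2) nz(1) nz(1) nz(1) nz(1)]\<close>)
  have sub: "TT \<subseteq> dirs" by (auto simp: TT_def live_def)
  have 3: "r' * (a f * D) = (- 1) ^ card TT * r * w' * T"
    unfolding r_def r'_def D_def T_def
    by (rule flip_ratio_inverse) (use nz sub TT_last in \<open>auto simp: b_def\<close>)
  obtain R where R: "ratio_prefactor GG a * T = a f * D * R"
      "ratio_prefactor new.GG (a(f := w')) = w' ^ new.expo f * R"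
    unfolding T_def D_def b_def by (rule prefactor_flip[of a w'])
  have Tnz: "T \<noteq> 0" "a f * D \<noteq> 0"
    using nz finite_subset[OF sub finite_dirs] by (simp_all add: T_def D_def b_def finite_dirs)
  have "ratio_prefactor GG a * r' * T * (a f * D) = (- 1) ^ card TT * r * w' * R * T * (a f * D)"
  proof -
    have "ratio_prefactor GG a * r' * T * (a f * D) = (ratio_prefactor GG a * T) * (r' * (a f * D))"
      by (simp only: ac_simps)
    then show ?thesis unfolding R(1) 3 by (simp only: ac_simps)
  qed
  then have 4: "ratio_prefactor GG a * r' = (- 1) ^ card TT * r * w' * R" using Tnz by simp
  have w: "(if live = {} then w' else 1) * w' ^ new.expo f = w'" by (simp add: new_expo_f)
  \<comment> \<open>The exponent is raised by 4 to match the subtraction-free form of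
    \<open>card_VV\<close>.\<close>
  have "\<i> ^ card new.VV = \<i> ^ (card new.VV + 4)" by (simp add: power_add)
  also have "\<dots> = \<i> ^ card VV * (- 1) ^ card TT" unfolding card_VV by (simp add: power_add power_mult)
  finally have c: "\<i> ^ card new.VV = \<i> ^ card VV * (- 1) ^ card TT" .
  have "\<i> ^ card VV * ratio_prefactor GG a * dimer_Z GG (\<lambda>g. inverse (a g)) canonical_orientation =
      \<i> ^ card VV * (ratio_prefactor GG a * r') * Z"
    unfolding 2 by (simp only: ac_simps)
  also have "\<dots> = r * w' * (\<i> ^ card new.VV * R * Z)" unfolding 4 c by (simp only: ac_simps)
  also have "\<dots> = r * (if live = {} then w' else 1) * (\<i> ^ card new.VV * ratio_prefactor new.GG (a(f := w')) * Z)"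
  proof -
    define c where "c = (if live = {} then w' else 1)"
    have "r * c * (\<i> ^ card new.VV * (w' ^ new.expo f * R) * Z) = r * (c * w' ^ new.expo f) * (\<i> ^ card new.VV * R * Z)"
      by (simp only: ac_simps)
    then show ?thesis unfolding R(2) using w unfolding c_def by simp
  qed
  finally show thesis using 1 that unfolding Z_def by blast
qed

text \<open>If no neighbour of \<open>f\<close> is internal, all four are farther from the apex, so
  \<open>f\<close> is the apex itself. All other faces are at least as high as \<open>f\<close> if
  internal, but farther away, so none of them fits below the level \<open>k\<close>.\<close>

lemma live_empty:
  assumes "live = {}"
  shows "f = (px, py)" "h f + 2 = k" "new.II = {}"
proof -
  have no: "f + \<delta> \<notin> II" if "\<delta> \<in> dirs" for \<delta> using assms that unfolding live_def by blast
  have far: "dist1 (f + \<delta>) = dist1 f + 1" if "\<delta> \<in> dirs" for \<delta>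
    using no[OF that] nbr[OF that] dist1_step[OF that, of f] f_int by (auto simp: internal_iff)
  show f: "f = (px, py)"
    using far[OF dirs_in(1)] far[OF dirs_in(2)] far[OF dirs_in(3)] far[OF dirs_in(4)]
    by (cases f) (auto simp: dist1_def)
  have d: "dist1 f = 0" by (simp add: f dist1_def)
  show hf: "h f + 2 = k"
    using no[OF dirs_in(1)] nbr[OF dirs_in(1)] far[OF dirs_in(1)] f_int d unfolding internal_iff internal_iff2[of f] 
    using internal_iff2[of f] f_int by auto
  have "g \<notin> new.II" for g
  proof (cases "g = f")
    case True
    then show ?thesis using new_II(2) hf d by simp
  next
    case False
    have "dist1 g > 0" using False by (cases g) (auto simp: f dist1_def)
    then have "g \<notin> II" using f_min[of g] hf unfolding internal_iff2 by auto
    then show ?thesis using new_II(1)[OF False] by simp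
  qed
  then show "new.II = {}" by blast
qed

end

lemma (in cone) ratio_empty:
  assumes "II = {}"
  shows "VV = {}" "ratio_prefactor GG a = 1" "dimer_Z GG a canonical_orientation = 1"
proof -
  show VV: "VV = {}" using assms by auto
  have "FO = {}" unfolding set_eq_iff FO_iff using assms by auto
  then show "ratio_prefactor GG a = 1" unfolding prefactor using assms by simp
  show "dimer_Z GG a canonical_orientation = 1" unfolding dimer_Z_canonical VV by simp
qed

lemma (in cone) obtain_flip:
  assumes "II \<noteq> {}"
  obtains f where "flip h px py k f"
proof -
  define m where "m = Min (h ` II)"
  define J where "J = {g \<in> II. h g = m}"
  have m: "m \<in> h ` II" "\<And>g. g \<in> II \<Longrightarrow> m \<le> h g"
    unfolding m_def using finite_internal assms by auto
  have J: "finite J" "J \<noteq> {}" using finite_internal m(1) by (auto simp: J_def)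
  define M where "M = Max ((\<lambda>g. fst g + snd g) ` J)"
  have M: "M \<in> (\<lambda>g. fst g + snd g) ` J" "\<And>g. g \<in> J \<Longrightarrow> fst g + snd g \<le> M"
    unfolding M_def using J by auto
  from M(1) obtain f where f: "M = fst f + snd f" "f \<in> J" by (rule imageE)
  have "flip h px py k f"
  proof
    show "f \<in> II" using f(2) by (simp add: J_def)
    show "h f \<le> h g" if "g \<in> II" for g using f(2) m(2)[OF that] by (simp add: J_def)
    show "fst g + snd g \<le> fst f + snd f" if "g \<in> II" "h g = h f" for g
      using M(2)[of g] that f by (simp add: J_def)
  qed
  then show thesis by (rule that)
qed

text \<open>The factor \<open>r\<close> of a flip multiplies both sides and may be zero, so the
  identity for the flipped graph implies the one for the original graph. The induction is on the
  total amount by which the internal faces lie below \<open>k\<close>. It ends at the flip of the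
  apex, whose new weight \<open>w'\<close> is the value at the top of the cone and whose new graph
  is empty.\<close>

lemma affine_ratio:
  fixes X :: "point \<Rightarrow> complex"
  assumes nz: "\<And>q. X q \<noteq> 0"
    and skp: "\<And>q. q \<notin> even_lattice \<Longrightarrow>
      (X (q - e3) - X (q + e2)) * (X (q - e1) - X (q + e3)) * (X (q - e2) - X (q + e1)) /
      ((X (q + e2) - X (q - e1)) * (X (q + e3) - X (q - e2)) * (X (q + e1) - X (q - e3))) = -1"
    and cone: "cone h px py k" and above: "h (px, py) < k"
  defines "\<And>h. G h \<equiv> cw_graph h (px, py, k)" and "\<And>h g. a h g \<equiv> X (fst g, snd g, h g)"
  shows "\<i> ^ card (vertices (G h)) * ratio_prefactor (G h) (a h) *
      dimer_Z (G h) (\<lambda>g. inverse (a h g)) (heights.canonical_orientation h) =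
    X (px, py, k) * dimer_Z (G h) (a h) (heights.canonical_orientation h)"
  using cone above
proof (induction "\<Sum>g\<in>cw_internal h (px, py, k). nat (k - h g)" arbitrary: h rule: less_induct)
  case less
  interpret cone h px py k by (rule less.prems)
  have "(px, py) \<in> II" using less.prems(2) by (simp add: internal_iff dist1_def)
  then obtain f where "flip h px py k f" using obtain_flip by blast
  then interpret flip h px py k f .
  define w' where "w' = X (fst f, snd f, h f + 2)"
  have a': "(a h)(f := w') = a h'" by (rule ext) (simp add: a_def w'_def h'_def)
  \<comment> \<open>The centre of the octahedron whose bottom and top carry the old and the new
    weight of \<open>f\<close>, and whose other four corners carry the weights of its
    neighbours.\<close>
  define q where "q = (fst f, snd f, h f + 1)"
  have q: "q \<notin> even_lattice" using even_h[of f] by (simp add: q_def even_lattice_def)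
  have v: "a h f = X (q - e3)" "w' = X (q + e3)" "a h (f + dE) = X (q + e1)" "a h (f + dW) = X (q - e1)"
    "a h (f + dN) = X (q + e2)" "a h (f + dS) = X (q - e2)"
    using nbr[OF dirs_in(1)] nbr[OF dirs_in(2)] nbr[OF dirs_in(3)] nbr[OF dirs_in(4)]
    by (simp_all add: a_def w'_def q_def e1_def e2_def e3_def add.commute)
  have s: "(a h f - a h (f + dN)) * (a h (f + dW) - w') * (a h (f + dS) - a h (f + dE)) /
      ((a h (f + dN) - a h (f + dW)) * (w' - a h (f + dS)) * (a h (f + dE) - a h f)) = -1"
    unfolding v by (rule skp[OF q])
  have z: "a h g \<noteq> 0" "w' \<noteq> 0" for g using nz by (simp_all add: a_def w'_def)
  obtain r where r:
    "dimer_Z GG (a h) canonical_orientation = r * dimer_Z new.GG (a h') new.canonical_orientation"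
    "\<i> ^ card VV * ratio_prefactor GG (a h) * dimer_Z GG (\<lambda>g. inverse (a h g)) canonical_orientation =
      r * (if live = {} then w' else 1) * (\<i> ^ card new.VV * ratio_prefactor new.GG (a h') *
        dimer_Z new.GG (\<lambda>g. inverse (a h' g)) new.canonical_orientation)"
    by (rule ratio_flip[of "a h" w', unfolded a', OF z s])
  have V: "vertices (G h) = VV" "vertices (G h') = new.VV" by (simp_all add: G_def cw_graph_def)
  show ?case
  proof (cases "live = {}")
    case True
    note l = live_empty[OF True]
    note e = new.ratio_empty[OF l(3)]
    have "w' = X (px, py, k)" using l(2) unfolding w'_def l(1) by simp
    then show ?thesis using r True unfolding V unfolding G_def by (simp add: e)
  next
    case False
    \<comment> \<open>The apex stays below \<open>p\<close> while a corner is live: if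
      \<open>f\<close> is the apex, an internal neighbour has distance 1 and height
      \<open>h f + 1\<close>, which leaves room for raising \<open>f\<close> by 2.\<close>
    have lt: "h' (px, py) < k"
    proof (cases "f = (px, py)")
      case True
      obtain \<delta> where d: "\<delta> \<in> dirs" "f + \<delta> \<in> II"
        using False rot_in_dirs unfolding live_def by blast
      then have "h f + 2 < k"
        using nbr[OF d(1)] dist1_step[OF d(1), of f] True unfolding internal_iff by (auto simp: dist1_def)
      then show ?thesis using True h'_simps(1) by simp
    next
      case False
      then have "(px, py) \<noteq> f" by blast
      then show ?thesis using less.prems(2) h'_simps(2)[of "(px, py)"] by simp
    qed
    have sub: "new.II \<subseteq> II"
    proof
      fix g assume "g \<in> new.II"
      then show "g \<in> II" using new_II f_int by (cases "g = f") simp_all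
    qed
    have "(\<Sum>g\<in>new.II. nat (k - h' g)) \<le> (\<Sum>g\<in>II. nat (k - h' g))"
      by (rule sum_mono2[OF finite_internal sub]) simp
    also have "\<dots> < (\<Sum>g\<in>II. nat (k - h g))"
    proof (rule sum_strict_mono_ex1[OF finite_internal])
      show "\<forall>g\<in>II. nat (k - h' g) \<le> nat (k - h g)" by (auto simp: h'_def)
      have "h f < k" using f_int by (simp add: internal_iff dist1_def)
      then show "\<exists>g\<in>II. nat (k - h' g) < nat (k - h g)" using f_int by (intro bexI[of _ f]) simp_all
    qed
    finally have "(\<Sum>g\<in>new.II. nat (k - h' g)) < (\<Sum>g\<in>II. nat (k - h g))" .
    note IH = less.hyps[OF this new.cone_axioms lt]
    show ?thesis
      using r False IH unfolding V unfolding G_def by simp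
  qed
qed

section \<open>Solutions on the sphere\<close>

lemma height_function_cone:
  assumes h: "height_function h" and p: "(px, py, k) \<in> upper_region h"
  shows "cone h px py k" "h (px, py) < k"
proof -
  have ev: "even (i + j + h (i, j))" for i j
    using h by (auto simp: height_function_def even_lattice_def)
  have st: "\<bar>h (i, j) - h (i', j')\<bar> = 1" if "\<bar>i - i'\<bar> + \<bar>j - j'\<bar> = 1" for i j i' j'
    using h that unfolding height_function_def by blast
  have lim: "filterlim (\<lambda>(i, j). h (i, j) + \<bar>i\<bar> + \<bar>j\<bar>) at_top (filtercomap (\<lambda>(i, j). \<bar>i\<bar> + \<bar>j\<bar>) at_top)"
    using h unfolding height_function_def by blast
  show "h (px, py) < k" using p by (simp add: upper_region_def)
  show "cone h px py k"
  proof
    fix \<delta> g assume "\<delta> \<in> dirs"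
    then show "\<bar>h (g + \<delta>) - h g\<bar> = 1"
      by (cases g; elim dirs_cases; simp; intro st; simp)
  next
    fix g show "even (fst g + snd g + h g)" using ev[of "fst g" "snd g"] by simp
  next
    show "even (px + py + k)" using p by (simp add: upper_region_def even_lattice_def)
  next
    have "\<forall>\<^sub>F g in filtercomap (\<lambda>(i, j). \<bar>i\<bar> + \<bar>j\<bar>) at_top. k + \<bar>px\<bar> + \<bar>py\<bar> \<le> (case g of (i, j) \<Rightarrow> h (i, j) + \<bar>i\<bar> + \<bar>j\<bar>)"
      using lim unfolding filterlim_at_top by blast
    then obtain N where N: "\<And>i j. N \<le> \<bar>i\<bar> + \<bar>j\<bar> \<Longrightarrow> k + \<bar>px\<bar> + \<bar>py\<bar> \<le> h (i, j) + \<bar>i\<bar> + \<bar>j\<bar>"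
      unfolding eventually_filtercomap_at_top_linorder by auto
    \<comment> \<open>By the triangle inequality, a face with
      \<open>N \<le> \<bar>i\<bar> + \<bar>j\<bar>\<close> has level at least \<open>k\<close>. The
      bounds use the absolute value as \<open>N\<close> may be negative.\<close>
    have "cw_internal h (px, py, k) \<subseteq> {- \<bar>N\<bar>..\<bar>N\<bar>} \<times> {- \<bar>N\<bar>..\<bar>N\<bar>}"
    proof
      fix g assume g: "g \<in> cw_internal h (px, py, k)"
      obtain i j where ij: "g = (i, j)" by (cases g)
      have "h (i, j) < k - \<bar>px - i\<bar> - \<bar>py - j\<bar>" using g by (simp add: ij cw_internal_def)
      then have "\<not> N \<le> \<bar>i\<bar> + \<bar>j\<bar>" using N[of i j] by linarith
      then show "g \<in> {- \<bar>N\<bar>..\<bar>N\<bar>} \<times> {- \<bar>N\<bar>..\<bar>N\<bar>}" by (auto simp: ij)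
    qed
    then show "finite (cw_internal h (px, py, k))" by (rule finite_subset) simp
  qed
qed

text \<open>This moves \<open>[u : v]\<close> to \<open>[u + t v : v + t u]\<close> and multiplies \<^const>\<open>sdiff\<close> by \<open>1 - t\<^sup>2\<close>, so that
  solutions remain solutions.\<close>

definition perturb :: "complex \<Rightarrow> sphere \<Rightarrow> complex \<times> complex" where
  "perturb t z = (fst (homog z) + t * snd (homog z), snd (homog z) + t * fst (homog z))"

lemma perturb_0 [simp]: "perturb 0 z = homog z"
  by (simp add: perturb_def)

lemma perturb_ne: "t \<noteq> 0 \<Longrightarrow> perturb t z \<noteq> homog z"
  by (cases z) (simp_all add: perturb_def)

lemma perturb_nonzero:
  obtains B where "finite B" "\<And>t. t \<notin> B \<Longrightarrow> fst (perturb t z) \<noteq> 0 \<and> snd (perturb t z) \<noteq> 0"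
proof (cases z)
  case None
  then show thesis by (intro that[of "{0}"]) (simp_all add: perturb_def)
next
  case (Some c)
  \<comment> \<open>The exceptional values are the zeros of \<open>c + t\<close> and of
    \<open>1 + t * c\<close>. For \<open>c = 0\<close> the second coordinate is constantly 1, and
    the default \<open>inverse 0 = 0\<close> adds nothing to the set.\<close>
  show thesis
  proof (rule that[of "{- c, - inverse c}"])
    fix t assume t: "t \<notin> {- c, - inverse c}"
    have "1 + t * c \<noteq> 0"
    proof
      assume "1 + t * c = 0"
      then have "t * c = - 1" by (simp add: add_eq_0_iff)
      moreover from this have "c \<noteq> 0" by auto
      ultimately have "t = - 1 / c" by (intro eq_divide_imp)
      then show False using t by (simp add: divide_inverse)
    qed
    then show "fst (perturb t z) \<noteq> 0 \<and> snd (perturb t z) \<noteq> 0"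
      using t by (simp add: Some perturb_def add_eq_0_iff)
  qed simp
qed

lemma perturb_diff:
  assumes "snd (perturb t z) \<noteq> 0" "snd (perturb t w) \<noteq> 0"
  shows "fst (perturb t z) / snd (perturb t z) - fst (perturb t w) / snd (perturb t w) =
    (1 - t\<^sup>2) * sdiff z w / (snd (perturb t z) * snd (perturb t w))"
proof -
  have "fst (perturb t z) * snd (perturb t w) - fst (perturb t w) * snd (perturb t z) = (1 - t\<^sup>2) * sdiff z w"
    by (simp add: perturb_def sdiff_def algebra_simps power2_eq_square)
  then show ?thesis using assms by (simp add: diff_frac_eq)
qed

text \<open>Three differences stand above and three below, so the factors
  \<open>1 - t\<^sup>2\<close> cancel; each point occurs once above and once below, so the
  denominators cancel too.\<close>

lemma perturb_dSKP:
  assumes x: "dSKP x" and q: "q \<notin> even_lattice" and t: "t\<^sup>2 \<noteq> 1" and nz: "\<And>q. snd (perturb t (x q)) \<noteq> 0"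
  defines "X \<equiv> \<lambda>q. fst (perturb t (x q)) / snd (perturb t (x q))"
  shows "(X (q - e3) - X (q + e2)) * (X (q - e1) - X (q + e3)) * (X (q - e2) - X (q + e1)) /
      ((X (q + e2) - X (q - e1)) * (X (q + e3) - X (q - e2)) * (X (q + e1) - X (q - e3))) = -1"
proof -
  define d where "d r = snd (perturb t (x r))" for r
  have X: "X r - X r' = (1 - t\<^sup>2) * sdiff (x r) (x r') / (d r * d r')" for r r'
    unfolding X_def d_def by (rule perturb_diff[OF nz nz])
  have "1 - t\<^sup>2 \<noteq> 0" "\<And>r. d r \<noteq> 0" using t nz by (simp_all add: d_def)
  then have "(X (q - e3) - X (q + e2)) * (X (q - e1) - X (q + e3)) * (X (q - e2) - X (q + e1)) /
      ((X (q + e2) - X (q - e1)) * (X (q + e3) - X (q - e2)) * (X (q + e1) - X (q - e3))) =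
     (sdiff (x (q - e3)) (x (q + e2)) * sdiff (x (q - e1)) (x (q + e3)) * sdiff (x (q - e2)) (x (q + e1))) /
     (sdiff (x (q + e2)) (x (q - e1)) * sdiff (x (q + e3)) (x (q - e2)) * sdiff (x (q + e1)) (x (q - e3)))"
    unfolding X by (simp add: mult.assoc)
  then show ?thesis using x q unfolding dSKP_def by metis
qed

lemma islimpt_countable_complement:
  fixes z :: complex
  assumes "countable B"
  shows "z islimpt - B"
proof (rule islimptI)
  fix T assume "z \<in> T" "open T"
  then obtain r where r: "r > 0" "ball z r \<subseteq> T" by (meson open_contains_ball)
  have "uncountable (ball z r)" using r(1) by (rule uncountable_ball)
  then have "\<not> ball z r \<subseteq> insert z B" using assms by (meson countable_insert countable_subset)
  then show "\<exists>y\<in>- B. y \<in> T \<and> y \<noteq> z" using r(2) by blast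
qed

context cone
begin

lemma prefactor_divide:
  assumes "\<And>g. v g \<noteq> 0"
  shows "ratio_prefactor GG (\<lambda>g. u g / v g) * ratio_prefactor GG v = ratio_prefactor GG u"
  unfolding prefactor prod.distrib[symmetric] using assms by (simp add: power_divide)

text \<open>The curve \<open>w t\<close> of perturbed weights has two uses. It shows that the
  weights at \<open>t = 0\<close> are a limit point of the admissible ones, so that the limit in
  \<open>ratio_coords\<close> is given by the polynomials \<open>P\<close> and \<open>Q\<close>. And
  it carries the identity of \<open>affine_ratio\<close>, multiplied out, to
  \<open>t = 0\<close>.\<close>

lemma ratio_coords_solution:
  assumes x: "dSKP x" and above: "h (px, py) < k" and K: "Kasteleyn_orientation GG \<phi>"
  defines "a \<equiv> \<lambda>g. x (fst g, snd g, h g)"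
  shows "fst (ratio_coords GG a \<phi>) * snd (homog (x (px, py, k))) =
    snd (ratio_coords GG a \<phi>) * fst (homog (x (px, py, k)))"
proof -
  define S where "S = {w :: face \<Rightarrow> complex \<times> complex. \<forall>f. fst (w f) \<noteq> 0 \<and> snd (w f) \<noteq> 0}"
  define w where "w t g = perturb t (a g)" for t g
  define P where "P w = \<i> ^ card (vertices GG) * hom_poly \<phi> (\<lambda>f. snd (w f)) (\<lambda>f. fst (w f))" for w :: "face \<Rightarrow> complex \<times> complex"
  define Q where "Q w = hom_poly \<phi> (\<lambda>f. fst (w f)) (\<lambda>f. snd (w f))" for w :: "face \<Rightarrow> complex \<times> complex"
  have PQ: "ratio_fraction GG \<phi> v = (P v, Q v)" if "v \<in> S" for v
    unfolding P_def Q_def by (rule ratio_fraction_hom_poly[OF K]) (use that in \<open>unfold S_def, blast\<close>)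
  have lim: "((\<lambda>s. P (v s)) \<longlongrightarrow> P v0) F" "((\<lambda>s. Q (v s)) \<longlongrightarrow> Q v0) F"
    if "\<And>g. ((\<lambda>s. v s g) \<longlongrightarrow> v0 g) F" for v :: "'s \<Rightarrow> face \<Rightarrow> complex \<times> complex" and v0 F
    unfolding P_def Q_def
    by (intro tendsto_mult tendsto_const tendsto_hom_poly tendsto_fst tendsto_snd that)+
  have "\<exists>B. \<forall>q. finite (B q) \<and> (\<forall>t. t \<notin> B q \<longrightarrow> fst (perturb t (x q)) \<noteq> 0 \<and> snd (perturb t (x q)) \<noteq> 0)"
    using perturb_nonzero by (intro choice) metis
  then obtain B where B: "\<And>q. finite (B q)"
    "\<And>q t. t \<notin> B q \<Longrightarrow> fst (perturb t (x q)) \<noteq> 0 \<and> snd (perturb t (x q)) \<noteq> 0" by blast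
  \<comment> \<open>All lattice points must avoid zeros and poles simultaneously, so the exceptional
    set is only countable. The values 1 and -1 are excluded because \<open>1 - t\<^sup>2\<close>
    vanishes there, and 0 because it is the limit point.\<close>
  define C where "C = {0, 1, - 1} \<union> (\<Union>q. B q)"
  have C: "countable C" unfolding C_def using B(1) by (simp add: countable_finite)
  have nz: "fst (perturb t (x q)) \<noteq> 0" "snd (perturb t (x q)) \<noteq> 0" if "t \<notin> C" for t q
  proof -
    have "t \<notin> B q" using that unfolding C_def by blast
    then show "fst (perturb t (x q)) \<noteq> 0" "snd (perturb t (x q)) \<noteq> 0" using B(2) by blast+
  qed
  have wS: "w t \<in> S" if "t \<notin> C" for t using nz[OF that] by (simp add: S_def w_def a_def)
  have cont: "continuous_on UNIV w"
    unfolding w_def[abs_def] perturb_def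
    by (intro continuous_on_coordinatewise_then_product continuous_intros)
  have key: "P (w t) * snd (perturb t (x (px, py, k))) = Q (w t) * fst (perturb t (x (px, py, k)))" if t: "t \<notin> C" for t
  proof -
    define X where "X q = fst (perturb t (x q)) / snd (perturb t (x q))" for q
    define b where "b g = X (fst g, snd g, h g)" for g
    define u v where "u g = fst (w t g)" and "v g = snd (w t g)" for g
    have t1: "t\<^sup>2 \<noteq> 1" using t by (auto simp: C_def power2_eq_1_iff)
    have Z0: "\<i> ^ card (vertices GG) * ratio_prefactor GG b *
        dimer_Z GG (\<lambda>g. inverse (b g)) canonical_orientation = X (px, py, k) * dimer_Z GG b canonical_orientation"
      unfolding b_def
    proof (rule affine_ratio)
      show "X q \<noteq> 0" for q using nz[OF t] by (simp add: X_def)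
      show "(X (q - e3) - X (q + e2)) * (X (q - e1) - X (q + e3)) * (X (q - e2) - X (q + e1)) /
        ((X (q + e2) - X (q - e1)) * (X (q + e3) - X (q - e2)) * (X (q + e1) - X (q - e3))) = -1" if "q \<notin> even_lattice" for q
        unfolding X_def by (rule perturb_dSKP[OF x that t1 nz(2)[OF t]])
    qed (rule cone_axioms, rule above)
    obtain s where s: "\<And>c. dimer_Z GG c \<phi> = s * dimer_Z GG c canonical_orientation"
      using dimer_Z_Kasteleyn[OF K] by metis
    have Z: "\<i> ^ card (vertices GG) * ratio_prefactor GG b * dimer_Z GG (\<lambda>g. inverse (b g)) \<phi> =
        X (px, py, k) * dimer_Z GG b \<phi>"
      unfolding s using arg_cong[OF Z0, of "\<lambda>z. s * z"] by (simp only: mult_ac)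
    have vz: "v g \<noteq> 0" for g using nz(2)[OF t] by (simp add: v_def w_def a_def)
    have b: "b = (\<lambda>g. u g / v g)" "(\<lambda>g. inverse (b g)) = (\<lambda>g. v g / u g)"
      by (simp_all add: fun_eq_iff b_def X_def u_def v_def w_def a_def)
    have "(P (w t), Q (w t)) = ratio_fraction GG \<phi> (w t)" by (rule PQ[OF wS[OF t], symmetric])
    then have PQt: "P (w t) = \<i> ^ card (vertices GG) * ratio_prefactor GG u * dimer_Z GG (\<lambda>g. inverse (b g)) \<phi>"
      "Q (w t) = ratio_prefactor GG v * dimer_Z GG b \<phi>"
      unfolding ratio_fraction_def b u_def v_def by simp_all
    have pb: "ratio_prefactor GG b * ratio_prefactor GG v = ratio_prefactor GG u"
      unfolding b(1) by (rule prefactor_divide[OF vz])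
    have "P (w t) = (\<i> ^ card (vertices GG) * ratio_prefactor GG b * dimer_Z GG (\<lambda>g. inverse (b g)) \<phi>) * ratio_prefactor GG v"
      unfolding PQt pb[symmetric] by (simp only: mult_ac)
    also have "\<dots> = X (px, py, k) * Q (w t)" unfolding Z PQt by (simp only: ac_simps)
    finally show ?thesis using nz(2)[OF t, of "(px, py, k)"] by (simp add: X_def)
  qed
  have w0: "w 0 = (\<lambda>f. homog (a f))" by (simp add: fun_eq_iff w_def)
  have "w 0 islimpt S"
  proof (rule islimptI)
    fix T assume T: "w 0 \<in> T" "open T"
    have "open (w -` T)" using cont T(2) by (simp add: continuous_on_open_vimage)
    then obtain t where t: "t \<in> - C" "t \<in> w -` T"
      using islimptE[OF islimpt_countable_complement[OF C], of 0 "w -` T"] T(1) by auto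
    have "t \<noteq> 0" using t(1) by (auto simp: C_def)
    \<comment> \<open>Any face would do: a nonzero \<open>t\<close> changes the representative of
      every point of the sphere.\<close>
    then have "w t (0, 0) \<noteq> w 0 (0, 0)" by (simp add: w_def perturb_ne)
    then show "\<exists>y\<in>S. y \<in> T \<and> y \<noteq> w 0" using wS[of t] t by (intro bexI[of _ "w t"]) auto
  qed
  then have nontriv: "at (w 0) within S \<noteq> bot" by (simp add: trivial_limit_within)
  have coord: "((\<lambda>v. v f) \<longlongrightarrow> w 0 f) (at (w 0) within S)" for f
    using continuous_on_product_coordinates[of f]
    by (metis UNIV_I continuous_on_def tendsto_within_subset top_greatest)
  have "((\<lambda>v. (P v, Q v)) \<longlongrightarrow> (P (w 0), Q (w 0))) (at (w 0) within S)"
    using lim[OF coord] by (intro tendsto_Pair)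
  moreover have "\<forall>\<^sub>F v in at (w 0) within S. (P v, Q v) = ratio_fraction GG \<phi> v"
    unfolding eventually_at_filter using PQ by (intro always_eventually) simp
  ultimately have "(ratio_fraction GG \<phi> \<longlongrightarrow> (P (w 0), Q (w 0))) (at (w 0) within S)"
    by (rule Lim_transform_eventually)
  then have rc: "ratio_coords GG a \<phi> = (P (w 0), Q (w 0))"
    unfolding ratio_coords_def S_def[symmetric] w0[symmetric] by (rule tendsto_Lim[OF nontriv])
  define F where "F = at 0 within - C"
  have F: "F \<noteq> bot" using islimpt_countable_complement[OF C] by (simp add: F_def trivial_limit_within)
  have pt: "((\<lambda>t. perturb t z) \<longlongrightarrow> perturb 0 z) F" for z
    unfolding perturb_def F_def by (intro tendsto_intros)
  have wt: "((\<lambda>t. w t g) \<longlongrightarrow> w 0 g) F" for g unfolding w_def by (rule pt)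
  have L: "((\<lambda>t. P (w t) * snd (perturb t (x (px, py, k)))) \<longlongrightarrow> P (w 0) * snd (homog (x (px, py, k)))) F"
    using tendsto_mult[OF lim(1)[OF wt] tendsto_snd[OF pt[of "x (px, py, k)"]]] by simp
  have R: "((\<lambda>t. Q (w t) * fst (perturb t (x (px, py, k)))) \<longlongrightarrow> Q (w 0) * fst (homog (x (px, py, k)))) F"
    using tendsto_mult[OF lim(2)[OF wt] tendsto_fst[OF pt[of "x (px, py, k)"]]] by simp
  have "\<forall>\<^sub>F t in F. Q (w t) * fst (perturb t (x (px, py, k))) = P (w t) * snd (perturb t (x (px, py, k)))"
    unfolding F_def eventually_at_filter using key by (intro always_eventually) simp
  then have "((\<lambda>t. P (w t) * snd (perturb t (x (px, py, k)))) \<longlongrightarrow> Q (w 0) * fst (homog (x (px, py, k)))) F"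
    by (rule Lim_transform_eventually[OF R])
  from tendsto_unique[OF F L this] show ?thesis by (simp add: rc)
qed

end

text \<open>The equation says that \<open>w\<close> is proportional to \<open>homog z\<close>; with
  both vectors nonzero they represent the same point. Excluding \<open>(0, 0)\<close> is the role of
  \<open>ratio_defined\<close>.\<close>

lemma of_homog_eqI:
  assumes "w \<noteq> (0, 0)" "fst w * snd (homog z) = snd w * fst (homog z)"
  shows "of_homog w = z"
  using assms by (cases z; cases w) (auto simp: of_homog_def)

theorem theorem3p4:
  fixes x :: "point \<Rightarrow> sphere" and h :: "face \<Rightarrow> int" and a :: "face \<Rightarrow> sphere" and p :: point
  assumes "dSKP x"
    and "height_function h"
    and "\<And>i j. a (i, j) = x (i, j, h (i, j))"
    and "p \<in> upper_region h"
    and "ratio_defined (cw_graph h p) a"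
  shows "x p = ratio_function (cw_graph h p) a"
proof -
  obtain px py k where p: "p = (px, py, k)" by (cases p)
  note cone = height_function_cone[OF assms(2) assms(4)[unfolded p]]
  interpret cone h px py k by (rule cone)
  have a: "a = (\<lambda>g. x (fst g, snd g, h g))" using assms(3) by (simp add: fun_eq_iff)
  define \<phi> where "\<phi> = (SOME \<phi>. Kasteleyn_orientation GG \<phi>)"
  have "Kasteleyn_orientation GG \<phi>"
    unfolding \<phi>_def by (rule someI[of _ canonical_orientation]) (rule Kasteleyn_canonical)
  then have "fst (ratio_coords GG a \<phi>) * snd (homog (x p)) = snd (ratio_coords GG a \<phi>) * fst (homog (x p))"
    unfolding a p by (rule ratio_coords_solution[OF assms(1) cone(2)])
  moreover have "ratio_coords GG a \<phi> \<noteq> (0, 0)"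
    using assms(5) unfolding ratio_defined_def \<phi>_def p .
  ultimately have "of_homog (ratio_coords GG a \<phi>) = x p" by (intro of_homog_eqI)
  then show ?thesis unfolding ratio_function_def \<phi>_def p by simp
qed

end
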